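(* Let $c$ be a nonzero integer and $P\in\mathbb{Z}[y_1,\ldots,y_k]$ a polynomial with no constant term, and consider the equation $c\,(x_1-x_2)=P(y_1,\ldots,y_k)$. If $A\subseteq\mathbb{N}$ is IP-large and has positive Banach density, then there exist $\xi_1,\xi_2\in A$ and mutually distinct $\eta_1,\ldots,\eta_k\in A$ such that $c\,(\xi_1-\xi_2)=P(\eta_1,\ldots,\eta_k)$. Moreover, if $k=1$ then one can take $\xi_1\ne\xi_2$.
   Context: $\mathbb{N}$ is the set of positive integers. A set $A\subseteq\mathbb{N}$ is IP-large if there is an increasing sequence $(g_i)_{i\in\mathbb{N}}$ of natural numbers with $\{\sum_{j=1}^m g_{i_j}\mid m\ge1,\ i_1<\ldots<i_m\}\subseteq A$. The Banach density of $E\subseteq\mathbb{Z}$ is the greatest value of $\limsup_{n\to\infty}|E\cap[a_n,b_n]|/(b_n-a_n+1)$ over all sequences of intervals $[a_n,b_n]$ with $b_n-a_n\to+\infty$.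
   Formalization: In the "moreover" part for k=1 the polynomial P is additionally assumed to be nonzero, since for P=0 the equation c(x_1-x_2)=0 with c nonzero forces ξ_1=ξ_2. *)

theory Defs
  imports "HOL-Library.Extended_Real" "HOL-Library.Poly_Mapping"
begin

(* Finite sums sum_{j<=m} g_{i_j} with m >= 1 and i_1 < ... < i_m are the sums over finite
   nonempty index sets. Sequences are indexed from 0 rather than from 1; sets of positive
   integers are sets A :: nat set with A <= {1..}. *)
definition finite_sums :: "(nat \<Rightarrow> nat) \<Rightarrow> nat set" where
  "finite_sums g = {\<Sum>i\<in>F. g i | F. finite F \<and> F \<noteq> {}}"

definition IP_large :: "nat set \<Rightarrow> bool" where
  "IP_large A \<longleftrightarrow> (\<exists>g. strict_mono g \<and> (\<forall>i. 0 < g i) \<and> finite_sums g \<subseteq> A)"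

definition interval_seq :: "(nat \<Rightarrow> int) \<Rightarrow> (nat \<Rightarrow> int) \<Rightarrow> bool" where
  "interval_seq a b \<longleftrightarrow>
     (\<forall>n. a n \<le> b n) \<and> filterlim (\<lambda>n. b n - a n) at_top sequentially"

definition density_along :: "int set \<Rightarrow> (nat \<Rightarrow> int) \<Rightarrow> (nat \<Rightarrow> int) \<Rightarrow> ereal" where
  "density_along E a b =
     limsup (\<lambda>n. ereal (real (card (E \<inter> {a n..b n})) / real_of_int (b n - a n + 1)))"

(* Defined as a supremum; banach_density_attained below shows that it is a maximum. *)
definition banach_density :: "int set \<Rightarrow> ereal" where
  "banach_density E = Sup {density_along E a b | a b. interval_seq a b}"

lemma density_along_bounds:
  assumes "interval_seq a b"
  shows "0 \<le> density_along E a b" and "density_along E a b \<le> 1"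
proof -
  have *: "0 \<le> ereal (real (card (E \<inter> {a n..b n})) / real_of_int (b n - a n + 1)) \<and>
           ereal (real (card (E \<inter> {a n..b n})) / real_of_int (b n - a n + 1)) \<le> 1" for n
  proof -
    have ab: "a n \<le> b n" using assms by (simp add: interval_seq_def)
    have "card (E \<inter> {a n..b n}) \<le> card {a n..b n}" by (intro card_mono) auto
    also have "\<dots> = nat (b n - a n + 1)" by simp
    finally have "real (card (E \<inter> {a n..b n})) \<le> real_of_int (b n - a n + 1)"
      using ab by linarith
    moreover have "0 < real_of_int (b n - a n + 1)" using ab by linarith
    ultimately show ?thesis by (simp add: one_ereal_def zero_ereal_def del: of_int_add of_int_diff)
  qed
  show "0 \<le> density_along E a b"
    unfolding density_along_def by (rule le_Limsup) (use * in auto)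
  show "density_along E a b \<le> 1"
    unfolding density_along_def by (rule Limsup_bounded) (use * in auto)
qed

lemma banach_density_attained:
  "\<exists>a b. interval_seq a b \<and> density_along E a b = banach_density E"
proof -
  let ?r = "\<lambda>x y. ereal (real (card (E \<inter> {x..y})) / real_of_int (y - x + 1))"
  have upper: "density_along E a b \<le> banach_density E" if "interval_seq a b" for a b
    unfolding banach_density_def using that by (intro Sup_upper) auto
  have "filterlim (\<lambda>n. int n) at_top sequentially"
    by (simp add: filterlim_int_sequentially)
  then have ex: "interval_seq (\<lambda>n. 0) int"
    by (simp add: interval_seq_def)
  have "banach_density E \<le> 1"
    unfolding banach_density_def by (intro Sup_least) (auto intro: density_along_bounds)
  moreover have "0 \<le> banach_density E"
    using density_along_bounds(1)[OF ex] upper[OF ex] by (rule order_trans)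
  ultimately obtain s where s: "banach_density E = ereal s"
    by (cases "banach_density E") auto
  have "\<exists>x y. x \<le> y \<and> int k \<le> y - x \<and> ereal (s - 1 / real (Suc k)) < ?r x y" for k
  proof -
    have "ereal (s - 1 / real (Suc k)) < banach_density E" using s by simp
    then obtain a b where ab: "interval_seq a b"
      and lt: "ereal (s - 1 / real (Suc k)) < density_along E a b"
      unfolding banach_density_def less_Sup_iff by auto
    have "\<exists>\<^sub>F n in sequentially. ereal (s - 1 / real (Suc k)) < ?r (a n) (b n)"
    proof (rule ccontr)
      assume "\<not> ?thesis"
      then have "\<forall>\<^sub>F n in sequentially. ?r (a n) (b n) \<le> ereal (s - 1 / real (Suc k))"
        by (simp add: frequently_def not_less)
      then have "density_along E a b \<le> ereal (s - 1 / real (Suc k))"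
        unfolding density_along_def by (rule Limsup_bounded)
      with lt show False by simp
    qed
    moreover have "\<forall>\<^sub>F n in sequentially. int k \<le> b n - a n"
      using ab by (auto simp: interval_seq_def filterlim_at_top)
    ultimately obtain n where "ereal (s - 1 / real (Suc k)) < ?r (a n) (b n)" "int k \<le> b n - a n"
      using frequently_ex[OF frequently_eventually_conj] by (metis (no_types, lifting))
    moreover have "a n \<le> b n" using ab by (simp add: interval_seq_def)
    ultimately show ?thesis by blast
  qed
  then obtain a b where ab: "\<And>k. a k \<le> b k" "\<And>k. int k \<le> b k - a k"
      "\<And>k. ereal (s - 1 / real (Suc k)) < ?r (a k) (b k)"
    by metis
  have "filterlim (\<lambda>k. b k - a k) at_top sequentially"
    by (rule filterlim_at_top_mono[OF filterlim_int_sequentially]) (use ab in auto)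
  then have I: "interval_seq a b" using ab by (simp add: interval_seq_def)
  have "(\<lambda>k. s - 1 / real (Suc k)) \<longlonglongrightarrow> s - 0"
    by (intro tendsto_diff tendsto_const LIMSEQ_Suc[OF lim_1_over_n])
  then have "(\<lambda>k. ereal (s - 1 / real (Suc k))) \<longlonglongrightarrow> ereal s"
    by (simp add: lim_ereal)
  then have "ereal s = limsup (\<lambda>k. ereal (s - 1 / real (Suc k)))"
    by (metis lim_imp_Limsup sequentially_bot)
  also have "\<dots> \<le> density_along E a b"
    unfolding density_along_def
    by (rule Limsup_mono, rule always_eventually) (use ab(3) less_imp_le in blast)
  finally show ?thesis using I upper[OF I] s by (intro exI[of _ a] exI[of _ b]) auto
qed

(* A polynomial maps exponent vectors (monomials) to coefficients; the monomial 0 is the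
   constant one, so Poly_Mapping.lookup P 0 is the constant term. *)
type_synonym int_mpoly = "(nat \<Rightarrow>\<^sub>0 nat) \<Rightarrow>\<^sub>0 int"

definition mpoly_vars :: "int_mpoly \<Rightarrow> nat set" where
  "mpoly_vars P = (\<Union>m\<in>Poly_Mapping.keys P. Poly_Mapping.keys m)"

definition mpoly_eval :: "int_mpoly \<Rightarrow> (nat \<Rightarrow> int) \<Rightarrow> int" where
  "mpoly_eval P y =
     (\<Sum>m\<in>Poly_Mapping.keys P. Poly_Mapping.lookup P m *
        (\<Prod>i\<in>Poly_Mapping.keys m. y i ^ Poly_Mapping.lookup m i))"

end

theory Submission
  imports Defs "HOL-Probability.Probability" "HOL-Computational_Algebra.Polynomial"
begin

text \<open>
  Suppose no value \<open>P(\<eta>) / c\<close> is a difference of two elements of \<open>A\<close>, where \<open>\<eta>\<close> ranges over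
  \<open>k\<close>-tuples of sums over a common finite index set \<open>\<alpha>\<close>, formed from \<open>k\<close> disjoint subsequences
  of an IP set whose terms are divisible by \<open>c\<close>. Since \<open>A\<close> has positive density, a weak limit of
  normalised squared Fourier transforms of \<open>1\<^sub>A - d\<close>, with \<open>d\<close> the density of \<open>A\<close>, on long
  intervals is a probability measure \<open>M\<close> with \<open>\<integral> cos (2\<pi>tx) dM \<le> - d\<^sup>2\<close> at each such value \<open>t\<close>. This contradicts the following
  fact: along an idempotent ultrafilter on the finite subsets \<open>\<alpha>\<close>, the characters
  \<open>exp (2\<pi>i x P(\<eta>(\<alpha>)) / c)\<close> converge weakly in \<open>L\<^sup>2(M)\<close> to the indicator function of a set,
  so the limit of their integrals is nonnegative.

  The weak limit is found by induction on the degree. The set functions of lower degree form a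
  finitely generated group, and by the ascending chain condition the sets attached to
  the differences of \<open>P(\<eta>(\<alpha>))\<close> by \<open>\<beta>\<close> converge to a set \<open>B\<close> as \<open>\<beta>\<close> runs
  through the ultrafilter. On \<open>B\<close> idempotence makes the weak limit \<open>Q\<close> satisfy \<open>Q\<^sup>2 = Q\<close>; off \<open>B\<close>
  it vanishes by van der Corput's argument.
\<close>

section \<open>Idempotent ultrafilters on finite sets\<close>

text \<open>The obstacle is that a weak limit of products is not the product of the weak limits,
  while the increment of P(\<eta>) from \<alpha> to \<beta> \<union> \<alpha> adds to the characters
  of \<beta> and \<alpha> a third factor that again depends on both sets. What saves the induction
  is that a unimodular function tending weakly to 1 on a set tends to 1 there in norm, because |f -
  1|^2 = 2 (1 - Re f); on its limit set the third factor can then be replaced by 1. This is why the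
  limits are shown to be indicator functions in every degree, and not merely to have a nonnegative
  integral. It also makes the coefficient vectors whose limit set contains a given set, up to a null
  set, a group, to which the chain condition applies.

  The density is subtracted from the indicator of A because without it the coefficient at a missed
  difference would only be 0, which a nonnegative limit allows. Divisibility by c makes P(\<eta>) /
  c an integer, the only kind of frequency at which the spectral measure is controlled. The
  ultrafilter provides all limits at once, for every test function, where subsequences would have to
  be extracted repeatedly.\<close>

definition filter_Un :: "'a set filter \<Rightarrow> 'a set filter \<Rightarrow> 'a set filter" where
  "filter_Un F G = Abs_filter (\<lambda>P. \<forall>\<^sub>F \<beta> in F. \<forall>\<^sub>F \<alpha> in G. P (\<beta> \<union> \<alpha>))"

text \<open>On ultrafilters this is the product in the Stone-Cech compactification of the semigroup
  of sets under union. A general filter stands for the closed set of ultrafilters below it, so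
  closed subsemigroups can be handled without a topology on ultrafilters.\<close>

lemma eventually_filter_Un:
  "eventually P (filter_Un F G) \<longleftrightarrow> (\<forall>\<^sub>F \<beta> in F. \<forall>\<^sub>F \<alpha> in G. P (\<beta> \<union> \<alpha>))"
  unfolding filter_Un_def
proof (rule eventually_Abs_filter, rule is_filter.intro)
  fix P Q :: "'a set \<Rightarrow> bool"
  show "\<forall>\<^sub>F \<beta> in F. \<forall>\<^sub>F \<alpha> in G. P (\<beta> \<union> \<alpha>) \<and> Q (\<beta> \<union> \<alpha>)"
    if "\<forall>\<^sub>F \<beta> in F. \<forall>\<^sub>F \<alpha> in G. P (\<beta> \<union> \<alpha>)" "\<forall>\<^sub>F \<beta> in F. \<forall>\<^sub>F \<alpha> in G. Q (\<beta> \<union> \<alpha>)"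
    using that by eventually_elim (rule eventually_conj)
  show "\<forall>\<^sub>F \<beta> in F. \<forall>\<^sub>F \<alpha> in G. Q (\<beta> \<union> \<alpha>)"
    if "\<forall>x. P x \<longrightarrow> Q x" "\<forall>\<^sub>F \<beta> in F. \<forall>\<^sub>F \<alpha> in G. P (\<beta> \<union> \<alpha>)"
    using that(2) by eventually_elim (use that(1) in \<open>auto elim: eventually_mono\<close>)
qed auto

lemma filter_Un_assoc: "filter_Un (filter_Un F G) H = filter_Un F (filter_Un G H)"
  by (simp add: filter_eq_iff eventually_filter_Un Un_assoc)

lemma filter_Un_mono: "F \<le> F' \<Longrightarrow> G \<le> G' \<Longrightarrow> filter_Un F G \<le> filter_Un F' G'"
  unfolding le_filter_def eventually_filter_Un by (blast intro: eventually_mono)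

lemma filter_Un_eq_bot_iff: "filter_Un F G = bot \<longleftrightarrow> F = bot \<or> G = bot"
  unfolding trivial_limit_def[symmetric] unfolding trivial_limit_def eventually_filter_Un
  by (cases "eventually (\<lambda>_. False) G") auto

text \<open>Zorn's lemma downwards. The infimum of a chain of proper filters is proper, since each
  predicate that it contains comes from a single member. A trivial \<open>Q\<close> gives
  ultrafilters; closure under the product gives minimal closed subsemigroups.\<close>

lemma minimal_filter_exists:
  assumes "Q F0" "F0 \<noteq> bot"
    and chain: "\<And>C. C \<noteq> {} \<Longrightarrow> (\<And>F. F \<in> C \<Longrightarrow> Q F \<and> F \<noteq> bot) \<Longrightarrow>
       (\<And>P. eventually P (Inf C) \<longleftrightarrow> (\<exists>F\<in>C. eventually P F)) \<Longrightarrow> Q (Inf C)"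
  obtains F where "Q F" "F \<noteq> bot" "F \<le> F0" "\<And>G. Q G \<Longrightarrow> G \<noteq> bot \<Longrightarrow> G \<le> F \<Longrightarrow> G = F"
proof -
  define A where "A = {F. Q F \<and> F \<noteq> bot \<and> F \<le> F0}"
  have "\<exists>m\<in>A. \<forall>a\<in>A. m \<ge> a \<longrightarrow> a = m"
  proof (rule predicate_Zorn)
    show "partial_order_on A (relation_of (\<ge>) A)"
      by (rule partial_order_on_relation_ofI) auto
    fix C assume C: "C \<in> Chains (relation_of (\<ge>) A)"
    then have CA: "C \<subseteq> A" by (rule Chains_relation_of)
    show "\<exists>u\<in>A. \<forall>a\<in>C. a \<ge> u"
    proof (cases "C = {}")
      case True
      then show ?thesis using assms(1,2) A_def by auto
    next
      case False
      have ev: "eventually P (Inf C) \<longleftrightarrow> (\<exists>F\<in>C. eventually P F)" for P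
      proof (rule eventually_Inf_base[OF False])
        fix F G assume "F \<in> C" "G \<in> C"
        then have "F \<le> G \<or> G \<le> F" using C by (auto simp: Chains_def relation_of_def)
        then show "\<exists>x\<in>C. x \<le> inf F G" using \<open>F \<in> C\<close> \<open>G \<in> C\<close> by auto
      qed
      have "Q (Inf C)" using CA by (intro chain[OF False _ ev]) (auto simp: A_def)
      moreover have "Inf C \<noteq> bot"
        using CA unfolding trivial_limit_def ev by (auto simp: A_def trivial_limit_def)
      moreover have "Inf C \<le> F0"
        using False CA by (auto simp: A_def intro: Inf_lower2)
      ultimately show ?thesis by (intro bexI[of _ "Inf C"]) (auto simp: A_def Inf_lower)
    qed
  qed
  then obtain m where m: "m \<in> A" "\<And>a. a \<in> A \<Longrightarrow> a \<le> m \<Longrightarrow> a = m" by auto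
  show thesis
  proof (rule that[of m])
    fix G assume G: "Q G" "G \<noteq> bot" "G \<le> m"
    moreover have "m \<le> F0" using m(1) by (simp add: A_def)
    ultimately show "G = m" by (intro m(2)) (auto simp: A_def intro: order_trans)
  qed (use m(1) in \<open>auto simp: A_def\<close>)
qed

lemma ultrafilter_exists:
  assumes "F \<noteq> bot"
  obtains u where "u \<noteq> bot" "u \<le> F" "\<And>P. eventually P u \<or> eventually (\<lambda>x. \<not> P x) u"
proof -
  obtain u where u: "u \<noteq> bot" "u \<le> F" "\<And>G. G \<noteq> bot \<Longrightarrow> G \<le> u \<Longrightarrow> G = u"
    using minimal_filter_exists[of "\<lambda>_. True" F] assms by auto
  have "eventually P u \<or> eventually (\<lambda>x. \<not> P x) u" for P
  proof (rule disjCI)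
    assume "\<not> eventually (\<lambda>x. \<not> P x) u"
    then have "inf u (principal {x. P x}) \<noteq> bot"
      by (simp add: trivial_limit_def eventually_inf_principal)
    then have "inf u (principal {x. P x}) = u" by (rule u(3)) auto
    moreover have "eventually P (inf u (principal {x. P x}))"
      by (simp add: eventually_inf_principal)
    ultimately show "eventually P u" by simp
  qed
  with u that show thesis by blast
qed

text \<open>The Ellis-Numakura argument. If \<open>F\<close> is minimal with
  \<open>filter_Un F F \<le> F\<close> and \<open>u\<close> is an ultrafilter below it, then
  \<open>filter_Un F u\<close> has the same closure property and so equals \<open>F\<close>; the
  part of \<open>F\<close> that fixes \<open>u\<close> from the left has it too and so equals
  \<open>F\<close>. Hence \<open>F\<close> lies in the stabiliser, which forces
  \<open>F \<le> u\<close> and makes \<open>F\<close> an ultrafilter.\<close>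

lemma idempotent_ultrafilter_exists:
  obtains p :: "nat set filter" where "p \<noteq> bot"
    "\<And>P. eventually P p \<or> eventually (\<lambda>x. \<not> P x) p"
    "\<And>P. eventually P p \<Longrightarrow> \<forall>\<^sub>F \<beta> in p. \<forall>\<^sub>F \<alpha> in p. P (\<beta> \<union> \<alpha>)"
    "\<forall>\<^sub>F \<alpha> in p. finite \<alpha> \<and> \<alpha> \<noteq> {}"
    "\<And>n. \<forall>\<^sub>F \<alpha> in p. \<forall>i\<in>\<alpha>. n \<le> i"
proof -
  \<comment> \<open>Starting below the filter of tails puts \<alpha> eventually beyond any fixed
    finite \<beta>. The unions \<beta> \<union> \<alpha> are then disjoint, and sums over them
    split.\<close>
  define T where "T n = {\<alpha>::nat set. finite \<alpha> \<and> \<alpha> \<noteq> {} \<and> (\<forall>i\<in>\<alpha>. n \<le> i)}" for n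
  define F0 where "F0 = (INF n. principal (T n))"
  have ev0: "eventually P F0 \<longleftrightarrow> (\<exists>n. \<forall>\<alpha>\<in>T n. P \<alpha>)" for P
    unfolding F0_def
  proof (subst eventually_INF_base)
    fix a b :: nat
    show "\<exists>x\<in>UNIV. principal (T x) \<le> inf (principal (T a)) (principal (T b))"
      by (rule bexI[of _ "max a b"]) (auto simp: T_def)
  qed (auto simp: eventually_principal)
  define Q :: "nat set filter \<Rightarrow> bool" where "Q F \<longleftrightarrow> filter_Un F F \<le> F" for F
  have "{n} \<in> T n" for n by (simp add: T_def)
  then have F0: "F0 \<noteq> bot" unfolding trivial_limit_def ev0 by auto
  have Q0: "Q F0"
    unfolding Q_def le_filter_def eventually_filter_Un
  proof safe
    fix P assume "eventually P F0"
    then obtain n where "\<forall>\<alpha>\<in>T n. P \<alpha>" by (auto simp: ev0)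
    moreover have "\<beta> \<union> \<alpha> \<in> T n" if "\<beta> \<in> T n" "\<alpha> \<in> T n" for \<alpha> \<beta>
      using that by (auto simp: T_def)
    ultimately show "\<forall>\<^sub>F \<beta> in F0. \<forall>\<^sub>F \<alpha> in F0. P (\<beta> \<union> \<alpha>)"
      unfolding ev0 by blast
  qed
  obtain F where F: "Q F" "F \<noteq> bot" "F \<le> F0"
    and Fmin: "\<And>G. Q G \<Longrightarrow> G \<noteq> bot \<Longrightarrow> G \<le> F \<Longrightarrow> G = F"
  proof (rule minimal_filter_exists[where Q = Q and ?F0.0 = F0, OF Q0 F0])
    fix C assume C: "\<And>F. F \<in> C \<Longrightarrow> Q F \<and> F \<noteq> bot"
      and ev: "\<And>P. eventually P (Inf C) \<longleftrightarrow> (\<exists>F\<in>C. eventually P F)"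
    show "Q (Inf C)"
      unfolding Q_def le_filter_def
    proof safe
      fix P assume "eventually P (Inf C)"
      then obtain G where G: "G \<in> C" "eventually P G" by (auto simp: ev)
      then have "eventually P (filter_Un G G)" using C by (auto simp: Q_def le_filter_def)
      moreover have "filter_Un (Inf C) (Inf C) \<le> filter_Un G G"
        using G by (intro filter_Un_mono Inf_lower)
      ultimately show "eventually P (filter_Un (Inf C) (Inf C))" by (auto simp: le_filter_def)
    qed
  qed blast
  obtain u where u: "u \<noteq> bot" "u \<le> F" "\<And>P. eventually P u \<or> eventually (\<lambda>x. \<not> P x) u"
    using ultrafilter_exists[OF F(2)] by blast
  have FF: "filter_Un F F \<le> F" using F(1) by (simp add: Q_def)
  have Fu: "filter_Un F u = F"
  proof (rule Fmin)
    have "filter_Un (filter_Un F u) (filter_Un F u) \<le> filter_Un (filter_Un F F) (filter_Un F u)"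
      using u(2) by (intro filter_Un_mono) auto
    also have "\<dots> \<le> filter_Un F (filter_Un F u)" using FF by (intro filter_Un_mono) auto
    also have "\<dots> = filter_Un (filter_Un F F) u" by (simp add: filter_Un_assoc)
    also have "\<dots> \<le> filter_Un F u" using FF by (intro filter_Un_mono) auto
    finally show "Q (filter_Un F u)" by (simp add: Q_def)
    show "filter_Un F u \<noteq> bot" using F(2) u(1) by (simp add: filter_Un_eq_bot_iff)
    have "filter_Un F u \<le> filter_Un F F" using u(2) by (intro filter_Un_mono) auto
    with FF show "filter_Un F u \<le> F" by (rule order_trans[rotated])
  qed
  text \<open>The filters below \<open>K\<close> are those that fix \<open>u\<close> from the left.\<close>
  define K where "K = Abs_filter (\<lambda>R. \<exists>P. eventually P u \<and> (\<forall>\<beta>. (\<forall>\<^sub>F \<alpha> in u. P (\<beta> \<union> \<alpha>)) \<longrightarrow> R \<beta>))"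
  have evK: "eventually R K \<longleftrightarrow> (\<exists>P. eventually P u \<and> (\<forall>\<beta>. (\<forall>\<^sub>F \<alpha> in u. P (\<beta> \<union> \<alpha>)) \<longrightarrow> R \<beta>))" for R
    unfolding K_def
  proof (rule eventually_Abs_filter, rule is_filter.intro)
    fix R S assume "\<exists>P. eventually P u \<and> (\<forall>\<beta>. (\<forall>\<^sub>F \<alpha> in u. P (\<beta> \<union> \<alpha>)) \<longrightarrow> R \<beta>)"
      "\<exists>P. eventually P u \<and> (\<forall>\<beta>. (\<forall>\<^sub>F \<alpha> in u. P (\<beta> \<union> \<alpha>)) \<longrightarrow> S \<beta>)"
    then obtain P1 P2 where "eventually P1 u" "\<forall>\<beta>. (\<forall>\<^sub>F \<alpha> in u. P1 (\<beta> \<union> \<alpha>)) \<longrightarrow> R \<beta>"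
      "eventually P2 u" "\<forall>\<beta>. (\<forall>\<^sub>F \<alpha> in u. P2 (\<beta> \<union> \<alpha>)) \<longrightarrow> S \<beta>"
      by (elim exE conjE)
    then show "\<exists>P. eventually P u \<and> (\<forall>\<beta>. (\<forall>\<^sub>F \<alpha> in u. P (\<beta> \<union> \<alpha>)) \<longrightarrow> R \<beta> \<and> S \<beta>)"
      by (intro exI[of _ "\<lambda>x. P1 x \<and> P2 x"]) (simp add: eventually_conj_iff)
  next
    show "\<exists>P. eventually P u \<and> (\<forall>\<beta>. (\<forall>\<^sub>F \<alpha> in u. P (\<beta> \<union> \<alpha>)) \<longrightarrow> True)"
      by (intro exI[of _ "\<lambda>_. True"]) simp
  next
    fix R S assume RS: "\<forall>x. R x \<longrightarrow> S x"
      and "\<exists>P. eventually P u \<and> (\<forall>\<beta>. (\<forall>\<^sub>F \<alpha> in u. P (\<beta> \<union> \<alpha>)) \<longrightarrow> R \<beta>)"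
    then obtain P where "eventually P u" "\<forall>\<beta>. (\<forall>\<^sub>F \<alpha> in u. P (\<beta> \<union> \<alpha>)) \<longrightarrow> R \<beta>" by (elim exE conjE)
    with RS show "\<exists>P. eventually P u \<and> (\<forall>\<beta>. (\<forall>\<^sub>F \<alpha> in u. P (\<beta> \<union> \<alpha>)) \<longrightarrow> S \<beta>)" by (intro exI[of _ P]) simp
  qed
  have leK: "G \<le> K \<longleftrightarrow> filter_Un G u \<le> u" for G
  proof
    assume "G \<le> K"
    show "filter_Un G u \<le> u"
      unfolding le_filter_def eventually_filter_Un
    proof safe
      fix P assume "eventually P u"
      then have "eventually (\<lambda>\<beta>. \<forall>\<^sub>F \<alpha> in u. P (\<beta> \<union> \<alpha>)) K" unfolding evK by (intro exI[of _ P]) simp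
      with \<open>G \<le> K\<close> show "\<forall>\<^sub>F \<beta> in G. \<forall>\<^sub>F \<alpha> in u. P (\<beta> \<union> \<alpha>)" by (simp add: le_filter_def)
    qed
  next
    assume le: "filter_Un G u \<le> u"
    show "G \<le> K"
      unfolding le_filter_def evK
    proof safe
      fix R P assume "eventually P u" and R: "\<forall>\<beta>. (\<forall>\<^sub>F \<alpha> in u. P (\<beta> \<union> \<alpha>)) \<longrightarrow> R \<beta>"
      then have "\<forall>\<^sub>F \<beta> in G. \<forall>\<^sub>F \<alpha> in u. P (\<beta> \<union> \<alpha>)"
        using le by (simp add: le_filter_def eventually_filter_Un)
      then show "eventually R G" by eventually_elim (use R in simp)
    qed
  qed
  have "inf F K = F"
  proof (rule Fmin)
    have 1: "filter_Un (inf F K) u \<le> u" by (simp flip: leK)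
    have "filter_Un (filter_Un (inf F K) (inf F K)) u = filter_Un (inf F K) (filter_Un (inf F K) u)"
      by (rule filter_Un_assoc)
    also have "\<dots> \<le> filter_Un (inf F K) u" using 1 by (intro filter_Un_mono) auto
    also note 1
    finally have 2: "filter_Un (inf F K) (inf F K) \<le> K" by (simp add: leK)
    have "filter_Un (inf F K) (inf F K) \<le> filter_Un F F" by (intro filter_Un_mono) auto
    also note FF
    finally show "Q (inf F K)" using 2 by (simp add: Q_def)
    \<comment> \<open>Otherwise some set of \<open>u\<close> would, for \<open>F\<close>-most
      \<beta>, be missed by \<beta> \<union> \<alpha> for \<open>u\<close>-most \<alpha>. Its
      complement would belong to \<open>filter_Un F u\<close>, that is to \<open>F\<close>, and
      hence to \<open>u\<close>.\<close>
    show "inf F K \<noteq> bot"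
    proof
      assume "inf F K = bot"
      then obtain A R where AR: "eventually A F" "eventually R K" "\<forall>x. \<not> (A x \<and> R x)"
        unfolding trivial_limit_def eventually_inf by auto
      obtain P where P: "eventually P u" "\<forall>\<beta>. (\<forall>\<^sub>F \<alpha> in u. P (\<beta> \<union> \<alpha>)) \<longrightarrow> R \<beta>"
        using AR(2) unfolding evK by (elim exE conjE)
      have "\<forall>\<^sub>F \<beta> in F. \<forall>\<^sub>F \<alpha> in u. \<not> P (\<beta> \<union> \<alpha>)"
        using AR(1)
      proof eventually_elim
        fix \<beta> assume "A \<beta>"
        then have "\<not> (\<forall>\<^sub>F \<alpha> in u. P (\<beta> \<union> \<alpha>))" using AR(3) P(2) by metis
        with u(3)[of "\<lambda>\<alpha>. P (\<beta> \<union> \<alpha>)"] show "\<forall>\<^sub>F \<alpha> in u. \<not> P (\<beta> \<union> \<alpha>)" by simp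
      qed
      then have "eventually (\<lambda>x. \<not> P x) F" using eventually_filter_Un[of "\<lambda>x. \<not> P x" F u] Fu by simp
      with u(2) have "eventually (\<lambda>x. \<not> P x) u" by (simp add: le_filter_def)
      with P(1) have "eventually (\<lambda>x. False) u" by eventually_elim blast
      with u(1) show False by (simp add: trivial_limit_def)
    qed
  qed auto
  then have "F \<le> u" using Fu leK[of F] inf.cobounded2[of F K] by simp
  with u(2) have uF: "u = F" by simp
  show thesis
  proof (rule that[of F])
    show "F \<noteq> bot" by fact
    show "eventually P F \<or> eventually (\<lambda>x. \<not> P x) F" for P using u(3) uF by blast
    show "\<forall>\<^sub>F \<beta> in F. \<forall>\<^sub>F \<alpha> in F. P (\<beta> \<union> \<alpha>)" if "eventually P F" for P
      using that FF by (simp add: le_filter_def eventually_filter_Un)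
    have evT: "eventually (\<lambda>\<alpha>. \<alpha> \<in> T n) F" for n
      using F(3) by (auto simp: le_filter_def ev0)
    show "\<forall>\<^sub>F \<alpha> in F. finite \<alpha> \<and> \<alpha> \<noteq> {}" "\<forall>\<^sub>F \<alpha> in F. \<forall>i\<in>\<alpha>. n \<le> i" for n
      using evT[of n] by (auto simp: T_def elim: eventually_mono)
  qed
qed

section \<open>Subgroups of \<open>\<int>\<close>-valued functions on a finite set\<close>

text \<open>Elements of \<int>^J are functions on the whole index type that are compared only on
  \<open>J\<close>; membership below is therefore always up to agreement on
  \<open>J\<close>.\<close>

definition add_subgroup :: "('j \<Rightarrow> int) set \<Rightarrow> bool" where
  "add_subgroup G \<longleftrightarrow> (\<lambda>_. 0) \<in> G \<and> (\<forall>a\<in>G. \<forall>b\<in>G. (\<lambda>j. a j - b j) \<in> G)"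

lemma add_subgroup_zero: "add_subgroup G \<Longrightarrow> (\<lambda>_. 0) \<in> G"
  by (simp add: add_subgroup_def)

lemma add_subgroup_Int: "add_subgroup G \<Longrightarrow> add_subgroup H \<Longrightarrow> add_subgroup (G \<inter> H)"
  by (auto simp: add_subgroup_def)

lemma add_subgroupI:
  "(\<lambda>_. 0) \<in> G \<Longrightarrow> (\<And>a b. a \<in> G \<Longrightarrow> b \<in> G \<Longrightarrow> (\<lambda>j. a j - b j) \<in> G) \<Longrightarrow> add_subgroup G"
  by (simp add: add_subgroup_def)

lemma add_subgroup_minus:
  "add_subgroup G \<Longrightarrow> a \<in> G \<Longrightarrow> b \<in> G \<Longrightarrow> (\<lambda>j. a j - b j) \<in> G"
  by (auto simp: add_subgroup_def)

lemma add_subgroup_plus: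
  assumes "add_subgroup G" "a \<in> G" "b \<in> G"
  shows "(\<lambda>j. a j + b j) \<in> G"
proof -
  have "(\<lambda>j. 0 - b j) \<in> G"
    by (intro add_subgroup_minus add_subgroup_zero assms)
  from add_subgroup_minus[OF assms(1,2) this] show ?thesis by simp
qed

lemma add_subgroup_mult:
  assumes "add_subgroup G" "a \<in> G"
  shows "(\<lambda>j. m * a j) \<in> G"
proof (induction m rule: int_induct[where k = 0])
  case base
  then show ?case using add_subgroup_zero[OF assms(1)] by simp
next
  case (step1 i)
  from add_subgroup_plus[OF assms(1) step1(2) assms(2)] show ?case by (simp add: algebra_simps)
next
  case (step2 i)
  from add_subgroup_minus[OF assms(1) step2(2) assms(2)] show ?case by (simp add: algebra_simps)
qed

text \<open>\<int>^J is Noetherian: by induction on \<open>J\<close>, the elements vanishing at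
  \<open>j\<close> are generated by \<open>F0\<close>, and one further element \<open>g\<close>
  generates the ideal of all values at \<open>j\<close>. Generation is phrased through arbitrary
  subgroups \<open>G\<close> containing the generators.\<close>

lemma add_subgroup_finitely_generated:
  assumes "finite J" "add_subgroup H"
  shows "\<exists>F\<subseteq>H. finite F \<and>
    (\<forall>G. add_subgroup G \<longrightarrow> F \<subseteq> G \<longrightarrow> (\<forall>a\<in>H. \<exists>b\<in>G. \<forall>j\<in>J. a j = b j))"
  using assms
proof (induction J arbitrary: H rule: finite_induct)
  case empty
  then show ?case by (intro exI[of _ "{}"]) (auto dest: add_subgroup_zero)
next
  case (insert j J)
  define H0 where "H0 = {a\<in>H. a j = 0}"
  have H0: "add_subgroup H0"
    by (rule add_subgroupI)
      (simp_all add: H0_def add_subgroup_zero[OF insert.prems] add_subgroup_minus[OF insert.prems])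
  obtain F0 where F0: "F0 \<subseteq> H0" "finite F0"
    and gen: "\<forall>G. add_subgroup G \<longrightarrow> F0 \<subseteq> G \<longrightarrow> (\<forall>a\<in>H0. \<exists>b\<in>G. \<forall>j\<in>J. a j = b j)"
    using insert.IH[OF H0] by (elim exE conjE)
  obtain g where g: "g \<in> H" "\<And>a. a \<in> H \<Longrightarrow> g j dvd a j"
  proof (cases "\<exists>a\<in>H. a j \<noteq> 0")
    case False
    then show thesis using that[of "\<lambda>_. 0"] add_subgroup_zero[OF insert.prems] by auto
  next
    case True
    \<comment> \<open>The least positive absolute value at \<open>j\<close> divides all the others,
      since a nonzero remainder would give a smaller one.\<close>
    define D where "D n \<longleftrightarrow> 0 < n \<and> (\<exists>a\<in>H. \<bar>a j\<bar> = int n)" for n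
    obtain n where "D n" "\<And>m. D m \<Longrightarrow> n \<le> m"
    proof -
      from True obtain a where "a \<in> H" "a j \<noteq> 0" by blast
      then have "D (nat \<bar>a j\<bar>)" by (auto simp: D_def)
      then show thesis using that LeastI[of D] Least_le[of D] by blast
    qed
    then obtain a where a: "a \<in> H" "a j \<noteq> 0" "\<And>m. D m \<Longrightarrow> \<bar>a j\<bar> \<le> int m"
      by (force simp: D_def)
    show thesis
    proof (rule that[OF a(1)])
      fix b assume "b \<in> H"
      have "(\<lambda>i. b i - (b j div a j) * a i) \<in> H"
        using insert.prems \<open>b \<in> H\<close> a(1) by (intro add_subgroup_minus add_subgroup_mult)
      moreover have "b j - (b j div a j) * a j = b j mod a j" by (simp add: minus_div_mult_eq_mod)
      ultimately have "D (nat \<bar>b j mod a j\<bar>)" if "b j mod a j \<noteq> 0"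
        using that unfolding D_def by (intro conjI bexI) auto
      from a(3)[OF this] have "b j mod a j = 0"
        using abs_mod_less[OF a(2), of "b j"] by fastforce
      then show "a j dvd b j" by (simp add: dvd_eq_mod_eq_0)
    qed
  qed
  show ?case
  proof (intro exI[of _ "insert g F0"] conjI allI impI ballI)
    show "insert g F0 \<subseteq> H" using g F0 by (auto simp: H0_def)
    show "finite (insert g F0)" using F0 by simp
    fix G a assume G: "add_subgroup G" "insert g F0 \<subseteq> G" and a: "a \<in> H"
    from g(2)[OF a] obtain m where m: "a j = g j * m" by (elim dvdE)
    have "(\<lambda>i. a i - m * g i) \<in> H"
      using insert.prems a g(1) by (intro add_subgroup_minus add_subgroup_mult)
    then have "(\<lambda>i. a i - m * g i) \<in> H0" using m by (simp add: H0_def)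
    \<comment> \<open>Using \<open>G \<inter> H0\<close> instead of \<open>G\<close> gives an
      element that also vanishes at \<open>j\<close>, so that adding \<open>m * g\<close> produces
      the right value there.\<close>
    moreover have "F0 \<subseteq> G \<inter> H0" using F0 G by auto
    ultimately have "\<exists>b\<in>G \<inter> H0. \<forall>i\<in>J. a i - m * g i = b i"
      using gen add_subgroup_Int[OF G(1) H0] by simp
    then obtain b where b: "b \<in> G" "b \<in> H0" "\<forall>i\<in>J. a i - m * g i = b i" by blast
    have "(\<lambda>i. b i + m * g i) \<in> G"
      using G b by (intro add_subgroup_plus add_subgroup_mult) auto
    moreover have "\<forall>i\<in>insert j J. a i = b i + m * g i"
      using b m by (auto simp: H0_def algebra_simps)
    ultimately show "\<exists>b\<in>G. \<forall>i\<in>insert j J. a i = b i" by (intro bexI) auto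
  qed
qed

text \<open>Ascending chain condition: the union of the spans of the initial segments is finitely
  generated, and its generators already lie in one of these spans.\<close>

lemma sequence_in_generated_subgroup:
  fixes a :: "nat \<Rightarrow> 'j \<Rightarrow> int"
  assumes "finite J"
  shows "\<exists>n. \<forall>G. add_subgroup G \<longrightarrow> (\<forall>i<n. a i \<in> G) \<longrightarrow> (\<exists>b\<in>G. \<forall>j\<in>J. a n j = b j)"
proof -
  define span where "span n = \<Inter>{G. add_subgroup G \<and> (\<forall>i<n. a i \<in> G)}" for n
  have sub: "add_subgroup (span n)" for n
    unfolding span_def
    by (rule add_subgroupI) (simp_all add: add_subgroup_zero add_subgroup_minus)
  have mono: "m \<le> n \<Longrightarrow> span m \<subseteq> span n" for m n
    unfolding span_def by (intro Inter_anti_mono) auto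
  have "add_subgroup (\<Union>n. span n)"
    unfolding add_subgroup_def
  proof (intro conjI ballI)
    show "(\<lambda>_. 0) \<in> (\<Union>n. span n)" using add_subgroup_zero[OF sub] by blast
    fix x y assume "x \<in> (\<Union>n. span n)" "y \<in> (\<Union>n. span n)"
    then obtain m n where "x \<in> span m" "y \<in> span n" by blast
    then have "x \<in> span (max m n)" "y \<in> span (max m n)" using mono by (meson max.cobounded1 max.cobounded2 subsetD)+
    then show "(\<lambda>j. x j - y j) \<in> (\<Union>n. span n)" using add_subgroup_minus[OF sub] by blast
  qed
  from add_subgroup_finitely_generated[OF assms this] obtain F where
    F: "F \<subseteq> (\<Union>n. span n)" "finite F" and
    gen: "\<forall>G. add_subgroup G \<longrightarrow> F \<subseteq> G \<longrightarrow> (\<forall>x\<in>(\<Union>n. span n). \<exists>b\<in>G. \<forall>j\<in>J. x j = b j)"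
    by (elim exE conjE)
  have "\<exists>n. F \<subseteq> span n"
    using F(2,1)
  proof (induction F rule: finite_induct)
    case (insert x F)
    then obtain n m where "F \<subseteq> span n" "x \<in> span m" by blast
    then have "insert x F \<subseteq> span (max m n)" using mono by (meson insert_subset max.cobounded1 max.cobounded2 order_trans subsetD)
    then show ?case by blast
  qed auto
  then obtain n where n: "F \<subseteq> span n" ..
  have "a n \<in> span (Suc n)" by (auto simp: span_def)
  then have an: "a n \<in> (\<Union>n. span n)" by blast
  show ?thesis
  proof (intro exI[of _ n] allI impI)
    fix G assume "add_subgroup G" "\<forall>i<n. a i \<in> G"
    then have "span n \<subseteq> G" by (auto simp: span_def)
    with n have "F \<subseteq> G" by blast
    with gen[rule_format, OF \<open>add_subgroup G\<close> _ an] show "\<exists>b\<in>G. \<forall>j\<in>J. a n j = b j" .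
  qed
qed

section \<open>Weak limits along an idempotent ultrafilter\<close>

locale idempotent_ultrafilter =
  fixes p :: "'a set filter"
  assumes nonbot: "p \<noteq> bot"
    and ultra: "eventually P p \<or> eventually (\<lambda>\<alpha>. \<not> P \<alpha>) p"
    and idem: "eventually P p \<Longrightarrow> \<forall>\<^sub>F \<beta> in p. \<forall>\<^sub>F \<alpha> in p. P (\<beta> \<union> \<alpha>)"
begin

text \<open>A cluster point of an ultrafilter is its limit, because the ultrafilter decides every
  neighbourhood.\<close>

lemma tendsto_compact:
  fixes f :: "'a set \<Rightarrow> 'b::topological_space"
  assumes "compact K" "\<And>\<alpha>. f \<alpha> \<in> K"
  obtains l where "l \<in> K" "(f \<longlongrightarrow> l) p"
proof -
  have "filtermap f p \<noteq> bot" "eventually (\<lambda>x. x \<in> K) (filtermap f p)"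
    using nonbot assms(2) by (auto simp: filtermap_bot_iff eventually_filtermap)
  then obtain l where l: "l \<in> K" "inf (nhds l) (filtermap f p) \<noteq> bot"
    using assms(1) unfolding compact_filter by blast
  have "(f \<longlongrightarrow> l) p"
  proof (rule topological_tendstoI)
    fix U assume U: "open U" "l \<in> U"
    have "\<not> eventually (\<lambda>\<alpha>. \<not> f \<alpha> \<in> U) p"
    proof
      assume "eventually (\<lambda>\<alpha>. \<not> f \<alpha> \<in> U) p"
      then have "eventually (\<lambda>x. x \<notin> U) (filtermap f p)" by (simp add: eventually_filtermap)
      moreover have "eventually (\<lambda>x. x \<in> U) (nhds l)" using U by (rule eventually_nhds_in_open)
      ultimately have "eventually (\<lambda>_. False) (inf (nhds l) (filtermap f p))"
        unfolding eventually_inf by blast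
      with l(2) show False by (simp add: trivial_limit_def)
    qed
    with ultra[of "\<lambda>\<alpha>. f \<alpha> \<in> U"] show "eventually (\<lambda>\<alpha>. f \<alpha> \<in> U) p" by simp
  qed
  with l(1) show thesis by (rule that)
qed

text \<open>This supplies the family for van der Corput's argument. If \<open>W\<close> holds
  between \<beta> \<union> \<alpha> and \<alpha> for most \<beta> and then most \<alpha>, sets
  formed as unions of tails of a sequence are pairwise related. Idempotence is what lets the already
  formed unions stay good when a further set is joined to all of them.\<close>

lemma idempotent_chain:
  assumes R: "eventually R p" and W: "\<forall>\<^sub>F \<beta> in p. \<forall>\<^sub>F \<alpha> in p. W (\<beta> \<union> \<alpha>) \<alpha>"
  shows "\<exists>as. length as = n \<and> (\<forall>a\<in>set as. R a) \<and> sorted_wrt W as"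
proof -
  define V where "V \<beta> \<longleftrightarrow> (\<forall>\<^sub>F \<alpha> in p. W (\<beta> \<union> \<alpha>) \<alpha>)" for \<beta>
  define L where "L cs \<alpha> = map (\<lambda>\<gamma>. \<gamma> \<union> \<alpha>) cs @ [\<alpha>]" for cs and \<alpha> :: "'a set"
  define G where "G cs \<alpha> \<longleftrightarrow> sorted_wrt W (L cs \<alpha>) \<and> (\<forall>a\<in>set (L cs \<alpha>). R a \<and> V a)" for cs \<alpha>
  have "\<exists>cs. length cs = n \<and> eventually (G cs) p"
  proof (induction n)
    case 0
    have "eventually (G []) p"
      using R W by eventually_elim (simp add: G_def L_def V_def)
    then show ?case by simp
  next
    case (Suc n)
    then obtain cs where cs: "length cs = n" "eventually (G cs) p" by blast
    obtain \<beta> where \<beta>: "G cs \<beta>" "\<forall>\<^sub>F \<alpha> in p. G cs (\<beta> \<union> \<alpha>)"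
      using eventually_happens'[OF nonbot eventually_conj[OF cs(2) idem[OF cs(2)]]] by blast
    \<comment> \<open>Freezing \<beta> turns the list for \<open>cs\<close> into the new prefix:
      joining \<alpha> to it gives the old list at \<beta> \<union> \<alpha>, still good by
      idempotence, followed by \<alpha>.\<close>
    define ds where "ds = L cs \<beta>"
    have L_ds: "L ds \<alpha> = L cs (\<beta> \<union> \<alpha>) @ [\<alpha>]" for \<alpha>
      by (simp add: ds_def L_def Un_assoc)
    have "\<forall>\<^sub>F \<alpha> in p. \<forall>d\<in>set ds. W (d \<union> \<alpha>) \<alpha>"
      using \<beta>(1) by (intro eventually_ball_finite) (auto simp: G_def ds_def V_def)
    moreover have "\<forall>\<^sub>F \<alpha> in p. R \<alpha> \<and> V \<alpha>"
      using R W unfolding V_def by eventually_elim simp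
    ultimately have "eventually (G ds) p"
      using \<beta>(2)
    proof eventually_elim
      case (elim \<alpha>)
      have "set (L cs (\<beta> \<union> \<alpha>)) = (\<lambda>d. d \<union> \<alpha>) ` set ds"
        by (simp add: ds_def L_def Un_assoc image_image)
      moreover have "set (L ds \<alpha>) = insert \<alpha> (set (L cs (\<beta> \<union> \<alpha>)))" by (simp add: L_ds)
      ultimately show ?case using elim by (simp add: G_def L_ds sorted_wrt_append)
    qed
    moreover have "length ds = Suc n" using cs(1) by (simp add: ds_def L_def)
    ultimately show ?case by blast
  qed
  then obtain cs where cs: "length cs = n" "eventually (G cs) p" by blast
  then obtain \<alpha> where "G cs \<alpha>" using eventually_happens'[OF nonbot] by blast
  then show ?thesis
    using cs(1) by (intro exI[of _ "map (\<lambda>\<gamma>. \<gamma> \<union> \<alpha>) cs"]) (auto simp: G_def L_def sorted_wrt_append)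
qed

end

lemma borel_measurable_cnj[measurable]:
  "f \<in> borel_measurable N \<Longrightarrow> (\<lambda>x. cnj (f x)) \<in> borel_measurable N"
  by (rule borel_measurable_continuous_on[where f = cnj]) (auto intro: continuous_intros)

lemma borel_measurable_cis[measurable]: "cis \<in> borel_measurable borel"
  by (intro borel_measurable_continuous_onI continuous_intros)

section \<open>Weak limits of bounded functions and their existence\<close>

locale prob_ultrafilter = prob_space M + idempotent_ultrafilter p
  for M :: "'x measure" and p :: "'a set filter"
begin

text \<open>Weak-star convergence in L^\<infinity>, as all functions concerned are uniformly
  bounded. The pairing has no complex conjugate, so a bounded factor can be moved freely between the
  test function and the limit.\<close>

definition weak_lim :: "('a set \<Rightarrow> 'x \<Rightarrow> complex) \<Rightarrow> ('x \<Rightarrow> complex) \<Rightarrow> bool" where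
  "weak_lim f g \<longleftrightarrow> (\<forall>h. integrable M h \<longrightarrow>
     ((\<lambda>\<alpha>. \<integral>x. h x * f \<alpha> x \<partial>M) \<longlongrightarrow> (\<integral>x. h x * g x \<partial>M)) p)"

lemma weak_limD:
  "weak_lim f g \<Longrightarrow> integrable M h \<Longrightarrow>
     ((\<lambda>\<alpha>. \<integral>x. h x * f \<alpha> x \<partial>M) \<longlongrightarrow> (\<integral>x. h x * g x \<partial>M)) p"
  by (simp add: weak_lim_def)

lemma integrable_bounded:
  fixes f :: "'x \<Rightarrow> 'b::{banach, second_countable_topology}"
  assumes "f \<in> borel_measurable M" "\<And>x. norm (f x) \<le> K"
  shows "integrable M f"
  using assms by (intro integrable_const_bound[where B = K]) auto

lemma integrable_mult_bounded:
  fixes f g :: "'x \<Rightarrow> complex"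
  assumes "integrable M h" "g \<in> borel_measurable M" "\<And>x. norm (g x) \<le> K"
  shows "integrable M (\<lambda>x. h x * g x)"
proof (rule Bochner_Integration.integrable_bound)
  show "integrable M (\<lambda>x. K *\<^sub>R norm (h x))" using assms(1) by auto
  have "norm (h x * g x) \<le> norm (K *\<^sub>R norm (h x))" for x
  proof -
    have "norm (h x * g x) \<le> norm (h x) * K"
      unfolding norm_mult by (intro mult_left_mono assms) auto
    also have "\<dots> \<le> norm (K *\<^sub>R norm (h x))" by (simp add: mult.commute mult_left_mono)
    finally show ?thesis .
  qed
  then show "AE x in M. norm (h x * g x) \<le> norm (K *\<^sub>R norm (h x))" by simp
qed (use assms in auto)

lemma norm_integral_le:
  fixes f :: "'x \<Rightarrow> complex"
  assumes "integrable M g" "\<And>x. norm (f x) \<le> g x"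
  shows "norm (\<integral>x. f x \<partial>M) \<le> (\<integral>x. g x \<partial>M)"
proof (cases "integrable M f")
  case True
  then have "norm (\<integral>x. f x \<partial>M) \<le> (\<integral>x. norm (f x) \<partial>M)" by (intro integral_norm_bound)
  also have "\<dots> \<le> (\<integral>x. g x \<partial>M)" using True assms by (intro integral_mono) auto
  finally show ?thesis .
next
  case False
  have "0 \<le> (\<integral>x. g x \<partial>M)"
    by (intro Bochner_Integration.integral_nonneg) (meson assms(2) norm_ge_zero order_trans)
  with False show ?thesis by (simp add: not_integrable_integral_eq)
qed

text \<open>Simple functions are dense in L^1, and by the common bound \<open>K\<close> the error of
  replacing \<open>h\<close> by an approximation is the same for all \<open>f \<alpha>\<close> and
  for \<open>g\<close>.\<close>

lemma weak_lim_indicatorI: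
  assumes f[measurable]: "\<And>\<alpha>. f \<alpha> \<in> borel_measurable M" and f_le: "\<And>\<alpha> x. norm (f \<alpha> x) \<le> K"
    and g[measurable]: "g \<in> borel_measurable M" and g_le: "\<And>x. norm (g x) \<le> K"
    and lim: "\<And>A. A \<in> sets M \<Longrightarrow>
      ((\<lambda>\<alpha>. \<integral>x. indicator A x *\<^sub>R f \<alpha> x \<partial>M) \<longlongrightarrow> (\<integral>x. indicator A x *\<^sub>R g x \<partial>M)) p"
  shows "weak_lim f g"
  unfolding weak_lim_def
proof safe
  have K: "0 \<le> K" using g_le[of undefined] norm_ge_zero order_trans by blast
  fix h :: "'x \<Rightarrow> complex" assume "integrable M h"
  then show "((\<lambda>\<alpha>. \<integral>x. h x * f \<alpha> x \<partial>M) \<longlongrightarrow> (\<integral>x. h x * g x \<partial>M)) p"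
  proof (induction h rule: integrable_induct)
    case (base A c)
    have "((\<lambda>\<alpha>. c * (\<integral>x. indicator A x *\<^sub>R f \<alpha> x \<partial>M)) \<longlongrightarrow> c * (\<integral>x. indicator A x *\<^sub>R g x \<partial>M)) p"
      using base by (intro tendsto_mult_left lim) auto
    moreover have "c * (\<integral>x. indicator A x *\<^sub>R f x \<partial>M) = (\<integral>x. (indicator A x *\<^sub>R c) * f x \<partial>M)" for f
      by (subst integral_mult_right_zero[symmetric]) (simp add: mult_ac scaleR_conv_of_real)
    ultimately show ?case by simp
  next
    case (add h1 h2)
    have *: "(\<integral>x. (h1 x + h2 x) * f x \<partial>M) = (\<integral>x. h1 x * f x \<partial>M) + (\<integral>x. h2 x * f x \<partial>M)"
      if "f \<in> borel_measurable M" "\<And>x. norm (f x) \<le> K" for f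
      using add.hyps that
      by (subst Bochner_Integration.integral_add[symmetric])
        (auto simp: distrib_right intro!: integrable_mult_bounded)
    show ?case using add.IH by (subst (1 2) *) (auto intro!: tendsto_add f_le g_le)
  next
    case (lim h s)
    have diff: "norm ((\<integral>x. h x * f x \<partial>M) - (\<integral>x. s i x * f x \<partial>M)) \<le> K * (\<integral>x. norm (s i x - h x) \<partial>M)"
      if "f \<in> borel_measurable M" "\<And>x. norm (f x) \<le> K" for f i
    proof -
      have "(\<integral>x. h x * f x \<partial>M) - (\<integral>x. s i x * f x \<partial>M) = (\<integral>x. (h x - s i x) * f x \<partial>M)"
        using lim(1,4) that
        by (subst Bochner_Integration.integral_diff[symmetric])
          (auto simp: left_diff_distrib intro!: integrable_mult_bounded)
      also have "norm \<dots> \<le> (\<integral>x. K * norm (s i x - h x) \<partial>M)"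
        using lim(1,4) that(2)
        by (intro norm_integral_le)
          (auto simp: norm_mult norm_minus_commute mult.commute[of K] intro!: mult_left_mono)
      finally show ?thesis by simp
    qed
    have "(\<lambda>i. \<integral>x. norm (s i x - h x) \<partial>M) \<longlonglongrightarrow> (\<integral>x. 0 \<partial>M)"
    proof (rule integral_dominated_convergence[where w = "\<lambda>x. 3 * norm (h x)"])
      show "AE x in M. norm (norm (s i x - h x)) \<le> 3 * norm (h x)" for i
      proof (rule AE_I2)
        fix x assume "x \<in> space M"
        have "norm (s i x - h x) \<le> norm (s i x) + norm (h x)" by (rule norm_triangle_ineq4)
        with lim(3)[OF \<open>x \<in> space M\<close>, of i] show "norm (norm (s i x - h x)) \<le> 3 * norm (h x)" by simp
      qed
      show "AE x in M. (\<lambda>i. norm (s i x - h x)) \<longlonglongrightarrow> 0"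
        using lim(2) by (intro AE_I2 tendsto_norm_zero) (simp add: LIM_zero)
    qed (use lim(1,4) in auto)
    then have lim0: "(\<lambda>i. K * (\<integral>x. norm (s i x - h x) \<partial>M)) \<longlonglongrightarrow> 0"
      by (intro tendsto_mult_right_zero) simp
    show ?case
    proof (rule tendstoI)
      fix e :: real assume "0 < e"
      then obtain i where i: "K * (\<integral>x. norm (s i x - h x) \<partial>M) < e / 3"
        using order_tendstoD(2)[OF lim0, of "e/3"] eventually_happens'[OF sequentially_bot] by auto
      from tendstoD[OF lim(5)[of i], of "e/3"] \<open>0 < e\<close>
      have "\<forall>\<^sub>F \<alpha> in p. dist (\<integral>x. s i x * f \<alpha> x \<partial>M) (\<integral>x. s i x * g x \<partial>M) < e / 3" by simp
      then show "\<forall>\<^sub>F \<alpha> in p. dist (\<integral>x. h x * f \<alpha> x \<partial>M) (\<integral>x. h x * g x \<partial>M) < e"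
      proof eventually_elim
        case (elim \<alpha>)
        moreover have "dist (\<integral>x. h x * f \<alpha> x \<partial>M) (\<integral>x. s i x * f \<alpha> x \<partial>M) < e / 3"
          using diff[OF f f_le, of \<alpha> i] i by (simp add: dist_norm)
        moreover have "dist (\<integral>x. s i x * g x \<partial>M) (\<integral>x. h x * g x \<partial>M) < e / 3"
          using diff[OF g g_le, of i] i by (simp add: dist_norm norm_minus_commute)
        ultimately show ?case by (blast intro: dist_triangle_third)
      qed
    qed
  qed
qed

text \<open>The limits \<nu> of the integrals over each set form a measure dominated by
  \<open>M\<close>; its Radon-Nikodym derivative is the weak limit.\<close>

lemma real_weak_lim_exists:
  fixes f :: "'a set \<Rightarrow> 'x \<Rightarrow> real"
  assumes f[measurable]: "\<And>\<alpha>. f \<alpha> \<in> borel_measurable M" and f0: "\<And>\<alpha> x. 0 \<le> f \<alpha> x" and f1: "\<And>\<alpha> x. f \<alpha> x \<le> 1"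
  obtains g where "g \<in> borel_measurable M" "\<And>x. 0 \<le> g x" "\<And>x. g x \<le> 1"
    "\<And>A. A \<in> sets M \<Longrightarrow>
      ((\<lambda>\<alpha>. \<integral>x. indicator A x * f \<alpha> x \<partial>M) \<longlongrightarrow> (\<integral>x. indicator A x * g x \<partial>M)) p"
proof -
  define I where "I A \<alpha> = (\<integral>x. indicator A x * f \<alpha> x \<partial>M)" for A \<alpha>
  have int: "integrable M (\<lambda>x. indicator A x * f \<alpha> x)" if "A \<in> sets M" for A \<alpha>
    using that f0 f1 by (intro integrable_bounded[where K = 1]) (auto simp: indicator_def)
  have I_bounds: "I A \<alpha> \<in> {0..measure M A}" if "A \<in> sets M" for A \<alpha>
  proof -
    have "I A \<alpha> \<le> (\<integral>x. indicator A x \<partial>M)"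
      unfolding I_def using that f1
      by (intro integral_mono int) (simp_all add: indicator_def, simp add: indicator_def[symmetric] less_top[symmetric])
    with that f0 show ?thesis
      by (auto simp: I_def intro!: Bochner_Integration.integral_nonneg)
  qed
  have "\<exists>l\<in>{0..measure M A}. (I A \<longlongrightarrow> l) p" if "A \<in> sets M" for A
    using tendsto_compact[of "{0..measure M A}" "I A"] I_bounds[OF that] by (metis compact_Icc)
  then obtain \<nu> where \<nu>: "\<And>A. A \<in> sets M \<Longrightarrow> 0 \<le> \<nu> A \<and> \<nu> A \<le> measure M A \<and> (I A \<longlongrightarrow> \<nu> A) p"
    by (metis atLeastAtMost_iff)
  have add: "\<nu> (A \<union> B) = \<nu> A + \<nu> B" if "A \<in> sets M" "B \<in> sets M" "A \<inter> B = {}" for A B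
  proof (rule tendsto_unique[OF nonbot])
    show "(I (A \<union> B) \<longlongrightarrow> \<nu> (A \<union> B)) p" using that \<nu> by blast
    have "I (A \<union> B) = (\<lambda>\<alpha>. I A \<alpha> + I B \<alpha>)"
      unfolding fun_eq_iff I_def Bochner_Integration.integral_add[OF int[OF that(1)] int[OF that(2)], symmetric]
      using that(3) by (intro allI Bochner_Integration.integral_cong) (auto simp: indicator_def)
    moreover have "((\<lambda>\<alpha>. I A \<alpha> + I B \<alpha>) \<longlongrightarrow> \<nu> A + \<nu> B) p"
      using that \<nu> by (intro tendsto_add) auto
    ultimately show "(I (A \<union> B) \<longlongrightarrow> \<nu> A + \<nu> B) p" by simp
  qed
  define N where "N = measure_of (space M) (sets M) (\<lambda>A. ennreal (\<nu> A))"
  have pos: "positive (sets M) (\<lambda>A. ennreal (\<nu> A))"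
    using \<nu>[of "{}"] by (simp add: positive_def)
  \<comment> \<open>Finite additivity passes to the limit, and domination by \<open>M\<close> gives
    continuity at the empty set.\<close>
  have "countably_additive (sets M) (\<lambda>A. ennreal (\<nu> A))"
  proof (rule sets.empty_continuous_imp_countably_additive)
    show "positive (sets M) (\<lambda>A. ennreal (\<nu> A))" by (fact pos)
    show "additive (sets M) (\<lambda>A. ennreal (\<nu> A))"
      using add \<nu> by (auto simp: additive_def simp flip: ennreal_plus)
    fix A assume A: "range A \<subseteq> sets M" "decseq A" "(\<Inter>i. A i) = {}"
    have "(\<lambda>i. measure M (A i)) \<longlonglongrightarrow> measure M (\<Inter>i. A i)"
      using A by (intro finite_Lim_measure_decseq) auto
    then have lim: "(\<lambda>i. measure M (A i)) \<longlonglongrightarrow> 0" using A(3) by simp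
    have "(\<lambda>i. \<nu> (A i)) \<longlonglongrightarrow> 0"
    proof (rule tendsto_sandwich[OF _ _ tendsto_const lim])
      have "A i \<in> sets M" for i using A(1) by blast
      then show "\<forall>\<^sub>F i in sequentially. 0 \<le> \<nu> (A i)"
        "\<forall>\<^sub>F i in sequentially. \<nu> (A i) \<le> measure M (A i)"
        by (simp_all add: \<nu>)
    qed
    from tendsto_ennrealI[OF this] show "(\<lambda>i. ennreal (\<nu> (A i))) \<longlonglongrightarrow> 0" by simp
  qed simp
  then have N: "emeasure N A = ennreal (\<nu> A)" if "A \<in> sets M" for A
    using pos that unfolding N_def
    by (intro emeasure_measure_of_sigma) (auto simp: sets.sigma_algebra_axioms)
  have sets_N[simp]: "sets N = sets M" and [simp]: "space N = space M"
    by (simp_all add: N_def)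
  have "\<exists>g\<in>borel_measurable M. density M g = N"
  proof (rule Radon_Nikodym_finite_measure)
    show "finite_measure N" by (rule finite_measureI) (simp add: N)
    show "absolutely_continuous M N"
      unfolding absolutely_continuous_def null_sets_def
    proof safe
      fix A assume A: "A \<in> sets M" "emeasure M A = 0"
      then have "\<nu> A = 0" using \<nu>[OF A(1)] by (simp add: measure_def)
      with A show "A \<in> sets N" "emeasure N A = 0" by (simp_all add: N)
    qed
  qed simp
  then obtain G where G[measurable]: "G \<in> borel_measurable M" and "density M G = N" by blast
  then have G_int: "(\<integral>\<^sup>+x. G x * indicator A x \<partial>M) = ennreal (\<nu> A)" if "A \<in> sets M" for A
    using N[OF that] that by (simp add: emeasure_density flip: \<open>density M G = N\<close>)
  have "AE x in M. G x \<le> 1"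
  proof -
    define A where "A = {x\<in>space M. 1 < G x}"
    have A[measurable]: "A \<in> sets M" by (simp add: A_def)
    have "(\<integral>\<^sup>+x. (G x - 1) * indicator A x \<partial>M) + (\<integral>\<^sup>+x. indicator A x \<partial>M) = (\<integral>\<^sup>+x. G x * indicator A x \<partial>M)"
      by (subst nn_integral_add[symmetric])
        (auto intro!: nn_integral_cong simp: A_def indicator_def diff_add_cancel_ennreal less_imp_le)
    also have "\<dots> \<le> emeasure M A" using \<nu>[OF A] by (simp add: G_int[OF A] emeasure_eq_measure)
    finally have "emeasure M A + (\<integral>\<^sup>+x. (G x - 1) * indicator A x \<partial>M) \<le> emeasure M A + 0"
      using A by (simp add: add.commute)
    then have "(\<integral>\<^sup>+x. (G x - 1) * indicator A x \<partial>M) = 0"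
      unfolding ennreal_add_left_cancel_le by simp
    then have "AE x in M. (G x - 1) * indicator A x = 0"
      by (subst (asm) nn_integral_0_iff_AE) auto
    then show ?thesis
      by (rule AE_mp) (auto intro!: AE_I2 simp: A_def indicator_def diff_eq_0_iff_ennreal split: if_splits)
  qed
  \<comment> \<open>The derivative is at most 1 almost everywhere; truncation makes the bounds hold
    at every point.\<close>
  define g where "g x = enn2real (min (G x) 1)" for x
  have g[measurable]: "g \<in> borel_measurable M" unfolding g_def by measurable
  have g01: "0 \<le> g x" "g x \<le> 1" for x
    using enn2real_mono[of "min (G x) 1" 1] by (auto simp: g_def)
  show thesis
  proof (rule that[OF g g01])
    fix A assume A[measurable]: "A \<in> sets M"
    have "ennreal (\<integral>x. indicator A x * g x \<partial>M) = (\<integral>\<^sup>+x. ennreal (indicator A x * g x) \<partial>M)"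
      using g01 by (intro nn_integral_eq_integral[symmetric] integrable_bounded[where K = 1]) (auto simp: indicator_def)
    also have "\<dots> = (\<integral>\<^sup>+x. G x * indicator A x \<partial>M)"
    proof (rule nn_integral_cong_AE)
      show "AE x in M. ennreal (indicator A x * g x) = G x * indicator A x"
        using \<open>AE x in M. G x \<le> 1\<close>
      proof eventually_elim
        case (elim x)
        then have "min (G x) 1 = G x" "G x < top" by (auto simp: min_def intro: le_less_trans)
        then show ?case by (auto simp: g_def indicator_def)
      qed
    qed
    also have "\<dots> = ennreal (\<nu> A)" by (rule G_int[OF A])
    finally have "(\<integral>x. indicator A x * g x \<partial>M) = \<nu> A"
      using \<nu>[OF A] g01 by (subst (asm) ennreal_inj) (auto intro!: Bochner_Integration.integral_nonneg)
    with \<nu>[OF A] show "((\<lambda>\<alpha>. \<integral>x. indicator A x * f \<alpha> x \<partial>M) \<longlongrightarrow> (\<integral>x. indicator A x * g x \<partial>M)) p"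
      by (simp add: I_def[abs_def])
  qed
qed

lemma weak_lim_of_real:
  fixes f :: "'a set \<Rightarrow> 'x \<Rightarrow> real"
  assumes f: "\<And>\<alpha>. f \<alpha> \<in> borel_measurable M" "\<And>\<alpha> x. \<bar>f \<alpha> x\<bar> \<le> 1"
    and g: "g \<in> borel_measurable M" "\<And>x. \<bar>g x\<bar> \<le> 1"
    and lim: "\<And>A. A \<in> sets M \<Longrightarrow>
      ((\<lambda>\<alpha>. \<integral>x. indicator A x * f \<alpha> x \<partial>M) \<longlongrightarrow> (\<integral>x. indicator A x * g x \<partial>M)) p"
  shows "weak_lim (\<lambda>\<alpha> x. of_real (f \<alpha> x)) (\<lambda>x. of_real (g x))"
proof (rule weak_lim_indicatorI[where K = 1])
  fix A assume "A \<in> sets M"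
  from tendsto_of_real[OF lim[OF this], where 'a = complex]
  show "((\<lambda>\<alpha>. \<integral>x. indicator A x *\<^sub>R complex_of_real (f \<alpha> x) \<partial>M)
      \<longlongrightarrow> (\<integral>x. indicator A x *\<^sub>R complex_of_real (g x) \<partial>M)) p"
    by (simp add: scaleR_conv_of_real flip: of_real_mult)
qed (use f g in \<open>auto intro: borel_measurable_of_real\<close>)

lemma weak_lim_linear:
  assumes "weak_lim f1 g1" "weak_lim f2 g2"
    and meas: "\<And>\<alpha>. f1 \<alpha> \<in> borel_measurable M" "\<And>\<alpha>. f2 \<alpha> \<in> borel_measurable M"
      "g1 \<in> borel_measurable M" "g2 \<in> borel_measurable M"
    and le: "\<And>\<alpha> x. norm (f1 \<alpha> x) \<le> K" "\<And>\<alpha> x. norm (f2 \<alpha> x) \<le> K"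
      "\<And>x. norm (g1 x) \<le> K" "\<And>x. norm (g2 x) \<le> K"
  shows "weak_lim (\<lambda>\<alpha> x. a * f1 \<alpha> x + b * f2 \<alpha> x) (\<lambda>x. a * g1 x + b * g2 x)"
  unfolding weak_lim_def
proof safe
  fix h :: "'x \<Rightarrow> complex" assume h: "integrable M h"
  have eq: "(\<integral>x. h x * (a * f x + b * g x) \<partial>M) = a * (\<integral>x. h x * f x \<partial>M) + b * (\<integral>x. h x * g x \<partial>M)"
    if "integrable M (\<lambda>x. h x * f x)" "integrable M (\<lambda>x. h x * g x)" for f g
    using that
    by (subst (1 2) integral_mult_right_zero[symmetric], subst Bochner_Integration.integral_add[symmetric])
      (auto simp: algebra_simps)
  have "((\<lambda>\<alpha>. a * (\<integral>x. h x * f1 \<alpha> x \<partial>M) + b * (\<integral>x. h x * f2 \<alpha> x \<partial>M))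
      \<longlongrightarrow> a * (\<integral>x. h x * g1 x \<partial>M) + b * (\<integral>x. h x * g2 x \<partial>M)) p"
    using assms(1,2) h by (intro tendsto_intros weak_limD)
  then show "((\<lambda>\<alpha>. \<integral>x. h x * (a * f1 \<alpha> x + b * f2 \<alpha> x) \<partial>M) \<longlongrightarrow> (\<integral>x. h x * (a * g1 x + b * g2 x) \<partial>M)) p"
    by (subst (1 2) eq) (auto intro!: integrable_mult_bounded[OF h, where K = K] meas le)
qed

text \<open>The real case applies to (1 + Re f) / 2 and (1 + Im f) / 2, which take values in [0, 1];
  undoing this affine map gives a limit bounded by |2 g1 - 1| + |2 g2 - 1|. The 3 is a crude bound
  for that sum.\<close>

lemma weak_lim_exists:
  assumes f[measurable]: "\<And>\<alpha>. f \<alpha> \<in> borel_measurable M" and f_le: "\<And>\<alpha> x. norm (f \<alpha> x) \<le> 1"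
  obtains g where "g \<in> borel_measurable M" "\<And>x. norm (g x) \<le> 3" "weak_lim f g"
proof -
  have half: "\<exists>g. g \<in> borel_measurable M \<and> (\<forall>x. 0 \<le> g x \<and> g x \<le> 1) \<and>
      weak_lim (\<lambda>\<alpha> x. of_real ((1 + k \<alpha> x) / 2)) (\<lambda>x. of_real (g x))"
    if [measurable]: "\<And>\<alpha>. k \<alpha> \<in> borel_measurable M" and "\<And>\<alpha> x. \<bar>k \<alpha> x\<bar> \<le> 1" for k :: "'a set \<Rightarrow> 'x \<Rightarrow> real"
  proof -
    have k: "0 \<le> (1 + k \<alpha> x) / 2" "(1 + k \<alpha> x) / 2 \<le> 1" for \<alpha> x
      using that(2)[of \<alpha> x] by auto
    obtain g where g: "g \<in> borel_measurable M" "\<And>x. 0 \<le> g x" "\<And>x. g x \<le> 1"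
      and lim: "\<And>A. A \<in> sets M \<Longrightarrow>
        ((\<lambda>\<alpha>. \<integral>x. indicator A x * ((1 + k \<alpha> x) / 2) \<partial>M) \<longlongrightarrow> (\<integral>x. indicator A x * g x \<partial>M)) p"
      by (rule real_weak_lim_exists[of "\<lambda>\<alpha> x. (1 + k \<alpha> x) / 2"]) (use k in auto)
    have "weak_lim (\<lambda>\<alpha> x. of_real ((1 + k \<alpha> x) / 2)) (\<lambda>x. of_real (g x))"
      using g k lim by (intro weak_lim_of_real) auto
    with g show ?thesis by blast
  qed
  have Re_le: "\<bar>Re (f \<alpha> x)\<bar> \<le> 1" and Im_le: "\<bar>Im (f \<alpha> x)\<bar> \<le> 1" for \<alpha> x
    using f_le[of \<alpha> x] abs_Re_le_cmod abs_Im_le_cmod order_trans by blast+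
  obtain g1 where g1: "g1 \<in> borel_measurable M" "\<And>x. 0 \<le> g1 x \<and> g1 x \<le> 1"
    "weak_lim (\<lambda>\<alpha> x. of_real ((1 + Re (f \<alpha> x)) / 2)) (\<lambda>x. of_real (g1 x))"
    using half[of "\<lambda>\<alpha> x. Re (f \<alpha> x)"] Re_le by auto
  obtain g2 where g2: "g2 \<in> borel_measurable M" "\<And>x. 0 \<le> g2 x \<and> g2 x \<le> 1"
    "weak_lim (\<lambda>\<alpha> x. of_real ((1 + Im (f \<alpha> x)) / 2)) (\<lambda>x. of_real (g2 x))"
    using half[of "\<lambda>\<alpha> x. Im (f \<alpha> x)"] Im_le by auto
  note [measurable] = g1(1) g2(1)
  have unit: "norm (complex_of_real t) \<le> 1" if "0 \<le> t" "t \<le> 1" for t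
    using that by simp
  have half_le: "norm (complex_of_real ((1 + t) / 2)) \<le> 1" if "\<bar>t\<bar> \<le> 1" for t
    using that by (intro unit) auto
  have w1: "weak_lim (\<lambda>\<alpha> x. 2 * of_real ((1 + Re (f \<alpha> x)) / 2) + (2 * \<i>) * of_real ((1 + Im (f \<alpha> x)) / 2))
     (\<lambda>x. 2 * of_real (g1 x) + (2 * \<i>) * of_real (g2 x))"
    using g1 g2 Re_le Im_le
    by (intro weak_lim_linear[where K = 1] half_le) (auto intro!: unit)
  have w0: "weak_lim (\<lambda>\<alpha> x. 1) (\<lambda>x. 1)" by (simp add: weak_lim_def)
  have bd1: "norm (2 * complex_of_real s + (2 * \<i>) * of_real t) \<le> 4" if "0 \<le> s" "s \<le> 1" "0 \<le> t" "t \<le> 1" for s t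
    using norm_triangle_ineq[of "2 * complex_of_real s" "(2 * \<i>) * of_real t"] that by (simp add: norm_mult)
  have "weak_lim (\<lambda>\<alpha> x. 1 * (2 * of_real ((1 + Re (f \<alpha> x)) / 2) + (2 * \<i>) * of_real ((1 + Im (f \<alpha> x)) / 2)) + (- 1 - \<i>) * 1)
     (\<lambda>x. 1 * (2 * of_real (g1 x) + (2 * \<i>) * of_real (g2 x)) + (- 1 - \<i>) * 1)"
  proof (rule weak_lim_linear[OF w1 w0, where K = 4])
    show "norm (2 * complex_of_real ((1 + Re (f \<alpha> x)) / 2) + (2 * \<i>) * of_real ((1 + Im (f \<alpha> x)) / 2)) \<le> 4" for \<alpha> x
      using Re_le[of \<alpha> x] Im_le[of \<alpha> x] by (intro bd1) auto
    show "norm (2 * complex_of_real (g1 x) + (2 * \<i>) * of_real (g2 x)) \<le> 4" for x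
      using g1(2)[of x] g2(2)[of x] by (intro bd1) auto
  qed auto
  moreover have "1 * (2 * of_real ((1 + Re z) / 2) + (2 * \<i>) * of_real ((1 + Im z) / 2)) + (- 1 - \<i>) * 1 = z" for z
    by (auto simp: complex_eq_iff field_simps)
  ultimately have w: "weak_lim f (\<lambda>x. 1 * (2 * of_real (g1 x) + (2 * \<i>) * of_real (g2 x)) + (- 1 - \<i>) * 1)"
    by simp
  show thesis
  proof (rule that[OF _ _ w])
    fix x
    have "1 * (2 * of_real (g1 x) + (2 * \<i>) * of_real (g2 x)) + (- 1 - \<i>) * 1 = Complex (2 * g1 x - 1) (2 * g2 x - 1)"
      by (simp add: complex_eq_iff)
    also have "norm \<dots> \<le> \<bar>2 * g1 x - 1\<bar> + \<bar>2 * g2 x - 1\<bar>"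
      using cmod_le[of "Complex (2 * g1 x - 1) (2 * g2 x - 1)"] by simp
    also have "\<dots> \<le> 3" using g1(2)[of x] g2(2)[of x] by auto
    finally show "norm (1 * (2 * of_real (g1 x) + (2 * \<i>) * of_real (g2 x)) + (- 1 - \<i>) * 1) \<le> (3::real)" .
  qed auto
qed

section \<open>Unimodular functions whose weak limit is an indicator function\<close>

lemma integral_complex_indicator:
  assumes "A \<in> sets M"
  shows "(\<integral>x. indicator A x \<partial>M) = complex_of_real (measure M A)"
proof -
  have "(\<integral>x. indicator A x \<partial>M) = (\<integral>x. complex_of_real (indicator A x) \<partial>M)"
    by (intro Bochner_Integration.integral_cong) (auto simp: indicator_def)
  also have "\<dots> = of_real (\<integral>x. indicator A x \<partial>M)" by (rule integral_complex_of_real)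
  also have "(\<integral>x. indicator A x \<partial>M) = measure M A" using assms by simp
  finally show ?thesis .
qed

definition unimodular :: "('x \<Rightarrow> complex) \<Rightarrow> bool" where
  "unimodular f \<longleftrightarrow> f \<in> borel_measurable M \<and> (\<forall>x. norm (f x) = 1)"

lemma unimodularD:
  assumes "unimodular f"
  shows "f \<in> borel_measurable M" "norm (f x) = 1"
  using assms by (auto simp: unimodular_def)

text \<open>For unimodular functions |f - 1|^2 = 2 (1 - Re f) is affine in \<open>f\<close>, so the
  weak limit alone determines the limit of its integral over \<open>A\<close>.\<close>

lemma weak_lim_indicator_square:
  assumes f: "\<And>\<alpha>. unimodular (f \<alpha>)" and A: "A \<in> sets M" "weak_lim f (indicator A)"
  shows "((\<lambda>\<alpha>. \<integral>x. indicator A x * (norm (f \<alpha> x - 1))\<^sup>2 \<partial>M) \<longlongrightarrow> 0) p"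
proof -
  note [measurable] = unimodularD(1)[OF f] A(1)
  have int: "integrable M (indicator A :: 'x \<Rightarrow> complex)"
    by (intro integrable_bounded[where K = 1]) (auto simp: indicator_def)
  have int2: "integrable M (\<lambda>x. indicator A x * f \<alpha> x)" for \<alpha>
    by (intro integrable_mult_bounded[OF int, where K = 1]) (auto simp: unimodularD[OF f])
  have "(\<integral>x. indicator A x * indicator A x \<partial>M) = complex_of_real (measure M A)"
    by (simp add: integral_complex_indicator A flip: indicator_inter_arith)
  then have "((\<lambda>\<alpha>. 2 * (measure M A - Re (\<integral>x. indicator A x * f \<alpha> x \<partial>M))) \<longlongrightarrow>
      2 * (measure M A - Re (complex_of_real (measure M A)))) p"
    using weak_limD[OF A(2) int] by (intro tendsto_intros) simp
  moreover have "2 * (measure M A - Re (\<integral>x. indicator A x * f \<alpha> x \<partial>M)) = (\<integral>x. indicator A x * (norm (f \<alpha> x - 1))\<^sup>2 \<partial>M)" for \<alpha>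
  proof -
    have "(\<integral>x. indicator A x * (norm (f \<alpha> x - 1))\<^sup>2 \<partial>M) = (\<integral>x. 2 * (indicator A x - Re (indicator A x * f \<alpha> x)) \<partial>M)"
    proof (intro Bochner_Integration.integral_cong refl)
      fix x
      have "(Re (f \<alpha> x))\<^sup>2 + (Im (f \<alpha> x))\<^sup>2 = 1"
        using unimodularD(2)[OF f, of \<alpha> x] by (simp flip: cmod_power2)
      then have "(norm (f \<alpha> x - 1))\<^sup>2 = 2 * (1 - Re (f \<alpha> x))"
        unfolding cmod_power2 by (simp add: power2_eq_square algebra_simps)
      then show "indicator A x * (norm (f \<alpha> x - 1))\<^sup>2 = 2 * (indicator A x - Re (indicator A x * f \<alpha> x))"
        by (auto simp: indicator_def)
    qed
    also have "\<dots> = 2 * (measure M A - Re (\<integral>x. indicator A x * f \<alpha> x \<partial>M))"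
    proof -
      have "integrable M (indicat_real A)"
        by (intro integrable_bounded[where K = 1]) (auto simp: indicator_def)
      then show ?thesis
        using int2[of \<alpha>] A(1)
        by (simp only: integral_mult_right_zero integral_Re integrable_Re Bochner_Integration.integral_diff) simp
    qed
    finally show ?thesis by simp
  qed
  ultimately show ?thesis by simp
qed

text \<open>Passage from L^2 to L^1 on a probability space; Cauchy-Schwarz appears as nonnegativity
  of a variance.\<close>

lemma weak_lim_indicator_norm:
  assumes f: "\<And>\<alpha>. unimodular (f \<alpha>)" and A: "A \<in> sets M" "weak_lim f (indicator A)"
  shows "((\<lambda>\<alpha>. \<integral>x. indicator A x * norm (f \<alpha> x - 1) \<partial>M) \<longlongrightarrow> 0) p"
proof -
  note [measurable] = unimodularD(1)[OF f] A(1)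
  have n2: "norm (f \<alpha> x - 1) \<le> 2" for \<alpha> x
    using norm_triangle_ineq4[of "f \<alpha> x" 1] by (simp add: unimodularD[OF f])
  have le: "(\<integral>x. indicator A x * norm (f \<alpha> x - 1) \<partial>M) \<le> sqrt (\<integral>x. indicator A x * (norm (f \<alpha> x - 1))\<^sup>2 \<partial>M)" for \<alpha>
  proof -
    let ?X = "\<lambda>x. indicator A x * norm (f \<alpha> x - 1)"
    have sq: "(?X x)\<^sup>2 = indicator A x * (norm (f \<alpha> x - 1))\<^sup>2" for x
      by (auto simp: indicator_def)
    have "integrable M ?X"
      using n2 by (intro integrable_bounded[where K = 2]) (auto simp: indicator_def)
    moreover have "integrable M (\<lambda>x. (?X x)\<^sup>2)"
      using power_mono[OF n2 norm_ge_zero, of _ _ 2] by (intro integrable_bounded[where K = 4]) (auto simp: indicator_def)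
    ultimately have "0 \<le> expectation (\<lambda>x. (?X x)\<^sup>2) - (expectation ?X)\<^sup>2"
      using variance_eq[of ?X] variance_positive[of ?X] by simp
    then have "(expectation ?X)\<^sup>2 \<le> (\<integral>x. indicator A x * (norm (f \<alpha> x - 1))\<^sup>2 \<partial>M)" by (simp add: sq)
    then show ?thesis by (rule real_le_rsqrt)
  qed
  show ?thesis
  proof (rule tendsto_sandwich[OF _ _ tendsto_const])
    show "((\<lambda>\<alpha>. sqrt (\<integral>x. indicator A x * (norm (f \<alpha> x - 1))\<^sup>2 \<partial>M)) \<longlongrightarrow> 0) p"
      using tendsto_real_sqrt[OF weak_lim_indicator_square[OF assms]] by simp
  qed (use le in \<open>auto intro!: always_eventually Bochner_Integration.integral_nonneg\<close>)
qed

text \<open>On \<open>A \<inter> B\<close> both factors tend to 1 in norm, hence so does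
  \<open>h\<close>; its weak limit cannot vanish on a part of positive measure. Applied to
  differences of coefficient vectors, this gives closure under subtraction.\<close>

lemma weak_lim_indicator_prod:
  assumes f: "\<And>\<alpha>. unimodular (f \<alpha>)" "\<And>\<alpha>. unimodular (g \<alpha>)" "\<And>\<alpha>. unimodular (h \<alpha>)"
    and h: "\<And>\<alpha> x. h \<alpha> x = f \<alpha> x * cnj (g \<alpha> x)"
    and A: "A \<in> sets M" "weak_lim f (indicator A)"
    and B: "B \<in> sets M" "weak_lim g (indicator B)"
    and C: "C \<in> sets M" "weak_lim h (indicator C)"
  shows "measure M (A \<inter> B - C) = 0"
proof -
  note [measurable] = unimodularD(1)[OF f(1)] unimodularD(1)[OF f(2)] unimodularD(1)[OF f(3)] A(1) B(1) C(1)
  have n2: "norm (u \<alpha> x - 1) \<le> 2" if "\<And>\<alpha>. unimodular (u \<alpha>)" for u :: "'a set \<Rightarrow> 'x \<Rightarrow> complex" and \<alpha> x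
    using norm_triangle_ineq4[of "u \<alpha> x" 1] by (simp add: unimodularD[OF that])
  let ?D = "A \<inter> B - C"
  have intD: "integrable M (indicator ?D :: 'x \<Rightarrow> complex)"
    by (intro integrable_bounded[where K = 1]) (auto simp: indicator_def)
  have le: "norm (of_real (measure M ?D) - (\<integral>x. indicator ?D x * h \<alpha> x \<partial>M)) \<le>
    (\<integral>x. indicator A x * norm (f \<alpha> x - 1) \<partial>M) + (\<integral>x. indicator B x * norm (g \<alpha> x - 1) \<partial>M)" for \<alpha>
  proof -
    have iA: "integrable M (\<lambda>x. indicator A x * norm (f \<alpha> x - 1))"
      using n2[OF f(1)] by (intro integrable_bounded[where K = 2]) (auto simp: indicator_def)
    have iB: "integrable M (\<lambda>x. indicator B x * norm (g \<alpha> x - 1))"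
      using n2[OF f(2)] by (intro integrable_bounded[where K = 2]) (auto simp: indicator_def)
    have iD: "integrable M (\<lambda>x. indicator ?D x * h \<alpha> x)"
      by (intro integrable_mult_bounded[OF intD, where K = 1]) (auto simp: unimodularD[OF f(3)])
    have D: "?D \<in> sets M" using A(1) B(1) C(1) by auto
    have "of_real (measure M ?D) - (\<integral>x. indicator ?D x * h \<alpha> x \<partial>M) = (\<integral>x. indicator ?D x - indicator ?D x * h \<alpha> x \<partial>M)"
      using Bochner_Integration.integral_diff[OF intD iD] integral_complex_indicator[OF D] by simp
    also have "norm \<dots> \<le> (\<integral>x. indicator A x * norm (f \<alpha> x - 1) + indicator B x * norm (g \<alpha> x - 1) \<partial>M)"
    proof (rule norm_integral_le[OF Bochner_Integration.integrable_add[OF iA iB]])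
      fix x
      have "1 - h \<alpha> x = g \<alpha> x * cnj (g \<alpha> x) - f \<alpha> x * cnj (g \<alpha> x)"
        using unimodularD(2)[OF f(2)] by (simp add: h complex_norm_square[symmetric])
      also have "\<dots> = ((g \<alpha> x - 1) - (f \<alpha> x - 1)) * cnj (g \<alpha> x)" by (simp add: algebra_simps)
      finally have "norm (1 - h \<alpha> x) = norm ((g \<alpha> x - 1) - (f \<alpha> x - 1))"
        using unimodularD(2)[OF f(2)] by (simp add: norm_mult)
      also have "\<dots> \<le> norm (g \<alpha> x - 1) + norm (f \<alpha> x - 1)" by (rule norm_triangle_ineq4)
      finally show "norm (indicator ?D x - indicator ?D x * h \<alpha> x) \<le> indicator A x * norm (f \<alpha> x - 1) + indicator B x * norm (g \<alpha> x - 1)"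
        by (auto simp: indicator_def)
    qed
    also have "\<dots> = (\<integral>x. indicator A x * norm (f \<alpha> x - 1) \<partial>M) + (\<integral>x. indicator B x * norm (g \<alpha> x - 1) \<partial>M)"
      using iA iB by simp
    finally show ?thesis .
  qed
  have "(\<integral>x. indicator ?D x * indicator C x \<partial>M) = (\<integral>x. 0 \<partial>M :: complex)"
    by (intro Bochner_Integration.integral_cong) (auto simp: indicator_def)
  then have "((\<lambda>\<alpha>. of_real (measure M ?D) - (\<integral>x. indicator ?D x * h \<alpha> x \<partial>M)) \<longlongrightarrow> complex_of_real (measure M ?D) - 0) p"
    using weak_limD[OF C(2) intD] by (intro tendsto_intros) simp
  moreover have "((\<lambda>\<alpha>. of_real (measure M ?D) - (\<integral>x. indicator ?D x * h \<alpha> x \<partial>M)) \<longlongrightarrow> 0) p"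
  proof (rule Lim_null_comparison)
    show "((\<lambda>\<alpha>. (\<integral>x. indicator A x * norm (f \<alpha> x - 1) \<partial>M) + (\<integral>x. indicator B x * norm (g \<alpha> x - 1) \<partial>M)) \<longlongrightarrow> 0) p"
      using tendsto_add[OF weak_lim_indicator_norm[OF f(1) A] weak_lim_indicator_norm[OF f(2) B]] by simp
  qed (use le in auto)
  ultimately show ?thesis using tendsto_unique[OF nonbot] by fastforce
qed

section \<open>Convergence in measure of set families under a chain condition\<close>

lemma integral_indicator_mult_pos:
  fixes f :: "'x \<Rightarrow> real"
  assumes [measurable]: "f \<in> borel_measurable M" "A \<in> sets M"
    and "\<And>x. 0 \<le> f x" "\<And>x. f x \<le> 1" "\<And>x. x \<in> A \<Longrightarrow> 0 < f x" "0 < measure M A"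
  shows "0 < (\<integral>x. indicator A x * f x \<partial>M)"
proof -
  have int: "integrable M (\<lambda>x. indicator A x * f x)"
    using assms(3,4) by (intro integrable_bounded[where K = 1]) (auto simp: indicator_def)
  have nonneg: "0 \<le> (\<integral>x. indicator A x * f x \<partial>M)"
    using assms(3) by (intro Bochner_Integration.integral_nonneg) auto
  have "(\<integral>x. indicator A x * f x \<partial>M) \<noteq> 0"
  proof
    assume "(\<integral>x. indicator A x * f x \<partial>M) = 0"
    then have "AE x in M. indicator A x * f x = 0"
      using int assms(3) by (subst (asm) integral_nonneg_eq_0_iff_AE) auto
    then have "AE x in M. x \<notin> A"
      by eventually_elim (use assms(5) in \<open>force simp: indicator_def\<close>)
    then have "measure M A = 0"
      using AE_iff_null_sets[OF assms(2)] by (simp add: null_sets_def measure_def)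
    with assms(6) show False by simp
  qed
  with nonneg show ?thesis by simp
qed

text \<open>Each choice of \<open>\<beta>\<close> below splits the set where the weak limit is fractional into two
  parts of positive measure; a sequence of such choices contradicts the chain hypothesis.\<close>

lemma chain_condition_limit_set:
  assumes S: "\<And>\<beta>. S \<beta> \<in> sets M"
    and chain: "\<And>b :: nat \<Rightarrow> 'a set. \<exists>n. measure M ((\<Inter>i<n. S (b i)) \<inter> space M - S (b n)) = 0"
  obtains B where "B \<in> sets M" "((\<lambda>\<beta>. measure M (B - S \<beta>)) \<longlongrightarrow> 0) p"
    "((\<lambda>\<beta>. measure M (S \<beta> - B)) \<longlongrightarrow> 0) p"
proof -
  note [measurable] = S
  \<comment> \<open>The sets converge in measure exactly when the weak limit \<open>r\<close> of
    their indicators is itself an indicator; \<open>T0\<close> is where this fails.\<close>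
  obtain r :: "'x \<Rightarrow> real" where r[measurable]: "r \<in> borel_measurable M" and r01: "\<And>x. 0 \<le> r x" "\<And>x. r x \<le> 1"
    and lim: "\<And>A. A \<in> sets M \<Longrightarrow>
      ((\<lambda>\<beta>. \<integral>x. indicator A x * indicator (S \<beta>) x \<partial>M) \<longlongrightarrow> (\<integral>x. indicator A x * r x \<partial>M)) p"
    by (rule real_weak_lim_exists[of "\<lambda>\<beta>. indicat_real (S \<beta>)"]) (use S in simp_all)
  have lim1: "((\<lambda>\<beta>. measure M (A \<inter> S \<beta>)) \<longlongrightarrow> (\<integral>x. indicator A x * r x \<partial>M)) p" if "A \<in> sets M" for A
  proof -
    have "(\<integral>x. indicator A x * indicator (S \<beta>) x \<partial>M) = measure M (A \<inter> S \<beta>)" for \<beta>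
      using that S by (simp flip: indicator_inter_arith)
    with lim[OF that] show ?thesis by simp
  qed
  have lim2: "((\<lambda>\<beta>. measure M (A - S \<beta>)) \<longlongrightarrow> (\<integral>x. indicator A x * (1 - r x) \<partial>M)) p" if [measurable]: "A \<in> sets M" for A
  proof -
    have "measure M (A - S \<beta>) = measure M A - measure M (A \<inter> S \<beta>)" for \<beta>
      using finite_measure_Diff'[OF that S] by simp
    moreover have "(\<integral>x. indicator A x * (1 - r x) \<partial>M) = measure M A - (\<integral>x. indicator A x * r x \<partial>M)"
    proof -
      have "integrable M (indicat_real A)" "integrable M (\<lambda>x. indicator A x * r x)"
        using r01 by (auto intro!: integrable_bounded[where K = 1] simp: indicator_def)
      then have "(\<integral>x. indicator A x - indicator A x * r x \<partial>M) = measure M A - (\<integral>x. indicator A x * r x \<partial>M)"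
        by (subst Bochner_Integration.integral_diff) auto
      then show ?thesis by (simp add: right_diff_distrib)
    qed
    ultimately show ?thesis
      using tendsto_diff[OF tendsto_const lim1[OF that], of "measure M A"] by simp
  qed
  define T0 where "T0 = {x\<in>space M. 0 < r x \<and> r x < 1}"
  have [measurable]: "T0 \<in> sets M" by (simp add: T0_def)
  have "measure M T0 = 0"
  proof (rule ccontr)
    assume "measure M T0 \<noteq> 0"
    then have T0: "0 < measure M T0" by (simp add: zero_less_measure_iff)
    define P where "P T \<longleftrightarrow> T \<in> sets M \<and> T \<subseteq> T0 \<and> 0 < measure M T" for T
    have split: "\<exists>T'. P T' \<and> (\<exists>\<beta>. T' = T \<inter> S \<beta> \<and> 0 < measure M (T - S \<beta>))" if "P T" for T
    proof -
      have [measurable]: "T \<in> sets M" and T: "T \<subseteq> T0" "0 < measure M T" using that by (auto simp: P_def)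
      have "0 < (\<integral>x. indicator T x * r x \<partial>M)" "0 < (\<integral>x. indicator T x * (1 - r x) \<partial>M)"
        using T r01 by (auto intro!: integral_indicator_mult_pos simp: T0_def)
      then have "\<forall>\<^sub>F \<beta> in p. 0 < measure M (T \<inter> S \<beta>) \<and> 0 < measure M (T - S \<beta>)"
        using order_tendstoD(1)[OF lim1[of T], of 0] order_tendstoD(1)[OF lim2[of T], of 0]
        by (simp add: eventually_conj_iff)
      then obtain \<beta> where "0 < measure M (T \<inter> S \<beta>)" "0 < measure M (T - S \<beta>)"
        using eventually_happens'[OF nonbot] by blast
      then show ?thesis using T by (intro exI[of _ "T \<inter> S \<beta>"]) (auto simp: P_def)
    qed
    have "\<exists>f. \<forall>n. P (f n) \<and> (\<exists>\<beta>. f (Suc n) = f n \<inter> S \<beta> \<and> 0 < measure M (f n - S \<beta>))"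
    proof (rule dependent_nat_choice)
      show "\<exists>T. P T" using T0 by (intro exI[of _ T0]) (simp add: P_def)
    qed (rule split)
    then obtain f b where f: "\<And>n. P (f n)"
      and b: "\<And>n. f (Suc n) = f n \<inter> S (b n)" "\<And>n. 0 < measure M (f n - S (b n))"
      by metis
    \<comment> \<open>The piece chosen at stage \<open>n\<close> lies in the first \<open>n\<close>
      sets, yet loses positive measure to the next one, for every \<open>n\<close>.\<close>
    have sub: "f n \<subseteq> (\<Inter>i<n. S (b i)) \<inter> space M" for n
    proof (induction n)
      case 0
      then show ?case using f[of 0] by (auto simp: P_def T0_def)
    next
      case (Suc n)
      have "(\<Inter>i<Suc n. S (b i)) = (\<Inter>i<n. S (b i)) \<inter> S (b n)" by (auto simp: less_Suc_eq)
      with Suc show ?case by (simp only: b(1)) blast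
    qed
    obtain n where "measure M ((\<Inter>i<n. S (b i)) \<inter> space M - S (b n)) = 0" using chain by blast
    moreover have "measure M (f n - S (b n)) \<le> measure M ((\<Inter>i<n. S (b i)) \<inter> space M - S (b n))"
    proof (rule finite_measure_mono)
      show "(\<Inter>i<n. S (b i)) \<inter> space M - S (b n) \<in> sets M"
        by (cases "n = 0") (auto intro!: sets.Diff sets.Int sets.finite_INT S)
    qed (rule Diff_mono[OF sub subset_refl])
    ultimately show False using b(2)[of n] by simp
  qed
  then have AE01: "AE x in M. r x = 0 \<or> r x = 1"
  proof -
    have "emeasure M T0 = 0" using \<open>measure M T0 = 0\<close> by (simp add: emeasure_eq_measure)
    then have "AE x in M. x \<notin> T0" by (intro AE_not_in) (simp add: null_sets_def)
    then show ?thesis using AE_space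
      by eventually_elim (use r01 in \<open>force simp: T0_def order.strict_iff_order\<close>)
  qed
  define B where "B = {x\<in>space M. r x = 1}"
  have B[measurable]: "B \<in> sets M" by (simp add: B_def)
  show thesis
  proof (rule that[OF B])
    have "(\<integral>x. indicator B x * (1 - r x) \<partial>M) = (\<integral>x. 0 \<partial>M)"
      by (intro Bochner_Integration.integral_cong) (auto simp: B_def indicator_def)
    then show "((\<lambda>\<beta>. measure M (B - S \<beta>)) \<longlongrightarrow> 0) p" using lim2[OF B] by simp
    have "(\<integral>x. indicator (space M - B) x * r x \<partial>M) = (\<integral>x. 0 \<partial>M)"
      using AE01 by (intro integral_cong_AE) (auto simp: B_def indicator_def elim!: AE_mp)
    moreover have "(space M - B) \<inter> S \<beta> = S \<beta> - B" for \<beta>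
      using sets.sets_into_space[OF S] by blast
    ultimately show "((\<lambda>\<beta>. measure M (S \<beta> - B)) \<longlongrightarrow> 0) p"
      using lim1[of "space M - B"] by simp
  qed
qed

section \<open>Almost orthogonal sums and the inductive step for weak limits\<close>

lemma sum_list_unimodular:
  assumes u: "\<And>\<alpha>. unimodular (u \<alpha>)"
  shows "(\<lambda>x. \<Sum>b\<leftarrow>bs. u b x) \<in> borel_measurable M" "norm (\<Sum>b\<leftarrow>bs. u b x) \<le> length bs"
proof -
  note [measurable] = unimodularD(1)[OF u]
  show "(\<lambda>x. \<Sum>b\<leftarrow>bs. u b x) \<in> borel_measurable M" by (induction bs) auto
  show "norm (\<Sum>b\<leftarrow>bs. u b x) \<le> length bs"
  proof (induction bs)
    case (Cons b bs)
    then show ?case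
      using norm_triangle_ineq[of "u b x" "\<Sum>b\<leftarrow>bs. u b x"] unimodularD(2)[OF u, of b x] by simp
  qed simp
qed

text \<open>Expanding the square, each of the n diagonal terms gives at most 1 and each off-diagonal
  term at most \<open>e\<close>. The hypothesis covers only ordered pairs; the opposite ones are
  their conjugates and enter through twice the real part.\<close>

lemma integral_norm_list_square_le:
  fixes u :: "'a set \<Rightarrow> 'x \<Rightarrow> complex" and e :: real
  assumes u: "\<And>\<alpha>. unimodular (u \<alpha>)" and C[measurable]: "C \<in> sets M"
    and "sorted_wrt (\<lambda>a b. norm (\<integral>x. indicator C x * (u a x * cnj (u b x)) \<partial>M) \<le> e) as" "0 \<le> e"
  shows "(\<integral>x. indicator C x * (norm (\<Sum>a\<leftarrow>as. u a x))\<^sup>2 \<partial>M) \<le> length as + e * (length as)\<^sup>2"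
  using assms(3)
proof (induction as)
  case Nil
  then show ?case by simp
next
  case (Cons a as)
  note [measurable] = unimodularD(1)[OF u]
  let ?s = "\<lambda>x. \<Sum>b\<leftarrow>as. u b x"
  note [measurable] = sum_list_unimodular(1)[OF u] and s_le = sum_list_unimodular(2)[OF u]
  have int_u: "integrable M (\<lambda>x. indicator C x * (u a x * cnj (u b x)))" for b
    by (rule integrable_bounded[where K = 1], measurable) (auto simp: indicator_def norm_mult unimodularD(2)[OF u])
  have cross: "(\<integral>x. indicator C x * (u a x * cnj (\<Sum>b\<leftarrow>bs. u b x)) \<partial>M) = (\<Sum>b\<leftarrow>bs. \<integral>x. indicator C x * (u a x * cnj (u b x)) \<partial>M)
      \<and> integrable M (\<lambda>x. indicator C x * (u a x * cnj (\<Sum>b\<leftarrow>bs. u b x)))" for bs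
  proof (induction bs)
    case (Cons b bs)
    then show ?case
      using Bochner_Integration.integral_add[OF int_u[of b] conjunct2[OF Cons]]
        Bochner_Integration.integrable_add[OF int_u[of b] conjunct2[OF Cons]]
      by (simp add: algebra_simps)
  qed simp
  have "norm (\<Sum>b\<leftarrow>bs. \<integral>x. indicator C x * (u a x * cnj (u b x)) \<partial>M) \<le> e * length bs"
    if "\<forall>b\<in>set bs. norm (\<integral>x. indicator C x * (u a x * cnj (u b x)) \<partial>M) \<le> e" for bs
    using that
  proof (induction bs)
    case (Cons b bs)
    then show ?case
      using norm_triangle_ineq[of "\<integral>x. indicator C x * (u a x * cnj (u b x)) \<partial>M" "\<Sum>b\<leftarrow>bs. \<integral>x. indicator C x * (u a x * cnj (u b x)) \<partial>M"]
      by (simp add: algebra_simps)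
  qed simp
  from this[of as] cross[of as] have cross_le: "norm (\<integral>x. indicator C x * (u a x * cnj (?s x)) \<partial>M) \<le> e * length as"
    using Cons.prems by simp
  have i1: "integrable M (indicat_real C)"
    by (intro integrable_bounded[where K = 1]) (auto simp: indicator_def)
  have i2: "integrable M (\<lambda>x. Re (indicator C x * (u a x * cnj (?s x))))"
    using cross[of as] by (intro integrable_Re) simp
  have i3: "integrable M (\<lambda>x. indicator C x * (norm (?s x))\<^sup>2)"
  proof (rule integrable_bounded[where K = "(length as)\<^sup>2"])
    have "(norm (?s x))\<^sup>2 \<le> (real (length as))\<^sup>2" for x
      by (intro power_mono s_le norm_ge_zero)
    then show "norm (indicator C x * (norm (?s x))\<^sup>2) \<le> (length as)\<^sup>2" for x
      by (auto simp: indicator_def)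
  qed measurable
  have "(\<integral>x. indicator C x * (norm (\<Sum>b\<leftarrow>a # as. u b x))\<^sup>2 \<partial>M)
      = (\<integral>x. indicator C x + 2 * Re (indicator C x * (u a x * cnj (?s x))) + indicator C x * (norm (?s x))\<^sup>2 \<partial>M)"
  proof (intro Bochner_Integration.integral_cong refl)
    fix x
    have "(norm (u a x + ?s x))\<^sup>2 = (norm (u a x))\<^sup>2 + 2 * Re (u a x * cnj (?s x)) + (norm (?s x))\<^sup>2"
      unfolding cmod_power2 by (simp add: power2_eq_square algebra_simps)
    then show "indicator C x * (norm (\<Sum>b\<leftarrow>a # as. u b x))\<^sup>2
        = indicator C x + 2 * Re (indicator C x * (u a x * cnj (?s x))) + indicator C x * (norm (?s x))\<^sup>2"
      by (auto simp: indicator_def unimodularD(2)[OF u])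
  qed
  also have "\<dots> = measure M C + 2 * Re (\<integral>x. indicator C x * (u a x * cnj (?s x)) \<partial>M)
      + (\<integral>x. indicator C x * (norm (?s x))\<^sup>2 \<partial>M)"
  proof -
    have "(\<integral>x. Re (indicator C x * (u a x * cnj (?s x))) \<partial>M) = Re (\<integral>x. indicator C x * (u a x * cnj (?s x)) \<partial>M)"
      using cross[of as] by (intro integral_Re) simp
    then show ?thesis
      using i1 i2 i3 C by (simp only: Bochner_Integration.integral_add Bochner_Integration.integrable_add integrable_mult_right integral_mult_right_zero) simp
  qed
  also have "\<dots> \<le> 1 + 2 * (e * length as) + (length as + e * (length as)\<^sup>2)"
    using Cons cross_le complex_Re_le_cmod[of "\<integral>x. indicator C x * (u a x * cnj (?s x)) \<partial>M"]
    by (intro add_mono mult_left_mono) auto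
  also have "\<dots> \<le> length (a # as) + e * (length (a # as))\<^sup>2"
    using \<open>0 \<le> e\<close> by (simp add: power2_eq_square algebra_simps)
  finally show ?case .
qed

text \<open>For fixed \<beta> the factor \<open>v \<beta> \<alpha>\<close> tends to 1 in norm on
  \<open>S \<beta>\<close> and weakly to 0 off it. On the limit \<open>B\<close> of these sets,
  identity \<open>uv\<close> makes the characters asymptotically multiplicative; off
  \<open>B\<close> it makes those of \<beta> \<union> \<alpha> and \<alpha> asymptotically
  orthogonal. \<open>T\<close> is the part of \<open>B\<close> where the limit is 1.\<close>

lemma weak_lim_step:
  fixes u :: "'a set \<Rightarrow> 'x \<Rightarrow> complex" and v :: "'a set \<Rightarrow> 'a set \<Rightarrow> 'x \<Rightarrow> complex"
  assumes u: "\<And>\<alpha>. unimodular (u \<alpha>)" and v: "\<And>\<beta> \<alpha>. unimodular (v \<beta> \<alpha>)"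
    and uv: "\<forall>\<^sub>F \<beta> in p. \<forall>\<^sub>F \<alpha> in p. \<forall>x. u (\<beta> \<union> \<alpha>) x = u \<beta> x * u \<alpha> x * v \<beta> \<alpha> x"
    and S: "\<And>\<beta>. S \<beta> \<in> sets M" "\<And>\<beta>. weak_lim (v \<beta>) (indicator (S \<beta>))"
    and chain: "\<And>b :: nat \<Rightarrow> 'a set. \<exists>n. measure M ((\<Inter>i<n. S (b i)) \<inter> space M - S (b n)) = 0"
  obtains T where "T \<in> sets M" "weak_lim u (indicator T)"
proof -
  note [measurable] = unimodularD(1)[OF u] unimodularD(1)[OF v] S(1)
  obtain B where B[measurable]: "B \<in> sets M" and BS: "((\<lambda>\<beta>. measure M (B - S \<beta>)) \<longlongrightarrow> 0) p"
    and SB: "((\<lambda>\<beta>. measure M (S \<beta> - B)) \<longlongrightarrow> 0) p"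
    by (rule chain_condition_limit_set[of S, OF S(1) chain]) (rule that)
  obtain Q where Q[measurable]: "Q \<in> borel_measurable M" and Q_le: "\<And>x. norm (Q x) \<le> 3" and lim: "weak_lim u Q"
    by (rule weak_lim_exists[of u]) (simp_all add: unimodularD[OF u])
  have int_bd: "integrable M f" if "f \<in> borel_measurable M" "\<And>x. norm (f x) \<le> K" for f :: "'x \<Rightarrow> complex" and K
    using that by (rule integrable_bounded)
  have n2: "norm (v \<beta> \<alpha> x - 1) \<le> 2" for \<beta> \<alpha> x
    using norm_triangle_ineq4[of "v \<beta> \<alpha> x" 1] by (simp add: unimodularD[OF v])
  have square: "(\<integral>x. h x * Q x \<partial>M) = (\<integral>x. h x * Q x * Q x \<partial>M)"
    if h[measurable]: "h \<in> borel_measurable M" and h_le: "\<And>x. norm (h x) \<le> K" and h0: "\<And>x. x \<notin> B \<Longrightarrow> h x = 0" for h K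
  proof -
    have K: "0 \<le> K" using h_le[of undefined] norm_ge_zero order_trans by blast
    have int_h: "integrable M h" using h h_le by (rule int_bd)
    have int_hQ: "integrable M (\<lambda>x. h x * Q x)" by (rule integrable_mult_bounded[OF int_h Q Q_le])
    have int_hu: "integrable M (\<lambda>x. h x * u \<beta> x)" for \<beta>
      by (rule integrable_mult_bounded[OF int_h, where K = 1]) (auto simp: unimodularD[OF u])
    have "dist (\<integral>x. h x * Q x \<partial>M) (\<integral>x. h x * Q x * Q x \<partial>M) \<le> 0 + e" if "0 < e" for e
    proof -
      \<comment> \<open>Three limit errors of size d and the cost 3 K d of dropping \<open>v\<close>
        add up to \<open>e\<close>.\<close>
      define d where "d = e / (3 + 3 * K)"
      have d: "0 < d" "3 * d + 3 * K * d = e" using \<open>0 < e\<close> K by (auto simp: d_def field_simps add_nonneg_eq_0_iff)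
      have "\<forall>\<^sub>F \<alpha> in p. dist (\<integral>x. h x * u \<alpha> x \<partial>M) (\<integral>x. h x * Q x \<partial>M) < d"
        using weak_limD[OF lim int_h] d(1) by (rule tendstoD)
      \<comment> \<open>Idempotence enters here: the limit along \<alpha> is also the iterated limit
        along \<beta> \<union> \<alpha>, in which \<alpha> and then \<beta> each contribute one
        factor \<open>Q\<close>.\<close>
      note 1 = idem[OF this]
      have 2: "\<forall>\<^sub>F \<beta> in p. dist (\<integral>x. h x * Q x * u \<beta> x \<partial>M) (\<integral>x. h x * Q x * Q x \<partial>M) < d"
        using weak_limD[OF lim int_hQ] d(1) by (rule tendstoD)
      have 3: "\<forall>\<^sub>F \<beta> in p. measure M (B - S \<beta>) < d" using BS d(1) by (rule order_tendstoD)
      from 1 2 3 uv have "\<forall>\<^sub>F \<beta> in p. (\<forall>\<^sub>F \<alpha> in p. dist (\<integral>x. h x * u (\<beta> \<union> \<alpha>) x \<partial>M) (\<integral>x. h x * Q x \<partial>M) < d) \<and>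
         dist (\<integral>x. h x * Q x * u \<beta> x \<partial>M) (\<integral>x. h x * Q x * Q x \<partial>M) < d \<and> measure M (B - S \<beta>) < d \<and>
         (\<forall>\<^sub>F \<alpha> in p. \<forall>x. u (\<beta> \<union> \<alpha>) x = u \<beta> x * u \<alpha> x * v \<beta> \<alpha> x)"
        by eventually_elim simp
      then obtain \<beta> where \<beta>: "\<forall>\<^sub>F \<alpha> in p. dist (\<integral>x. h x * u (\<beta> \<union> \<alpha>) x \<partial>M) (\<integral>x. h x * Q x \<partial>M) < d"
        "dist (\<integral>x. h x * Q x * u \<beta> x \<partial>M) (\<integral>x. h x * Q x * Q x \<partial>M) < d" "measure M (B - S \<beta>) < d"
        "\<forall>\<^sub>F \<alpha> in p. \<forall>x. u (\<beta> \<union> \<alpha>) x = u \<beta> x * u \<alpha> x * v \<beta> \<alpha> x"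
        using eventually_happens'[OF nonbot] by blast
      have 4: "\<forall>\<^sub>F \<alpha> in p. dist (\<integral>x. h x * u \<beta> x * u \<alpha> x \<partial>M) (\<integral>x. h x * u \<beta> x * Q x \<partial>M) < d"
        using weak_limD[OF lim int_hu] d(1) by (rule tendstoD)
      have 5: "\<forall>\<^sub>F \<alpha> in p. (\<integral>x. indicator (S \<beta>) x * norm (v \<beta> \<alpha> x - 1) \<partial>M) < d"
        using weak_lim_indicator_norm[OF v S] d(1) by (rule order_tendstoD)
      from \<beta>(1,4) 4 5 have "\<forall>\<^sub>F \<alpha> in p. dist (\<integral>x. h x * u (\<beta> \<union> \<alpha>) x \<partial>M) (\<integral>x. h x * Q x \<partial>M) < d \<and>
        (\<forall>x. u (\<beta> \<union> \<alpha>) x = u \<beta> x * u \<alpha> x * v \<beta> \<alpha> x) \<and>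
        dist (\<integral>x. h x * u \<beta> x * u \<alpha> x \<partial>M) (\<integral>x. h x * u \<beta> x * Q x \<partial>M) < d \<and>
        (\<integral>x. indicator (S \<beta>) x * norm (v \<beta> \<alpha> x - 1) \<partial>M) < d"
        by eventually_elim simp
      then obtain \<alpha> where \<alpha>: "dist (\<integral>x. h x * u (\<beta> \<union> \<alpha>) x \<partial>M) (\<integral>x. h x * Q x \<partial>M) < d"
        "\<And>x. u (\<beta> \<union> \<alpha>) x = u \<beta> x * u \<alpha> x * v \<beta> \<alpha> x"
        "dist (\<integral>x. h x * u \<beta> x * u \<alpha> x \<partial>M) (\<integral>x. h x * u \<beta> x * Q x \<partial>M) < d"
        "(\<integral>x. indicator (S \<beta>) x * norm (v \<beta> \<alpha> x - 1) \<partial>M) < d"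
        using eventually_happens'[OF nonbot] by blast
      \<comment> \<open>Replacing \<open>v\<close> by 1 costs K d on \<open>S \<beta>\<close>.
        Elsewhere only \<open>B - S \<beta>\<close> counts, since \<open>h\<close> vanishes off
        \<open>B\<close>; it costs 2 K d because |v - 1| \<le> 2.\<close>
      have "dist (\<integral>x. h x * u (\<beta> \<union> \<alpha>) x \<partial>M) (\<integral>x. h x * u \<beta> x * u \<alpha> x \<partial>M) \<le> 3 * K * d"
      proof -
        have i1: "integrable M (\<lambda>x. h x * u (\<beta> \<union> \<alpha>) x)" by (rule int_hu)
        have i2: "integrable M (\<lambda>x. h x * u \<beta> x * u \<alpha> x)"
          by (rule integrable_mult_bounded[OF int_hu, where K = 1]) (auto simp: unimodularD[OF u])
        have i3: "integrable M (\<lambda>x. indicator (S \<beta>) x * norm (v \<beta> \<alpha> x - 1))"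
          using n2 by (intro integrable_bounded[where K = 2]) (auto simp: indicator_def)
        have i4: "integrable M (indicat_real (B - S \<beta>))"
          by (intro integrable_bounded[where K = 1]) (auto simp: indicator_def)
        have "dist (\<integral>x. h x * u (\<beta> \<union> \<alpha>) x \<partial>M) (\<integral>x. h x * u \<beta> x * u \<alpha> x \<partial>M)
            = norm (\<integral>x. h x * u (\<beta> \<union> \<alpha>) x - h x * u \<beta> x * u \<alpha> x \<partial>M)"
          by (simp only: dist_norm Bochner_Integration.integral_diff[OF i1 i2])
        also have "\<dots> \<le> (\<integral>x. K * (indicator (S \<beta>) x * norm (v \<beta> \<alpha> x - 1)) + K * (2 * indicator (B - S \<beta>) x) \<partial>M)"
        proof (rule norm_integral_le)
          show "integrable M (\<lambda>x. K * (indicator (S \<beta>) x * norm (v \<beta> \<alpha> x - 1)) + K * (2 * indicator (B - S \<beta>) x))"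
            using i3 i4 by (intro Bochner_Integration.integrable_add integrable_mult_right) auto
          fix x
          have "norm (h x * u (\<beta> \<union> \<alpha>) x - h x * u \<beta> x * u \<alpha> x) = norm (h x * (u \<beta> x * u \<alpha> x * (v \<beta> \<alpha> x - 1)))"
            by (simp add: \<alpha>(2) algebra_simps)
          also have "\<dots> = norm (h x) * norm (v \<beta> \<alpha> x - 1)" by (simp add: norm_mult unimodularD[OF u])
          also have "\<dots> \<le> K * (indicator (S \<beta>) x * norm (v \<beta> \<alpha> x - 1)) + K * (2 * indicator (B - S \<beta>) x)"
          proof (cases "x \<in> S \<beta>")
            case True
            then show ?thesis using h_le[of x] by (simp add: mult_right_mono)
          next
            case False
            show ?thesis
            proof (cases "x \<in> B")
              case True
              have "norm (h x) * norm (v \<beta> \<alpha> x - 1) \<le> K * 2"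
                using K by (intro mult_mono h_le n2) auto
              with True False show ?thesis by simp
            next
              case False
              with \<open>x \<notin> S \<beta>\<close> show ?thesis by (simp add: h0)
            qed
          qed
          finally show "norm (h x * u (\<beta> \<union> \<alpha>) x - h x * u \<beta> x * u \<alpha> x) \<le>
            K * (indicator (S \<beta>) x * norm (v \<beta> \<alpha> x - 1)) + K * (2 * indicator (B - S \<beta>) x)" .
        qed
        also have "\<dots> = K * (\<integral>x. indicator (S \<beta>) x * norm (v \<beta> \<alpha> x - 1) \<partial>M) + K * (2 * measure M (B - S \<beta>))"
        proof -
          have "(\<integral>x. K * (2 * indicator (B - S \<beta>) x) \<partial>M) = K * (2 * measure M (B - S \<beta>))" using B S(1) by simp
          then show ?thesis
            using i3 i4 by (subst Bochner_Integration.integral_add) auto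
        qed
        also have "\<dots> \<le> K * d + K * (2 * d)"
          using \<alpha>(4) \<beta>(3) K by (intro add_mono mult_left_mono) auto
        finally show ?thesis by simp
      qed
      moreover have "(\<integral>x. h x * u \<beta> x * Q x \<partial>M) = (\<integral>x. h x * Q x * u \<beta> x \<partial>M)" by (simp add: mult_ac)
      note \<alpha>(3)[unfolded this]
      moreover have tri: "dist a b' \<le> dist b a + dist b c + dist c c' + dist c' b'" for a b c c' b' :: complex
        by metric
      note tri[of "\<integral>x. h x * Q x \<partial>M" "\<integral>x. h x * Q x * Q x \<partial>M" "\<integral>x. h x * u (\<beta> \<union> \<alpha>) x \<partial>M"
          "\<integral>x. h x * u \<beta> x * u \<alpha> x \<partial>M" "\<integral>x. h x * Q x * u \<beta> x \<partial>M"]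
      ultimately show ?thesis using \<alpha>(1) \<beta>(2) d(2) by linarith
    qed
    then have "dist (\<integral>x. h x * Q x \<partial>M) (\<integral>x. h x * Q x * Q x \<partial>M) \<le> 0" by (rule field_le_epsilon)
    then show ?thesis by simp
  qed
  have on_B: "AE x in M. x \<in> B \<longrightarrow> Q x = 0 \<or> Q x = 1"
  proof -
    \<comment> \<open>Testing against the conjugate of the defect Q - Q^2 turns the identity into
      the vanishing of the squared L^2 norm of the defect on \<open>B\<close>. The bound 12 is 3 + 3
      * 3.\<close>
    let ?h = "\<lambda>x. indicator B x * cnj (Q x - Q x * Q x)"
    have D_le: "norm (Q x - Q x * Q x) \<le> 12" for x
    proof -
      have "norm (Q x) * norm (Q x) \<le> 3 * 3" using Q_le by (intro mult_mono) auto
      then show ?thesis using norm_triangle_ineq4[of "Q x" "Q x * Q x"] Q_le[of x] by (simp add: norm_mult)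
    qed
    have h_le: "norm (?h x) \<le> 12" for x
      using D_le[of x] by (auto simp: indicator_def simp del: complex_cnj_diff)
    have h_meas: "?h \<in> borel_measurable M" by measurable
    have i1: "integrable M ?h" by (rule int_bd[OF h_meas h_le])
    note i2 = integrable_mult_bounded[OF i1 Q Q_le]
    note i3 = integrable_mult_bounded[OF i2 Q Q_le]
    have "(\<integral>x. ?h x * Q x \<partial>M) = (\<integral>x. ?h x * Q x * Q x \<partial>M)"
      by (rule square[OF h_meas h_le]) simp
    then have "(\<integral>x. ?h x * Q x - ?h x * Q x * Q x \<partial>M) = 0"
      using i2 i3 by simp
    moreover have "?h x * Q x - ?h x * Q x * Q x = of_real (indicator B x * (norm (Q x - Q x * Q x))\<^sup>2)" for x
    proof -
      have "?h x * Q x - ?h x * Q x * Q x = indicator B x * ((Q x - Q x * Q x) * cnj (Q x - Q x * Q x))"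
        by (simp add: algebra_simps)
      also have "\<dots> = of_real (indicator B x * (norm (Q x - Q x * Q x))\<^sup>2)"
        by (auto simp: indicator_def complex_norm_square simp del: complex_cnj_diff of_real_power)
      finally show ?thesis .
    qed
    ultimately have "(\<integral>x. indicator B x * (norm (Q x - Q x * Q x))\<^sup>2 \<partial>M) = 0"
      by (simp only: integral_complex_of_real) simp
    moreover have "integrable M (\<lambda>x. indicator B x * (norm (Q x - Q x * Q x))\<^sup>2)"
      using power_mono[OF D_le norm_ge_zero, where n = 2]
      by (intro integrable_bounded[where K = "12\<^sup>2"]) (auto simp: indicator_def)
    ultimately have "AE x in M. indicator B x * (norm (Q x - Q x * Q x))\<^sup>2 = 0"
      by (subst (asm) integral_nonneg_eq_0_iff_AE) auto
    then show ?thesis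
    proof eventually_elim
      case (elim x)
      show ?case
      proof
        assume "x \<in> B"
        with elim have "Q x * (1 - Q x) = 0" by (simp add: right_diff_distrib)
        then show "Q x = 0 \<or> Q x = 1" by auto
      qed
    qed
  qed
  define C where "C = space M - B"
  have C[measurable]: "C \<in> sets M" by (simp add: C_def)
  define \<kappa> where "\<kappa> = (\<integral>x. indicator C x * (norm (Q x))\<^sup>2 \<partial>M)"
  have Q2: "(norm (Q x))\<^sup>2 \<le> 9" for x using power_mono[OF Q_le norm_ge_zero, of x 2] by simp
  have int_Q2: "integrable M (\<lambda>x. indicator C x * (norm (Q x))\<^sup>2)"
    using Q2 by (intro integrable_bounded[where K = 9]) (auto simp: indicator_def)
  have "\<kappa> = 0"
  proof -
    let ?h = "\<lambda>x. indicator C x * cnj (Q x)"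
    have h_le: "norm (?h x) \<le> 3" for x using Q_le[of x] by (auto simp: indicator_def)
    have int_h: "integrable M ?h" by (rule int_bd[OF _ h_le]) measurable
    have hQ: "(\<integral>x. ?h x * Q x \<partial>M) = of_real \<kappa>"
      unfolding \<kappa>_def integral_complex_of_real[symmetric]
      by (intro Bochner_Integration.integral_cong) (auto simp: indicator_def complex_norm_square mult.commute simp del: of_real_power)
    \<comment> \<open>Van der Corput's estimate: in 0 \<le> \<integral>_C |s - n Q|^2, with s a sum
      of n almost orthogonal characters, the first square is at most n + e n^2 and the cross term at
      least 2 n^2 (\<kappa> - e). Dividing by n^2 gives the bound.\<close>
    have small: "\<kappa> \<le> 1 / real n + 3 * e" if "0 < e" "0 < n" for e n
    proof -
      have R: "\<forall>\<^sub>F \<alpha> in p. dist (\<integral>x. ?h x * u \<alpha> x \<partial>M) (of_real \<kappa>) < e"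
        using weak_limD[OF lim int_h, unfolded hQ] \<open>0 < e\<close> by (rule tendstoD)
      have "\<forall>\<^sub>F \<beta> in p. \<forall>\<^sub>F \<alpha> in p. norm (\<integral>x. indicator C x * (u (\<beta> \<union> \<alpha>) x * cnj (u \<alpha> x)) \<partial>M) \<le> e"
        using order_tendstoD(2)[OF SB \<open>0 < e\<close>] uv
      proof eventually_elim
        case (elim \<beta>)
        have int_Cu: "integrable M (\<lambda>x. indicator C x * u \<beta> x)"
          by (rule integrable_bounded[where K = 1], measurable) (auto simp: indicator_def unimodularD[OF u])
        \<comment> \<open>As \<open>u \<alpha>\<close> has modulus 1, the correlation of
          \<open>u (\<beta> \<union> \<alpha>)\<close> with \<open>u \<alpha>\<close> over
          \<open>C\<close> is the integral of \<open>u \<beta> * v \<beta> \<alpha>\<close>. It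
          tends to an integral over \<open>S \<beta> \<inter> C\<close>, which is the small set
          \<open>S \<beta> - B\<close>.\<close>
        have "norm (\<integral>x. indicator C x * u \<beta> x * indicator (S \<beta>) x \<partial>M) \<le> (\<integral>x. indicator (S \<beta> \<inter> C) x \<partial>M)"
          by (rule norm_integral_le, rule integrable_bounded[where K = 1], measurable)
            (auto simp: indicator_def norm_mult unimodularD[OF u])
        also have "\<dots> = measure M (S \<beta> - B)"
        proof -
          have "S \<beta> \<inter> C = S \<beta> - B" using sets.sets_into_space[OF S(1)] by (auto simp: C_def)
          then show ?thesis using S(1) B by simp
        qed
        finally have "norm (\<integral>x. indicator C x * u \<beta> x * indicator (S \<beta>) x \<partial>M) < e" using elim(1) by simp
        with order_tendstoD(2)[OF tendsto_norm[OF weak_limD[OF S(2)[of \<beta>] int_Cu]]]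
        have "\<forall>\<^sub>F \<alpha> in p. norm (\<integral>x. indicator C x * u \<beta> x * v \<beta> \<alpha> x \<partial>M) < e" by blast
        with elim(2) show ?case
        proof eventually_elim
          case (elim \<alpha>)
          have "indicator C x * (u (\<beta> \<union> \<alpha>) x * cnj (u \<alpha> x)) = indicator C x * u \<beta> x * v \<beta> \<alpha> x" for x
          proof -
            have "u \<alpha> x * cnj (u \<alpha> x) = 1" using unimodularD(2)[OF u, of \<alpha> x] by (simp flip: complex_norm_square)
            moreover have "u (\<beta> \<union> \<alpha>) x * cnj (u \<alpha> x) = (u \<alpha> x * cnj (u \<alpha> x)) * (u \<beta> x * v \<beta> \<alpha> x)"
              using elim(1) by simp
            ultimately show ?thesis by simp
          qed
          then have "(\<integral>x. indicator C x * (u (\<beta> \<union> \<alpha>) x * cnj (u \<alpha> x)) \<partial>M) = (\<integral>x. indicator C x * u \<beta> x * v \<beta> \<alpha> x \<partial>M)"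
            by (simp only:)
          with elim(2) show ?case by simp
        qed
      qed
      \<comment> \<open>The n characters are pairwise almost orthogonal on \<open>C\<close>, while
        each pairs with the conjugate of \<open>Q\<close> to within \<open>e\<close> of
        \<kappa>.\<close>
      from idempotent_chain[OF R this, of n] obtain as where as: "length as = n"
        "\<And>a. a \<in> set as \<Longrightarrow> dist (\<integral>x. ?h x * u a x \<partial>M) (of_real \<kappa>) < e"
        "sorted_wrt (\<lambda>a b. norm (\<integral>x. indicator C x * (u a x * cnj (u b x)) \<partial>M) \<le> e) as"
        by blast
      let ?s = "\<lambda>x. \<Sum>a\<leftarrow>as. u a x"
      note s_meas[measurable] = sum_list_unimodular(1)[OF u] and s_bound = sum_list_unimodular(2)[OF u]
      have int_hs: "integrable M (\<lambda>x. ?h x * (\<Sum>b\<leftarrow>bs. u b x))" for bs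
        by (rule integrable_mult_bounded[OF int_h s_meas s_bound])
      have hs: "length bs * (\<kappa> - e) \<le> Re (\<integral>x. ?h x * (\<Sum>b\<leftarrow>bs. u b x) \<partial>M)"
        if "\<And>b. b \<in> set bs \<Longrightarrow> dist (\<integral>x. ?h x * u b x \<partial>M) (of_real \<kappa>) < e" for bs
        using that
      proof (induction bs)
        case (Cons b bs)
        have "integrable M (\<lambda>x. ?h x * u b x)"
          by (rule integrable_mult_bounded[OF int_h, where K = 1]) (auto simp: unimodularD[OF u])
        then have "(\<integral>x. ?h x * (\<Sum>b\<leftarrow>b # bs. u b x) \<partial>M) = (\<integral>x. ?h x * u b x \<partial>M) + (\<integral>x. ?h x * (\<Sum>b\<leftarrow>bs. u b x) \<partial>M)"
          using int_hs[of bs] by (subst Bochner_Integration.integral_add[symmetric]) (auto simp: distrib_left)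
        moreover have "\<kappa> - e \<le> Re (\<integral>x. ?h x * u b x \<partial>M)"
          using abs_Re_le_cmod[of "(\<integral>x. ?h x * u b x \<partial>M) - of_real \<kappa>"] Cons.prems[of b] by (simp add: dist_norm)
        moreover have "length bs * (\<kappa> - e) \<le> Re (\<integral>x. ?h x * (\<Sum>b\<leftarrow>bs. u b x) \<partial>M)" using Cons by simp
        ultimately show ?case by (simp add: algebra_simps)
      qed simp
      have ss: "(\<integral>x. indicator C x * (norm (?s x))\<^sup>2 \<partial>M) \<le> n + e * n\<^sup>2"
        using integral_norm_list_square_le[OF u C as(3)] \<open>0 < e\<close> as(1) by simp
      have int_ss: "integrable M (\<lambda>x. indicator C x * (norm (?s x))\<^sup>2)"
      proof (rule integrable_bounded[where K = "(length as)\<^sup>2"])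
        have "(norm (?s x))\<^sup>2 \<le> (real (length as))\<^sup>2" for x
          by (intro power_mono s_bound norm_ge_zero)
        then show "norm (indicator C x * (norm (?s x))\<^sup>2) \<le> (length as)\<^sup>2" for x
          by (auto simp: indicator_def)
      qed measurable
      have "0 \<le> (\<integral>x. indicator C x * (norm (?s x - n * Q x))\<^sup>2 \<partial>M)"
        by (intro Bochner_Integration.integral_nonneg) auto
      also have "\<dots> = (\<integral>x. indicator C x * (norm (?s x))\<^sup>2 - 2 * n * Re (?h x * ?s x) + n\<^sup>2 * (indicator C x * (norm (Q x))\<^sup>2) \<partial>M)"
      proof (intro Bochner_Integration.integral_cong refl)
        fix x
        have "(norm (?s x - n * Q x))\<^sup>2 = (norm (?s x))\<^sup>2 - 2 * n * Re (cnj (Q x) * ?s x) + n\<^sup>2 * (norm (Q x))\<^sup>2"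
          unfolding cmod_power2 by (simp add: power2_eq_square algebra_simps)
        then show "indicator C x * (norm (?s x - n * Q x))\<^sup>2 = indicator C x * (norm (?s x))\<^sup>2 - 2 * n * Re (?h x * ?s x) + n\<^sup>2 * (indicator C x * (norm (Q x))\<^sup>2)"
          by (auto simp: indicator_def)
      qed
      also have "\<dots> = (\<integral>x. indicator C x * (norm (?s x))\<^sup>2 \<partial>M) - 2 * n * Re (\<integral>x. ?h x * ?s x \<partial>M) + n\<^sup>2 * \<kappa>"
      proof -
        have "(\<integral>x. Re (?h x * ?s x) \<partial>M) = Re (\<integral>x. ?h x * ?s x \<partial>M)" "integrable M (\<lambda>x. Re (?h x * ?s x))"
          using int_hs[of as] by (rule integral_Re, rule integrable_Re)
        then show ?thesis
          using int_ss int_Q2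
          by (simp only: \<kappa>_def Bochner_Integration.integral_add Bochner_Integration.integral_diff Bochner_Integration.integrable_diff integrable_mult_right integral_mult_right_zero)
      qed
      also have "\<dots> \<le> (n + e * n\<^sup>2) - 2 * n * (n * (\<kappa> - e)) + n\<^sup>2 * \<kappa>"
        using ss hs[of as] as(1,2) by (intro add_mono diff_mono mult_left_mono) auto
      finally have "n\<^sup>2 * \<kappa> \<le> n\<^sup>2 * (1 / n + 3 * e)"
        using \<open>0 < n\<close> by (simp add: power2_eq_square algebra_simps)
      then show ?thesis using \<open>0 < n\<close> by simp
    qed
    have "\<kappa> \<le> 0 + e" if "0 < e" for e
    proof -
      obtain n where n: "0 < n" "1 / real n < e / 4"
      proof -
        obtain n where "inverse (real (Suc n)) < e / 4"
          using reals_Archimedean[of "e / 4"] \<open>0 < e\<close> by auto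
        then show thesis using that[of "Suc n"] by (simp only: inverse_eq_divide zero_less_Suc)
      qed
      with small[of "e / 4" n] \<open>0 < e\<close> show ?thesis by simp
    qed
    then have "\<kappa> \<le> 0" by (rule field_le_epsilon)
    moreover have "0 \<le> \<kappa>" unfolding \<kappa>_def by (intro Bochner_Integration.integral_nonneg) auto
    ultimately show ?thesis by simp
  qed
  then have "AE x in M. indicator C x * (norm (Q x))\<^sup>2 = 0"
    using int_Q2 unfolding \<kappa>_def by (subst (asm) integral_nonneg_eq_0_iff_AE) auto
  then have on_C: "AE x in M. x \<in> C \<longrightarrow> Q x = 0"
    by eventually_elim auto
  define T where "T = {x\<in>space M. x \<in> B \<and> Q x = 1}"
  have T[measurable]: "T \<in> sets M" unfolding T_def by measurable
  have "AE x in M. Q x = indicator T x"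
    using on_B on_C AE_space by eventually_elim (auto simp: T_def C_def indicator_def)
  then have "(\<integral>x. h x * Q x \<partial>M) = (\<integral>x. h x * indicator T x \<partial>M)" if "integrable M h" for h
    using that by (intro integral_cong_AE) (auto elim!: AE_mp)
  with lim have "weak_lim u (indicator T)" by (simp add: weak_lim_def)
  with T show thesis by (rule that)
qed

section \<open>Characters of triangular systems of set functions\<close>

lemma weak_lim_one: "weak_lim (\<lambda>_ _. 1) (indicator (space M))"
proof -
  have "(\<integral>x. h x * 1 \<partial>M) = (\<integral>x. h x * indicator (space M) x \<partial>M)" for h :: "'x \<Rightarrow> complex"
    by (intro Bochner_Integration.integral_cong) auto
  then show ?thesis by (simp add: weak_lim_def)
qed

lemma weak_lim_indicator_unique:
  assumes f: "\<And>\<alpha>. unimodular (f \<alpha>)"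
    and A: "A \<in> sets M" "weak_lim f (indicator A)" and B: "B \<in> sets M" "weak_lim f (indicator B)"
  shows "measure M (A - B) = 0"
proof -
  have "unimodular (\<lambda>_. 1)" by (simp add: unimodular_def)
  then have "measure M (A \<inter> space M - B) = 0"
    using weak_lim_indicator_prod[of f "\<lambda>_ _. 1" f A "space M" B] f A B weak_lim_one by simp
  moreover have "A \<inter> space M = A" using sets.sets_into_space[OF A(1)] by blast
  ultimately show ?thesis by simp
qed

text \<open>Polynomials enter only through this shape: the increment of \<open>w j\<close> by
  \<beta> is a constant plus a combination of functions of lower degree, with coefficients depending
  on \<beta>. Integer combinations are indexed by vectors in \<int>^J, and the induction is on a
  strict bound \<open>t\<close> for the degrees where the vector is nonzero; for t = 0 the character
  is constantly 1.\<close>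

lemma weak_lim_triangular:
  fixes w :: "'j \<Rightarrow> 'a set \<Rightarrow> int" and deg :: "'j \<Rightarrow> nat" and X :: "'x \<Rightarrow> real"
  assumes X[measurable]: "X \<in> borel_measurable M" and J: "finite J"
    and w: "\<forall>\<^sub>F \<beta> in p. \<forall>j\<in>J. \<exists>c. \<forall>\<^sub>F \<alpha> in p.
      w j (\<beta> \<union> \<alpha>) = w j \<beta> + w j \<alpha> + (\<Sum>l\<in>{l\<in>J. deg l < deg j}. c l * w l \<alpha>)"
  shows "\<exists>T\<in>sets M. weak_lim (\<lambda>\<alpha> x. cis (X x * of_int (\<Sum>j\<in>J. a j * w j \<alpha>))) (indicator T)"
proof -
  define \<phi> where "\<phi> a \<alpha> = (\<Sum>j\<in>J. a j * w j \<alpha>)" for a \<alpha>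
  define u where "u a \<alpha> = (\<lambda>x. cis (X x * of_int (\<phi> a \<alpha>)))" for a \<alpha>
  have u: "unimodular (u a \<alpha>)" for a \<alpha>
    unfolding unimodular_def u_def by simp
  have u_zero: "u (\<lambda>_. 0) = (\<lambda>_ _. 1)" by (simp add: u_def \<phi>_def fun_eq_iff)
  have u_minus: "u (\<lambda>j. a j - b j) \<alpha> x = u a \<alpha> x * cnj (u b \<alpha> x)" for a b \<alpha> x
    by (simp add: u_def \<phi>_def cis_cnj cis_mult left_diff_distrib right_diff_distrib sum_subtractf)
  have u_cong: "u a = u b" if "\<forall>j\<in>J. a j = b j" for a b
    using that by (simp add: u_def \<phi>_def fun_eq_iff)
  obtain G c where G: "eventually G p" and
    c: "\<And>\<beta> j. G \<beta> \<Longrightarrow> j \<in> J \<Longrightarrow> \<forall>\<^sub>F \<alpha> in p.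
      w j (\<beta> \<union> \<alpha>) = w j \<beta> + w j \<alpha> + (\<Sum>l\<in>{l\<in>J. deg l < deg j}. c \<beta> j l * w l \<alpha>)"
  proof -
    define P where "P \<beta> j c \<longleftrightarrow> (\<forall>\<^sub>F \<alpha> in p.
      w j (\<beta> \<union> \<alpha>) = w j \<beta> + w j \<alpha> + (\<Sum>l\<in>{l\<in>J. deg l < deg j}. c l * w l \<alpha>))" for \<beta> j c
    define c where "c \<beta> j = (SOME c. P \<beta> j c)" for \<beta> j
    have "P \<beta> j (c \<beta> j)" if "\<forall>j\<in>J. \<exists>c. P \<beta> j c" "j \<in> J" for \<beta> j
    proof -
      have "\<exists>c. P \<beta> j c" using that by simp
      then show ?thesis unfolding c_def by (rule someI_ex)
    qed
    moreover have "\<forall>\<^sub>F \<beta> in p. \<forall>j\<in>J. \<exists>c. P \<beta> j c" using w unfolding P_def .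
    ultimately show thesis using that[of "\<lambda>\<beta>. \<forall>j\<in>J. \<exists>c. P \<beta> j c" c] unfolding P_def by simp
  qed
  have "\<exists>T\<in>sets M. weak_lim (u a) (indicator T)" if "\<forall>j\<in>J. t \<le> deg j \<longrightarrow> a j = 0" for t a
    using that
  proof (induction t arbitrary: a)
    case 0
    then have "u a = (\<lambda>_ _. 1)" using u_cong[of a "\<lambda>_. 0"] u_zero by simp
    then show ?case using weak_lim_one by auto
  next
    case (Suc t)
    \<comment> \<open>Coefficient vector of the lower-degree remainder for \<beta>. The value 0 for
      exceptional \<beta> keeps \<open>d \<beta>\<close> supported below \<open>t\<close>, so that
      every \<beta> has a limit set \<open>S \<beta>\<close>.\<close>
    define d where "d \<beta> = (\<lambda>l. if G \<beta> then \<Sum>j\<in>{j\<in>J. deg l < deg j}. a j * c \<beta> j l else 0)" for \<beta>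
    have d_supp: "\<forall>j\<in>J. t \<le> deg j \<longrightarrow> d \<beta> j = 0" for \<beta>
      using Suc.prems by (auto simp: d_def intro!: sum.neutral)
    have "\<forall>\<^sub>F \<beta> in p. \<forall>\<^sub>F \<alpha> in p. \<forall>x. u a (\<beta> \<union> \<alpha>) x = u a \<beta> x * u a \<alpha> x * u (d \<beta>) \<alpha> x"
      using G
    proof eventually_elim
      case (elim \<beta>)
      have "\<forall>\<^sub>F \<alpha> in p. \<forall>j\<in>J. w j (\<beta> \<union> \<alpha>) = w j \<beta> + w j \<alpha> + (\<Sum>l\<in>{l\<in>J. deg l < deg j}. c \<beta> j l * w l \<alpha>)"
        using c[OF elim] J by (intro eventually_ball_finite) auto
      then show ?case
      proof eventually_elim
        case (elim \<alpha>)
        have "(\<Sum>j\<in>J. \<Sum>l\<in>{l\<in>J. deg l < deg j}. a j * (c \<beta> j l * w l \<alpha>))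
            = (\<Sum>l\<in>J. \<Sum>j\<in>{j\<in>J. deg l < deg j}. a j * (c \<beta> j l * w l \<alpha>))"
          using J by (rule sum.swap_restrict[OF J])
        also have "\<dots> = \<phi> (d \<beta>) \<alpha>"
          using \<open>G \<beta>\<close> by (simp add: \<phi>_def d_def sum_distrib_right mult.assoc)
        finally have "\<phi> a (\<beta> \<union> \<alpha>) = \<phi> a \<beta> + \<phi> a \<alpha> + \<phi> (d \<beta>) \<alpha>"
          using elim by (simp add: \<phi>_def distrib_left sum.distrib sum_distrib_left)
        then show ?case by (simp add: u_def cis_mult distrib_left)
      qed
    qed
    note step = this
    obtain S where S: "\<And>\<beta>. S \<beta> \<in> sets M" "\<And>\<beta>. weak_lim (u (d \<beta>)) (indicator (S \<beta>))"
      using Suc.IH[OF d_supp] by metis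
    have "\<exists>n. measure M ((\<Inter>i<n. S (b i)) \<inter> space M - S (b n)) = 0" for b :: "nat \<Rightarrow> 'a set"
    proof -
      obtain n where n: "\<forall>H. add_subgroup H \<longrightarrow> (\<forall>i<n. d (b i) \<in> H) \<longrightarrow> (\<exists>e\<in>H. \<forall>j\<in>J. d (b n) j = e j)"
        using sequence_in_generated_subgroup[OF J, of "\<lambda>i. d (b i)"] ..
      define I where "I = (\<Inter>i<n. S (b i)) \<inter> space M"
      have I: "I \<in> sets M"
        unfolding I_def by (cases "n = 0") (auto intro!: sets.Int sets.finite_INT S)
      \<comment> \<open>Vectors of lower degree whose character tends to 1 almost everywhere on
        \<open>I\<close>. The product rule for limit sets makes them a group; it contains the first
        \<open>n\<close> remainders, hence also the next one up to agreement on \<open>J\<close>.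
        This is how the chain condition on subgroups becomes one on sets.\<close>
      define H where "H = {e. (\<forall>j\<in>J. t \<le> deg j \<longrightarrow> e j = 0) \<and>
        (\<exists>T\<in>sets M. weak_lim (u e) (indicator T) \<and> measure M (I - T) = 0)}"
      have "add_subgroup H"
      proof (rule add_subgroupI)
        have "I - space M = {}" using sets.sets_into_space[OF I] by blast
        then have "measure M (I - space M) = 0" by (simp only: measure_empty)
        then show "(\<lambda>_. 0) \<in> H" using weak_lim_one unfolding H_def
          by (intro CollectI conjI bexI[of _ "space M"]) (simp_all add: u_zero)
        fix e f assume "e \<in> H" "f \<in> H"
        then obtain T U where ef: "\<forall>j\<in>J. t \<le> deg j \<longrightarrow> e j = 0" "\<forall>j\<in>J. t \<le> deg j \<longrightarrow> f j = 0"
          and T: "T \<in> sets M" "weak_lim (u e) (indicator T)" "measure M (I - T) = 0"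
          and U: "U \<in> sets M" "weak_lim (u f) (indicator U)" "measure M (I - U) = 0"
          unfolding H_def by blast
        have supp: "\<forall>j\<in>J. t \<le> deg j \<longrightarrow> e j - f j = 0" using ef by simp
        then obtain V where V: "V \<in> sets M" "weak_lim (u (\<lambda>j. e j - f j)) (indicator V)"
          using Suc.IH[of "\<lambda>j. e j - f j"] by blast
        have "measure M (T \<inter> U - V) = 0"
          by (rule weak_lim_indicator_prod[of "u e" "u f" "u (\<lambda>j. e j - f j)"]) (use u u_minus T U V in auto)
        have "measure M (I - V) \<le> measure M ((I - T) \<union> (I - U) \<union> (T \<inter> U - V))"
          using I T U V by (intro finite_measure_mono) auto
        also have "\<dots> \<le> measure M (I - T) + measure M (I - U) + measure M (T \<inter> U - V)"
          using I T U V by (intro order_trans[OF measure_Un_le] add_mono order_refl measure_Un_le) auto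
        finally have "measure M (I - V) = 0"
          using T U \<open>measure M (T \<inter> U - V) = 0\<close> measure_nonneg[of M "I - V"] by simp
        with supp V show "(\<lambda>j. e j - f j) \<in> H" unfolding H_def by blast
      qed
      moreover have "d (b i) \<in> H" if "i < n" for i
      proof -
        have "I - S (b i) = {}" using that by (auto simp: I_def)
        then have "measure M (I - S (b i)) = 0" by (simp only: measure_empty)
        then show ?thesis using d_supp S unfolding H_def by blast
      qed
      ultimately have "\<exists>e\<in>H. \<forall>j\<in>J. d (b n) j = e j" using n by simp
      then obtain e where e: "e \<in> H" "\<forall>j\<in>J. d (b n) j = e j" by blast
      from e(1) obtain T where T: "T \<in> sets M" "weak_lim (u e) (indicator T)" "measure M (I - T) = 0"
        unfolding H_def by blast
      have "weak_lim (u (d (b n))) (indicator T)" using T(2) u_cong[OF e(2)] by simp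
      then have "measure M (T - S (b n)) = 0"
        by (rule weak_lim_indicator_unique[OF u T(1) _ S])
      have "measure M (I - S (b n)) \<le> measure M ((I - T) \<union> (T - S (b n)))"
        using I T S by (intro finite_measure_mono) auto
      also have "\<dots> \<le> measure M (I - T) + measure M (T - S (b n))"
        using I T S by (intro measure_Un_le) auto
      finally have "measure M (I - S (b n)) = 0"
        using T(3) \<open>measure M (T - S (b n)) = 0\<close> measure_nonneg[of M "I - S (b n)"] by simp
      then show ?thesis unfolding I_def by blast
    qed
    then obtain T where "T \<in> sets M" "weak_lim (u a) (indicator T)"
      by (rule weak_lim_step[where u = "u a" and v = "\<lambda>\<beta>. u (d \<beta>)" and S = S, OF u u step S])
    then show ?case by blast
  qed
  note main = this
  obtain t where "\<forall>j\<in>J. deg j < t" using finite_nat_set_iff_bounded[of "deg ` J"] J by auto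
  then have "\<exists>T\<in>sets M. weak_lim (u a) (indicator T)" by (intro main[of t]) auto
  then show ?thesis unfolding u_def \<phi>_def .
qed

text \<open>Source of positivity: the limit of the integrals is a measure, hence a nonnegative real
  number.\<close>

lemma weak_lim_indicator_integral:
  assumes "weak_lim f (indicator T)" "T \<in> sets M"
  shows "((\<lambda>\<alpha>. \<integral>x. f \<alpha> x \<partial>M) \<longlongrightarrow> of_real (measure M T)) p"
  using weak_limD[OF assms(1), of "\<lambda>_. 1"] assms(2) by (simp add: integral_complex_indicator)

end

section \<open>Spectral measures of dense sets\<close>

lemma has_bochner_integral_cos_unit:
  fixes m :: int
  shows "has_bochner_integral lborel (\<lambda>x. cos (2 * pi * of_int m * x) * indicator {0..1} x) (of_bool (m = 0))"
proof (cases "m = 0")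
  case True
  have "has_bochner_integral lborel (\<lambda>x. 1 * indicat_real {0..1::real} x) (1 - 0)"
    by (rule has_bochner_integral_FTC_Icc_real[where F = "\<lambda>x. x"]) auto
  with True show ?thesis by simp
next
  case False
  have "has_bochner_integral lborel (\<lambda>x. cos (2 * pi * of_int m * x) * indicator {0..1} x)
    (sin (2 * pi * of_int m * 1) / (2 * pi * of_int m) - sin (2 * pi * of_int m * 0) / (2 * pi * of_int m))"
    using False by (intro has_bochner_integral_FTC_Icc_real) (auto intro!: derivative_eq_intros)
  moreover have "sin (2 * pi * of_int m) = 0" using sin_int_2pin[of m] by (simp add: mult_ac)
  ultimately show ?thesis using False by simp
qed

text \<open>The measure on \<open>[0, 1]\<close> whose density is the normalised squared modulus of the Fourier
  transform of \<open>f\<close>, topped up by a constant to total mass 1.\<close>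

lemma autocorrelation_distribution:
  fixes f :: "int \<Rightarrow> real" and I :: "int set"
  assumes I: "finite I" "I \<noteq> {}" and f: "\<And>y. \<bar>f y\<bar> \<le> 1"
  obtains \<mu> where "real_distribution \<mu>" "measure \<mu> {-1<..1} = 1"
    "\<And>t::int. t \<noteq> 0 \<Longrightarrow> (\<integral>x. cos (2 * pi * t * x) \<partial>\<mu>) = (\<Sum>y\<in>I. \<Sum>z\<in>I. f y * f z * of_bool (y - z = t)) / card I"
proof -
  define N where "N = real (card I)"
  have N: "0 < N" using I by (simp add: N_def card_gt_0_iff)
  define C where "C m x = cos (2 * pi * of_int m * x)" for m :: int and x :: real
  \<comment> \<open>The mean of the squares is the mass of the uncorrected density. Adding the
    constant 1 - v gives mass 1 and leaves all coefficients at nonzero frequencies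
    unchanged.\<close>
  define v where "v = (\<Sum>y\<in>I. (f y)\<^sup>2) / N"
  have v: "v \<le> 1"
  proof -
    have "(\<Sum>y\<in>I. (f y)\<^sup>2) \<le> (\<Sum>y\<in>I. 1)"
      using f by (intro sum_mono) (simp add: abs_square_le_1)
    then show ?thesis using N by (simp add: v_def N_def divide_le_eq_1)
  qed
  define D where "D x = (\<Sum>y\<in>I. \<Sum>z\<in>I. f y * f z * C (y - z) x) / N + (1 - v)" for x
  \<comment> \<open>The double sum is the squared modulus of the Fourier transform: the square of
    its cosine part plus that of its sine part.\<close>
  have D_nonneg: "0 \<le> D x" for x
  proof -
    have "(\<Sum>y\<in>I. \<Sum>z\<in>I. f y * f z * C (y - z) x)
      = (\<Sum>y\<in>I. f y * cos (2 * pi * y * x))\<^sup>2 + (\<Sum>y\<in>I. f y * sin (2 * pi * y * x))\<^sup>2"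
    proof -
      have "C (y - z) x = cos (2 * pi * y * x) * cos (2 * pi * z * x) + sin (2 * pi * y * x) * sin (2 * pi * z * x)" for y z
        unfolding C_def using cos_diff[of "2 * pi * y * x" "2 * pi * z * x"] by (simp add: algebra_simps)
      then show ?thesis
        by (simp add: power2_eq_square sum_product sum.distrib[symmetric] algebra_simps)
    qed
    then have "0 \<le> (\<Sum>y\<in>I. \<Sum>z\<in>I. f y * f z * C (y - z) x)" by simp
    then show ?thesis using N v by (simp add: D_def)
  qed
  have C_meas[measurable]: "C m \<in> borel_measurable borel" for m unfolding C_def by measurable
  have D_meas[measurable]: "D \<in> borel_measurable borel" unfolding D_def by measurable
  have C_int: "has_bochner_integral lborel (\<lambda>x. C m x * indicator {0..1} x) (of_bool (m = 0))" for m
    unfolding C_def by (rule has_bochner_integral_cos_unit)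
  \<comment> \<open>The cosine coefficient of the density at \<open>t\<close>. The product formula
    for cosines yields both shifts; the symmetry between y and z later merges them.\<close>
  define R where "R t = (\<Sum>y\<in>I. \<Sum>z\<in>I. f y * f z * ((of_bool (y - z + t = 0) + of_bool (y - z - t = 0)) / 2)) / N + (1 - v) * of_bool (t = 0)" for t :: int
  have DC_int: "has_bochner_integral lborel (\<lambda>x. indicator {0..1} x * D x * C t x) (R t)" for t
  proof -
    have prod: "C m x * C t x = (C (m + t) x + C (m - t) x) / 2" for m x
    proof -
      have "cos (a + b) + cos (a - b) = 2 * (cos a * cos b)" for a b :: real
        by (simp add: cos_add cos_diff)
      from this[of "2 * pi * m * x" "2 * pi * t * x"] show ?thesis
        unfolding C_def by (simp add: algebra_simps)
    qed
    have "has_bochner_integral lborel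
      (\<lambda>x. (\<Sum>y\<in>I. \<Sum>z\<in>I. f y * f z * ((C (y - z + t) x * indicator {0..1} x + C (y - z - t) x * indicator {0..1} x) / 2)) / N
         + (1 - v) * (C t x * indicator {0..1} x)) (R t)"
      unfolding R_def
      by (intro has_bochner_integral_add has_bochner_integral_sum has_bochner_integral_mult_right
          has_bochner_integral_divide_zero C_int)
    moreover have "(\<Sum>y\<in>I. \<Sum>z\<in>I. f y * f z * ((C (y - z + t) x * i + C (y - z - t) x * i) / 2)) / N
         + (1 - v) * (C t x * i) = i * D x * C t x" for x i
    proof -
      have "f y * f z * ((C (y - z + t) x * i + C (y - z - t) x * i) / 2) = i * (f y * f z * C (y - z) x * C t x)" for y z
        using prod[of "y - z" x] by (simp add: algebra_simps)
      then show ?thesis unfolding D_def by (simp add: sum_distrib_left sum_distrib_right algebra_simps)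
    qed
    ultimately show ?thesis by simp
  qed
  define \<mu> where "\<mu> = density lborel (\<lambda>x. ennreal (indicator {0..1} x * D x))"
  have int_\<mu>: "(\<integral>x. g x \<partial>\<mu>) = (\<integral>x. (indicator {0..1} x * D x) * g x \<partial>lborel)"
    if "g \<in> borel_measurable borel" for g :: "real \<Rightarrow> real"
    unfolding \<mu>_def using that D_nonneg by (subst integral_density) (auto intro!: AE_I2)
  have "R 0 = 1"
  proof -
    have "(\<Sum>z\<in>I. f y * f z * ((of_bool (y - z + 0 = 0) + of_bool (y - z - 0 = 0)) / 2)) = (f y)\<^sup>2" if "y \<in> I" for y
    proof -
      have "(\<Sum>z\<in>I. f y * f z * ((of_bool (y - z + 0 = 0) + of_bool (y - z - 0 = 0)) / 2)) = (\<Sum>z\<in>I. if y = z then f y * f z else 0)"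
        by (intro sum.cong) auto
      with that I show ?thesis by (simp add: power2_eq_square)
    qed
    then have "(\<Sum>y\<in>I. \<Sum>z\<in>I. f y * f z * ((of_bool (y - z + 0 = 0) + of_bool (y - z - 0 = 0)) / 2)) = (\<Sum>y\<in>I. (f y)\<^sup>2)"
      by (intro sum.cong) auto
    then show ?thesis by (simp only: R_def v_def) simp
  qed
  then have mass: "has_bochner_integral lborel (\<lambda>x. indicator {0..1} x * D x) 1"
    using DC_int[of 0] by (simp add: C_def)
  have mass': "(\<integral>\<^sup>+x. ennreal (indicator {0..1} x * D x) \<partial>lborel) = 1"
    using mass D_nonneg by (subst nn_integral_eq_integral) (auto simp: has_bochner_integral_iff)
  have em: "emeasure \<mu> A = 1" if [measurable]: "A \<in> sets borel" and "{0..1} \<subseteq> A" for A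
  proof -
    have "emeasure \<mu> A = (\<integral>\<^sup>+x. ennreal (indicator {0..1} x * D x) * indicator A x \<partial>lborel)"
      unfolding \<mu>_def by (rule emeasure_density) auto
    also have "\<dots> = (\<integral>\<^sup>+x. ennreal (indicator {0..1} x * D x) \<partial>lborel)"
      using that(2) by (intro nn_integral_cong) (auto simp: indicator_def)
    finally show ?thesis by (simp add: mass')
  qed
  show thesis
  proof (rule that[of \<mu>])
    have "prob_space \<mu>" by (rule prob_spaceI) (use em[of UNIV] in \<open>simp add: \<mu>_def\<close>)
    then show "real_distribution \<mu>"
      by (simp add: real_distribution_def real_distribution_axioms_def \<mu>_def)
    \<comment> \<open>The half-open interval is the form in which tightness is stated; it contains
      [0, 1], which carries the mass.\<close>
    show "measure \<mu> {-1<..1} = 1" using em[of "{-1<..1}"] by (simp add: measure_def subset_eq)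
    fix t :: int assume t: "t \<noteq> 0"
    have "(\<integral>x. cos (2 * pi * t * x) \<partial>\<mu>) = R t"
      using int_\<mu>[OF C_meas[of t]] DC_int[of t] by (simp add: C_def has_bochner_integral_iff)
    also have "R t = (\<Sum>y\<in>I. \<Sum>z\<in>I. f y * f z * of_bool (y - z = t)) / N"
    proof -
      have "(\<Sum>y\<in>I. \<Sum>z\<in>I. f y * f z * of_bool (y - z + t = 0)) = (\<Sum>y\<in>I. \<Sum>z\<in>I. f y * f z * of_bool (y - z - t = 0))"
        by (subst sum.swap, intro sum.cong refl) (auto simp: of_bool_def)
      then have "(\<Sum>y\<in>I. \<Sum>z\<in>I. f y * f z * ((of_bool (y - z + t = 0) + of_bool (y - z - t = 0)) / 2))
        = (\<Sum>y\<in>I. \<Sum>z\<in>I. f y * f z * of_bool (y - z - t = 0))"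
        by (simp only: add_divide_distrib distrib_left sum.distrib times_divide_eq_right flip: sum_divide_distrib)
      with t show ?thesis by (simp add: R_def)
    qed
    finally show "(\<integral>x. cos (2 * pi * t * x) \<partial>\<mu>) = (\<Sum>y\<in>I. \<Sum>z\<in>I. f y * f z * of_bool (y - z = t)) / card I"
      by (simp add: N_def)
  qed
qed

text \<open>With \<open>e\<close> the actual density on the interval, the autocorrelation of 1_E - e
  at a missed difference has no 1_E 1_E term; what remains is about e^2 - 2 e^2 = - e^2. Each of the
  two mixed terms loses at most |t| points at the ends of the interval.\<close>

lemma interval_spectral_distribution:
  fixes E :: "int set" and a b :: int and d :: real
  assumes ab: "a \<le> b" and d: "0 \<le> d" "d * (b - a + 1) \<le> card (E \<inter> {a..b})"
  obtains \<mu> where "real_distribution \<mu>" "measure \<mu> {-1<..1} = 1"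
    "\<And>t::int. t \<noteq> 0 \<Longrightarrow> \<forall>x\<in>E. \<forall>y\<in>E. x - y \<noteq> t \<Longrightarrow>
       (\<integral>x. cos (2 * pi * t * x) \<partial>\<mu>) \<le> - d\<^sup>2 + 2 * \<bar>t\<bar> / (b - a + 1)"
proof -
  define N where "N = real_of_int (b - a + 1)"
  have N: "0 < N" "N = card {a..b}" using ab by (auto simp: N_def)
  define e where "e = card (E \<inter> {a..b}) / N"
  have "card (E \<inter> {a..b}) \<le> card {a..b}" by (intro card_mono) auto
  then have "e \<le> 1" using N by (simp add: e_def)
  moreover have "d \<le> e" using d(2) N(1) by (simp add: e_def pos_le_divide_eq N_def)
  ultimately have e: "d \<le> e" "0 \<le> e" "e \<le> 1" using d(1) by auto
  define f where "f y = of_bool (y \<in> E) - e" for y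
  have "\<bar>f y\<bar> \<le> 1" for y using e by (auto simp: f_def)
  then obtain \<mu> where \<mu>: "real_distribution \<mu>" "measure \<mu> {-1<..1} = 1"
    "\<And>t::int. t \<noteq> 0 \<Longrightarrow> (\<integral>x. cos (2 * pi * t * x) \<partial>\<mu>) =
      (\<Sum>y\<in>{a..b}. \<Sum>z\<in>{a..b}. f y * f z * of_bool (y - z = t)) / card {a..b}"
    using autocorrelation_distribution[of "{a..b}" f] ab by auto
  show thesis
  proof (rule that[OF \<mu>(1,2)])
    fix t :: int assume t: "t \<noteq> 0" "\<forall>x\<in>E. \<forall>y\<in>E. x - y \<noteq> t"
    have row: "(\<Sum>z\<in>{a..b}. g z * of_bool (y - z = s)) = (if y - s \<in> {a..b} then g (y - s) else 0)" for g :: "int \<Rightarrow> real" and y s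
    proof -
      have "(\<Sum>z\<in>{a..b}. g z * of_bool (y - z = s)) = (\<Sum>z\<in>{a..b}. if z = y - s then g z else 0)"
        by (intro sum.cong) auto
      then show ?thesis by (simp add: sum.delta)
    qed
    \<comment> \<open>At most |s| points of the interval are shifted out of it. Both s = t and s = -
      t are used, one for each mixed term.\<close>
    have many: "e * N - \<bar>s\<bar> \<le> (\<Sum>y\<in>{a..b}. of_bool (y \<in> E) * of_bool (y - s \<in> {a..b}))" for s
    proof -
      have "e * N = card (E \<inter> {a..b})" using N by (simp add: e_def)
      also have "\<dots> \<le> real (card ({y\<in>{a..b}. y \<in> E \<and> y - s \<in> {a..b}} \<union> {y\<in>{a..b}. y - s \<notin> {a..b}}))"
        by (intro of_nat_mono card_mono finite_subset[OF _ finite_atLeastAtMost_int[of a b]]) auto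
      also have "\<dots> \<le> real (card {y\<in>{a..b}. y \<in> E \<and> y - s \<in> {a..b}}) + real (card {y\<in>{a..b}. y - s \<notin> {a..b}})"
        unfolding of_nat_add[symmetric] by (intro of_nat_mono card_Un_le)
      also have "real (card {y\<in>{a..b}. y - s \<notin> {a..b}}) \<le> real_of_int \<bar>s\<bar>"
      proof -
        have "{y\<in>{a..b}. y - s \<notin> {a..b}} \<subseteq> (if 0 \<le> s then {a..<a+s} else {b+s<..b})" by auto
        then have "card {y\<in>{a..b}. y - s \<notin> {a..b}} \<le> card (if 0 \<le> s then {a..<a+s} else {b+s<..b})"
          by (intro card_mono) auto
        also have "\<dots> = nat \<bar>s\<bar>" by auto
        finally show ?thesis by linarith
      qed
      also have "real (card {y\<in>{a..b}. y \<in> E \<and> y - s \<in> {a..b}}) = (\<Sum>y\<in>{a..b}. of_bool (y \<in> E) * of_bool (y - s \<in> {a..b}))"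
      proof -
        have "(\<Sum>y\<in>{a..b}. of_bool (y \<in> E) * of_bool (y - s \<in> {a..b})) = (\<Sum>y\<in>{a..b}. if y \<in> E \<and> y - s \<in> {a..b} then 1 else 0 :: real)"
          by (intro sum.cong) auto
        also have "\<dots> = real (card {y\<in>{a..b}. y \<in> E \<and> y - s \<in> {a..b}})"
          by (subst sum.inter_filter[symmetric]) auto
        finally show ?thesis by simp
      qed
      finally show ?thesis by simp
    qed
    have few: "(\<Sum>y\<in>{a..b}. of_bool (y - t \<in> {a..b})) \<le> N"
    proof -
      have "(\<Sum>y\<in>{a..b}. of_bool (y - t \<in> {a..b})) \<le> (\<Sum>y\<in>{a..b}. 1::real)" by (intro sum_mono) auto
      then show ?thesis using N by simp
    qed
    have prod: "f y * f z * of_bool (y - z = t) =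
      e\<^sup>2 * of_bool (y - z = t) - e * (of_bool (y \<in> E) * of_bool (y - z = t)) - e * (of_bool (z \<in> E) * of_bool (y - z = t))" for y z
      using t(2) by (auto simp: f_def power2_eq_square algebra_simps of_bool_def)
    have A: "(\<Sum>y\<in>{a..b}. \<Sum>z\<in>{a..b}. of_bool (y - z = t)) = (\<Sum>y\<in>{a..b}. of_bool (y - t \<in> {a..b}) :: real)"
      using row[of "\<lambda>_. 1" _ t] by (simp add: of_bool_def)
    have B1: "(\<Sum>y\<in>{a..b}. \<Sum>z\<in>{a..b}. of_bool (y \<in> E) * of_bool (y - z = t)) = (\<Sum>y\<in>{a..b}. of_bool (y \<in> E) * of_bool (y - t \<in> {a..b}) :: real)"
    proof (intro sum.cong refl)
      fix y
      show "(\<Sum>z\<in>{a..b}. of_bool (y \<in> E) * of_bool (y - z = t)) = (of_bool (y \<in> E) * of_bool (y - t \<in> {a..b}) :: real)"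
        using row[of "\<lambda>_. of_bool (y \<in> E)" y t] by simp
    qed
    have B2: "(\<Sum>y\<in>{a..b}. \<Sum>z\<in>{a..b}. of_bool (z \<in> E) * of_bool (y - z = t)) = (\<Sum>z\<in>{a..b}. of_bool (z \<in> E) * of_bool (z - - t \<in> {a..b}) :: real)"
    proof (subst sum.swap, intro sum.cong refl)
      fix z
      have "(\<Sum>y\<in>{a..b}. of_bool (z \<in> E) * of_bool (y - z = t)) = (\<Sum>y\<in>{a..b}. of_bool (z \<in> E) * of_bool (z - y = - t) :: real)"
        by (intro sum.cong refl arg_cong2[where f = "(*)"] arg_cong[where f = of_bool]) auto
      also have "\<dots> = of_bool (z \<in> E) * of_bool (z - - t \<in> {a..b})"
        using row[of "\<lambda>_. of_bool (z \<in> E)" z "- t"] by simp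
      finally show "(\<Sum>y\<in>{a..b}. of_bool (z \<in> E) * of_bool (y - z = t)) = (of_bool (z \<in> E) * of_bool (z - - t \<in> {a..b}) :: real)" .
    qed
    have "(\<Sum>y\<in>{a..b}. \<Sum>z\<in>{a..b}. f y * f z * of_bool (y - z = t))
      = e\<^sup>2 * (\<Sum>y\<in>{a..b}. \<Sum>z\<in>{a..b}. of_bool (y - z = t))
        - e * (\<Sum>y\<in>{a..b}. \<Sum>z\<in>{a..b}. of_bool (y \<in> E) * of_bool (y - z = t))
        - e * (\<Sum>y\<in>{a..b}. \<Sum>z\<in>{a..b}. of_bool (z \<in> E) * of_bool (y - z = t))"
      unfolding prod by (simp only: sum_subtractf sum_distrib_left)
    also have "\<dots> \<le> e\<^sup>2 * N - e * (e * N - \<bar>t\<bar>) - e * (e * N - \<bar>t\<bar>)"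
      unfolding A B1 B2 using few many[of t] many[of "- t"] e
      by (intro diff_mono mult_left_mono) auto
    also have "\<dots> = - e\<^sup>2 * N + e * (2 * \<bar>t\<bar>)" by (simp add: power2_eq_square algebra_simps)
    \<comment> \<open>Uses d \<le> e for the main term and e \<le> 1 for the boundary term.\<close>
    also have "\<dots> \<le> - d\<^sup>2 * N + 1 * (2 * \<bar>t\<bar>)"
      using e d(1) N(1) by (intro add_mono mult_right_mono) (auto intro!: power_mono mult_left_le_one_le)
    finally have "(\<Sum>y\<in>{a..b}. \<Sum>z\<in>{a..b}. f y * f z * of_bool (y - z = t)) / N \<le> (- d\<^sup>2 * N + 1 * (2 * \<bar>t\<bar>)) / N"
      using N(1) by (intro divide_right_mono) auto
    also have "\<dots> = - d\<^sup>2 + 2 * \<bar>t\<bar> / (b - a + 1)" using N(1) by (simp add: field_simps) (simp add: N_def)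
    finally show "(\<integral>x. cos (2 * pi * t * x) \<partial>\<mu>) \<le> - d\<^sup>2 + 2 * \<bar>t\<bar> / (b - a + 1)"
      using \<mu>(3)[OF t(1)] N(2) by simp
  qed
qed

text \<open>All the measures live on [0, 1], so they are tight and a subsequence converges weakly;
  the cosines are bounded and continuous, and the boundary error vanishes as the intervals
  grow.\<close>

lemma density_spectral_distribution:
  fixes E :: "int set" and d :: real
  assumes d: "0 \<le> d"
    and dens: "\<And>L::nat. \<exists>a b::int. a \<le> b \<and> int L \<le> b - a \<and> d * (b - a + 1) \<le> card (E \<inter> {a..b})"
  obtains M where "real_distribution M"
    "\<And>t::int. t \<noteq> 0 \<Longrightarrow> \<forall>x\<in>E. \<forall>y\<in>E. x - y \<noteq> t \<Longrightarrow> (\<integral>x. cos (2 * pi * t * x) \<partial>M) \<le> - d\<^sup>2"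
proof -
  have "\<exists>\<mu>. real_distribution \<mu> \<and> measure \<mu> {-1<..1} = 1 \<and>
    (\<forall>t::int. t \<noteq> 0 \<longrightarrow> (\<forall>x\<in>E. \<forall>y\<in>E. x - y \<noteq> t) \<longrightarrow>
       (\<integral>x. cos (2 * pi * t * x) \<partial>\<mu>) \<le> - d\<^sup>2 + 2 * \<bar>t\<bar> / real (Suc L))" for L
  proof -
    obtain a b where ab: "a \<le> b" "int L \<le> b - a" "d * (b - a + 1) \<le> card (E \<inter> {a..b})"
      using dens by blast
    obtain \<mu> where \<mu>: "real_distribution \<mu>" "measure \<mu> {-1<..1} = 1"
      "\<And>t::int. t \<noteq> 0 \<Longrightarrow> \<forall>x\<in>E. \<forall>y\<in>E. x - y \<noteq> t \<Longrightarrow>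
       (\<integral>x. cos (2 * pi * t * x) \<partial>\<mu>) \<le> - d\<^sup>2 + 2 * \<bar>t\<bar> / (b - a + 1)"
      using interval_spectral_distribution[OF ab(1) d ab(3)] by blast
    have "2 * \<bar>t\<bar> / (b - a + 1) \<le> 2 * \<bar>t\<bar> / real (Suc L)" for t :: int
      using ab(2) by (intro divide_left_mono) auto
    with \<mu> show ?thesis by (meson add_left_mono order_trans)
  qed
  then obtain \<mu> where \<mu>: "\<And>L. real_distribution (\<mu> L)" "\<And>L. measure (\<mu> L) {-1<..1} = 1"
    "\<And>L t::int. t \<noteq> 0 \<Longrightarrow> \<forall>x\<in>E. \<forall>y\<in>E. x - y \<noteq> t \<Longrightarrow>
       (\<integral>x. cos (2 * pi * t * x) \<partial>\<mu> L) \<le> - d\<^sup>2 + 2 * \<bar>t\<bar> / real (Suc L)"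
    by metis
  have "tight \<mu>"
    unfolding tight_def
  proof safe
    fix \<epsilon> :: real assume "0 < \<epsilon>"
    then show "\<exists>a b. a < b \<and> (\<forall>n. 1 - \<epsilon> < measure (\<mu> n) {a<..b})"
      by (intro exI[of _ "-1"] exI[of _ 1]) (simp add: \<mu>(2))
  qed (rule \<mu>(1))
  then obtain r M where r: "strict_mono r" "real_distribution M" "weak_conv_m (\<mu> \<circ> id \<circ> r) M"
    using tight_imp_convergent_subsubsequence[of \<mu> id] by (auto simp: strict_mono_id)
  show thesis
  proof (rule that[OF r(2)])
    fix t :: int assume t: "t \<noteq> 0" "\<forall>x\<in>E. \<forall>y\<in>E. x - y \<noteq> t"
    have "(\<lambda>n. \<integral>x. cos (2 * pi * t * x) \<partial>((\<mu> \<circ> id \<circ> r) n)) \<longlonglongrightarrow> (\<integral>x. cos (2 * pi * t * x) \<partial>M)"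
      by (rule weak_conv_imp_integral_bdd_continuous_conv[OF _ r(2,3), where B = 1]) (auto simp: \<mu>(1))
    moreover have "(\<lambda>n. - d\<^sup>2 + 2 * \<bar>t\<bar> / real (Suc n)) \<longlonglongrightarrow> - d\<^sup>2 + 0"
      by (intro tendsto_intros LIMSEQ_Suc lim_const_over_n)
    moreover have "(\<integral>x. cos (2 * pi * t * x) \<partial>((\<mu> \<circ> id \<circ> r) n)) \<le> - d\<^sup>2 + 2 * \<bar>t\<bar> / real (Suc n)" for n
    proof -
      have "2 * \<bar>t\<bar> / real (Suc (r n)) \<le> 2 * \<bar>t\<bar> / real (Suc n)"
        using seq_suble[OF r(1), of n] by (intro divide_left_mono) auto
      with \<mu>(3)[OF t, of "r n"] show ?thesis by simp
    qed
    ultimately show "(\<integral>x. cos (2 * pi * t * x) \<partial>M) \<le> - d\<^sup>2"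
      by (auto intro: LIMSEQ_le)
  qed
qed

section \<open>IP sets and polynomials\<close>

lemma divisible_block:
  fixes g :: "nat \<Rightarrow> nat"
  assumes "0 < c"
  obtains i j where "n \<le> i" "i < j" "c dvd (\<Sum>t\<in>{i..<j}. g t)"
proof -
  define s where "s i = (\<Sum>t\<in>{n..<n+i}. g t)" for i
  \<comment> \<open>Pigeonhole: c + 1 partial sums have only c possible residues, and the difference
    of two congruent ones is a block.\<close>
  have "\<not> inj_on (\<lambda>i. s i mod c) {..c}"
  proof
    assume "inj_on (\<lambda>i. s i mod c) {..c}"
    then have "card {..c} \<le> card {..<c}"
      by (rule card_inj_on_le) (use assms in auto)
    then show False by simp
  qed
  then obtain a b where ab: "a < b" "s a mod c = s b mod c"
    unfolding inj_on_def by (metis linorder_neqE_nat)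
  have "s b = s a + (\<Sum>t\<in>{n+a..<n+b}. g t)"
    unfolding s_def using ab(1) by (subst sum.atLeastLessThan_concat) auto
  with ab(2) have "c dvd (\<Sum>t\<in>{n+a..<n+b}. g t)"
    using mod_eq_dvd_iff_nat[of "s a" "s b" c] by simp
  with ab(1) show thesis by (intro that[of "n + a" "n + b"]) auto
qed

text \<open>Block sums of \<open>g\<close> over disjoint blocks have their finite sums among those
  of \<open>g\<close>, and every block can be chosen with sum divisible by \<open>c\<close>. The
  lower bound \<open>R\<close> serves to avoid the roots of a polynomial.\<close>

lemma IP_large_divisible:
  assumes "IP_large A" "0 < c"
  obtains h :: "nat \<Rightarrow> nat" where "strict_mono h" "\<And>i. c dvd h i" "\<And>i. R < h i" "finite_sums h \<subseteq> A"
proof -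
  obtain g where g: "strict_mono g" "\<And>i. 0 < g i" "finite_sums g \<subseteq> A"
    using assms(1) by (auto simp: IP_large_def)
  have "\<exists>ij. n \<le> fst ij \<and> fst ij < snd ij \<and> c dvd (\<Sum>t\<in>{fst ij..<snd ij}. g t)" for n
    using divisible_block[OF assms(2), of n g] by (metis fst_conv snd_conv)
  then obtain B where B: "\<And>n. n \<le> fst (B n)" "\<And>n. fst (B n) < snd (B n)"
    "\<And>n. c dvd (\<Sum>t\<in>{fst (B n)..<snd (B n)}. g t)"
    by metis
  define S where "S n = (\<Sum>t\<in>{fst (B n)..<snd (B n)}. g t)" for n
  \<comment> \<open>The next search starts past the end of the block, for disjointness, and past its
    sum, for monotonicity: a block starting at \<open>n k\<close> or later has sum at least
    \<open>n k\<close>. Starting at R + 1 makes all sums exceed \<open>R\<close>.\<close>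
  define n where "n = rec_nat (Suc R) (\<lambda>_ m. snd (B m) + Suc (S m))"
  have n_Suc: "n (Suc k) = snd (B (n k)) + Suc (S (n k))" and n_0: "n 0 = Suc R" for k
    by (simp_all add: n_def)
  define I where "I k = {fst (B (n k))..<snd (B (n k))}" for k
  define h where "h k = S (n k)" for k
  have h_eq: "h k = (\<Sum>t\<in>I k. g t)" for k by (simp add: h_def S_def I_def)
  have g_ge: "i \<le> g i" for i using g(1) by (rule strict_mono_imp_increasing)
  have h_ge: "n k \<le> h k" for k
  proof -
    have "n k \<le> g (fst (B (n k)))" using B(1)[of "n k"] g_ge[of "fst (B (n k))"] by simp
    also have "\<dots> \<le> h k"
      unfolding h_eq using B(2)[of "n k"] by (intro member_le_sum) (auto simp: I_def)
    finally show ?thesis .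
  qed
  have n_mono: "strict_mono n"
    unfolding strict_mono_Suc_iff
  proof
    fix k
    show "n k < n (Suc k)" using B(1,2)[of "n k"] unfolding n_Suc by linarith
  qed
  have end_le: "snd (B (n k)) \<le> n l" if "k < l" for k l
  proof -
    have "snd (B (n k)) \<le> n (Suc k)" by (simp add: n_Suc)
    also have "\<dots> \<le> n l" using that n_mono by (simp add: strict_mono_less_eq)
    finally show ?thesis .
  qed
  have disj: "I k \<inter> I l = {}" if "k < l" for k l
    using end_le[OF that] B(1)[of "n l"] by (auto simp: I_def)
  then have disj': "I k \<inter> I l = {}" if "k \<noteq> l" for k l
    using that by (metis Int_commute linorder_neqE_nat)
  show thesis
  proof (rule that[of h])
    show "strict_mono h"
      unfolding strict_mono_Suc_iff
    proof
      fix k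
      have "h k < n (Suc k)" by (simp add: n_Suc h_def)
      also have "\<dots> \<le> h (Suc k)" by (rule h_ge)
      finally show "h k < h (Suc k)" .
    qed
    show "c dvd h i" for i using B(3) by (simp add: h_def S_def)
    show "R < h i" for i
    proof -
      have "R < n 0" by (simp add: n_0)
      also have "n 0 \<le> n i" using n_mono by (simp add: strict_mono_less_eq)
      also have "\<dots> \<le> h i" by (rule h_ge)
      finally show ?thesis .
    qed
    show "finite_sums h \<subseteq> A"
    proof
      fix x assume "x \<in> finite_sums h"
      then obtain F where F: "finite F" "F \<noteq> {}" "x = (\<Sum>k\<in>F. h k)" by (auto simp: finite_sums_def)
      have "x = (\<Sum>t\<in>(\<Union>k\<in>F. I k). g t)"
        unfolding F(3) h_eq using F(1) disj' by (subst sum.UNION_disjoint) (auto simp: I_def)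
      moreover have "finite (\<Union>k\<in>F. I k)" using F(1) by (auto simp: I_def)
      moreover have "(\<Union>k\<in>F. I k) \<noteq> {}" using F(2) B(2) by (auto simp: I_def)
      ultimately have "x \<in> finite_sums g" by (auto simp: finite_sums_def)
      with g(3) show "x \<in> A" by blast
    qed
  qed
qed

text \<open>For \<open>d\<close> strictly between 0 and the density, an interval sequence attaining
  the density has ratio above \<open>d\<close> infinitely often, while its lengths eventually exceed
  any \<open>L\<close>.\<close>

lemma banach_density_pos_intervals:
  assumes "0 < banach_density E"
  obtains d :: real where "0 < d"
    "\<And>L::nat. \<exists>a b::int. a \<le> b \<and> int L \<le> b - a \<and> d * (b - a + 1) \<le> card (E \<inter> {a..b})"
proof -
  obtain a b where ab: "interval_seq a b" "density_along E a b = banach_density E"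
    using banach_density_attained by blast
  have "0 < density_along E a b" using assms ab by simp
  then obtain d where d: "0 < ereal d" "ereal d < density_along E a b"
    using ereal_dense2 by blast
  show thesis
  proof (rule that[of d])
    show "0 < d" using d by simp
    fix L :: nat
    have "\<exists>\<^sub>F n in sequentially. ereal d < ereal (real (card (E \<inter> {a n..b n})) / real_of_int (b n - a n + 1))"
    proof (rule ccontr)
      assume "\<not> ?thesis"
      then have "\<forall>\<^sub>F n in sequentially. ereal (real (card (E \<inter> {a n..b n})) / real_of_int (b n - a n + 1)) \<le> ereal d"
        by (simp add: frequently_def not_less)
      then have "density_along E a b \<le> ereal d"
        unfolding density_along_def by (rule Limsup_bounded)
      with d(2) show False by simp
    qed
    moreover have "\<forall>\<^sub>F n in sequentially. int L \<le> b n - a n"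
      using ab(1) by (auto simp: interval_seq_def filterlim_at_top)
    ultimately obtain n where n: "ereal d < ereal (real (card (E \<inter> {a n..b n})) / real_of_int (b n - a n + 1))"
        "int L \<le> b n - a n"
      using frequently_ex[OF frequently_eventually_conj] by (metis (no_types, lifting))
    have "a n \<le> b n" using ab(1) by (simp add: interval_seq_def)
    then have "0 < real_of_int (b n - a n + 1)" by linarith
    with n(1) have "d * (b n - a n + 1) \<le> card (E \<inter> {a n..b n})"
      by (simp add: pos_less_divide_eq less_imp_le del: of_int_add of_int_diff)
    with n(2) \<open>a n \<le> b n\<close> show "\<exists>a b::int. a \<le> b \<and> int L \<le> b - a \<and> d * (b - a + 1) \<le> card (E \<inter> {a..b})"
      by blast
  qed
qed

section \<open>Polynomials: roots in one variable, and expansion over words\<close>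

lemma univariate_mpoly_roots_bounded:
  assumes "P \<noteq> 0" "mpoly_vars P \<subseteq> {1}"
  obtains R :: nat where "\<And>y. int R < y 1 \<Longrightarrow> mpoly_eval P y \<noteq> 0"
proof -
  define q where "q = (\<Sum>m\<in>Poly_Mapping.keys P. monom (Poly_Mapping.lookup P m) (Poly_Mapping.lookup m 1))"
  have key_sub: "Poly_Mapping.keys m \<subseteq> {1}" if "m \<in> Poly_Mapping.keys P" for m
    using assms(2) that by (auto simp: mpoly_vars_def)
  \<comment> \<open>Distinct monomials in a single variable have distinct exponents, so no
    coefficients cancel in \<open>q\<close>.\<close>
  have inj: "m = m'" if "m \<in> Poly_Mapping.keys P" "m' \<in> Poly_Mapping.keys P"
    "Poly_Mapping.lookup m 1 = Poly_Mapping.lookup m' 1" for m m'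
  proof (rule poly_mapping_eqI)
    fix i
    show "Poly_Mapping.lookup m i = Poly_Mapping.lookup m' i"
    proof (cases "i = 1")
      case False
      then have "i \<notin> Poly_Mapping.keys m" "i \<notin> Poly_Mapping.keys m'" using that key_sub by blast+
      then show ?thesis by (simp add: in_keys_iff)
    qed (use that in simp)
  qed
  obtain m where m: "m \<in> Poly_Mapping.keys P" using assms(1) by (metis ex_in_conv keys_eq_empty)
  have "coeff q (Poly_Mapping.lookup m 1) = (\<Sum>m'\<in>Poly_Mapping.keys P. if m = m' then Poly_Mapping.lookup P m' else 0)"
    unfolding q_def coeff_sum using inj m by (intro sum.cong) auto
  also have "\<dots> = Poly_Mapping.lookup P m" using m by simp
  finally have "q \<noteq> 0" using m by (auto simp: in_keys_iff)
  then have "finite {x. poly q x = 0}" by (rule poly_roots_finite)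
  then obtain R where R: "\<And>x. poly q x = 0 \<Longrightarrow> x \<le> R"
    by (metis (mono_tags, lifting) bdd_above_finite bdd_above.unfold mem_Collect_eq)
  have eval: "mpoly_eval P y = poly q (y 1)" for y
    unfolding mpoly_eval_def q_def poly_sum poly_monom
  proof (intro sum.cong refl arg_cong2[where f = "(*)"])
    fix m assume "m \<in> Poly_Mapping.keys P"
    then consider "Poly_Mapping.keys m = {}" | "Poly_Mapping.keys m = {1}" using key_sub by blast
    then show "(\<Prod>i\<in>Poly_Mapping.keys m. y i ^ Poly_Mapping.lookup m i) = y 1 ^ Poly_Mapping.lookup m 1"
      by cases (auto simp: in_keys_iff)
  qed
  have "mpoly_eval P y \<noteq> 0" if "int (nat R) < y 1" for y
  proof
    assume "mpoly_eval P y = 0"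
    then have "y 1 \<le> R" by (intro R) (simp only: eval)
    then show False using that by linarith
  qed
  then show thesis by (rule that)
qed

text \<open>Monomials become words with repeated letters, so that expanding a product of sums is a
  recursion on the word and the degree is its length.\<close>

lemma monomial_as_list:
  fixes m :: "nat \<Rightarrow>\<^sub>0 nat"
  obtains l where "set l = Poly_Mapping.keys m"
    "\<And>y :: nat \<Rightarrow> int. (\<Prod>i\<in>Poly_Mapping.keys m. y i ^ Poly_Mapping.lookup m i) = prod_list (map y l)"
proof -
  have "\<exists>l. set l = K \<and> (\<forall>y :: nat \<Rightarrow> int. (\<Prod>i\<in>K. y i ^ Poly_Mapping.lookup m i) = prod_list (map y l))"
    if "finite K" "K \<subseteq> Poly_Mapping.keys m" for K
    using that
  proof (induction K rule: finite_induct)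
    case (insert i K)
    then obtain l where l: "set l = K" "\<And>y :: nat \<Rightarrow> int. (\<Prod>i\<in>K. y i ^ Poly_Mapping.lookup m i) = prod_list (map y l)"
      by auto
    have "0 < Poly_Mapping.lookup m i" using insert.prems by (auto simp: in_keys_iff)
    then show ?case
      using insert.hyps l
      by (intro exI[of _ "replicate (Poly_Mapping.lookup m i) i @ l"]) (simp add: prod_list_replicate)
  qed auto
  from this[of "Poly_Mapping.keys m"] that show thesis by auto
qed

text \<open>The index set is all nonempty words up to a length bound, not just those of
  \<open>P\<close>, because the increments produce shorter words. The empty word is absent since the
  constant term is zero.\<close>

lemma mpoly_eval_as_list_sum:
  assumes "mpoly_vars P \<subseteq> V" "finite V" "Poly_Mapping.lookup P 0 = 0"
  obtains n a where "\<And>y. mpoly_eval P y = (\<Sum>l\<in>{l. set l \<subseteq> V \<and> l \<noteq> [] \<and> length l \<le> n}. a l * prod_list (map y l))"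
proof -
  have "\<exists>l. set l = Poly_Mapping.keys m \<and>
    (\<forall>y :: nat \<Rightarrow> int. (\<Prod>i\<in>Poly_Mapping.keys m. y i ^ Poly_Mapping.lookup m i) = prod_list (map y l))" for m :: "nat \<Rightarrow>\<^sub>0 nat"
    using monomial_as_list[of m] by metis
  then obtain L where L: "\<And>m. set (L m) = Poly_Mapping.keys m"
    "\<And>m. \<And>y :: nat \<Rightarrow> int. (\<Prod>i\<in>Poly_Mapping.keys m. y i ^ Poly_Mapping.lookup m i) = prod_list (map y (L m))"
    by metis
  obtain n where "\<forall>k\<in>(\<lambda>m. length (L m)) ` Poly_Mapping.keys P. k \<le> n"
    using finite_nat_set_iff_bounded_le[of "(\<lambda>m. length (L m)) ` Poly_Mapping.keys P"] by auto
  then have n: "\<And>m. m \<in> Poly_Mapping.keys P \<Longrightarrow> length (L m) \<le> n" by blast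
  define J where "J = {l. set l \<subseteq> V \<and> l \<noteq> [] \<and> length l \<le> n}"
  have J: "finite J"
    by (rule finite_subset[OF _ finite_lists_length_le[OF assms(2), of n]]) (auto simp: J_def)
  have LJ: "L m \<in> J" if "m \<in> Poly_Mapping.keys P" for m
  proof -
    have "m \<noteq> 0" using that assms(3) by (auto simp: in_keys_iff)
    then have "L m \<noteq> []" using L(1)[of m] by (metis keys_eq_empty set_empty)
    moreover have "set (L m) \<subseteq> V" using assms(1) that by (auto simp: L mpoly_vars_def)
    ultimately show ?thesis using n[OF that] by (simp add: J_def)
  qed
  define a where "a l = (\<Sum>m\<in>{m\<in>Poly_Mapping.keys P. L m = l}. Poly_Mapping.lookup P m)" for l
  have "mpoly_eval P y = (\<Sum>l\<in>J. a l * prod_list (map y l))" for y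
  proof -
    have "mpoly_eval P y = (\<Sum>m\<in>Poly_Mapping.keys P. Poly_Mapping.lookup P m * prod_list (map y (L m)))"
      unfolding mpoly_eval_def L(2) ..
    also have "\<dots> = (\<Sum>l\<in>J. \<Sum>m\<in>{m\<in>Poly_Mapping.keys P. L m = l}. Poly_Mapping.lookup P m * prod_list (map y (L m)))"
      using LJ by (intro sum.group[symmetric] J) auto
    also have "\<dots> = (\<Sum>l\<in>J. a l * prod_list (map y l))"
      unfolding a_def sum_distrib_right by (intro sum.cong refl) auto
    finally show ?thesis .
  qed
  then show thesis unfolding J_def by (rule that)
qed

text \<open>The coefficients are chosen before \<open>z\<close>: with \<open>y\<close> belonging to
  \<beta> and \<open>z\<close> to \<alpha>, they may depend on \<beta> only.\<close>

lemma prod_list_add_expansion: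
  fixes y z :: "nat \<Rightarrow> int"
  assumes "set l \<subseteq> V" "finite V"
  shows "\<exists>c. \<forall>z. prod_list (map (\<lambda>i. y i + z i) l) =
    prod_list (map z l) + (\<Sum>s\<in>{s. set s \<subseteq> V \<and> length s < length l}. c s * prod_list (map z s))"
  using assms(1)
proof (induction l)
  case Nil
  then show ?case by simp
next
  case (Cons i l)
  define K where "K n = {s. set s \<subseteq> V \<and> length s < n}" for n
  have K: "finite (K n)" for n
    by (rule finite_subset[OF _ finite_lists_length_le[OF assms(2), of n]]) (auto simp: K_def)
  obtain c where c: "\<And>z. prod_list (map (\<lambda>i. y i + z i) l) =
    prod_list (map z l) + (\<Sum>s\<in>K (length l). c s * prod_list (map z s))"
    using Cons by (auto simp: K_def)
  \<comment> \<open>Multiplying the expansion for \<open>l\<close> by y_i + z_i gives, besides the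
    new leading word, y_i times the shorter words, y_i times \<open>l\<close>, and the letter
    \<open>i\<close> put before each shorter word.\<close>
  define c' where "c' s = (if s \<in> K (length l) then y i * c s else 0) + (if s = l then y i else 0)
    + (if s \<noteq> [] \<and> hd s = i \<and> tl s \<in> K (length l) then c (tl s) else 0)" for s
  have i: "i \<in> V" "l \<in> K (Suc (length l))" using Cons.prems by (auto simp: K_def)
  have sub: "K (length l) \<subseteq> K (Suc (length l))" by (auto simp: K_def)
  have "prod_list (map (\<lambda>i. y i + z i) (i # l)) =
    prod_list (map z (i # l)) + (\<Sum>s\<in>K (length (i # l)). c' s * prod_list (map z s))" for z
  proof -
    let ?w = "\<lambda>s. prod_list (map z s)"
    have 1: "(\<Sum>s\<in>K (Suc (length l)). (if s \<in> K (length l) then y i * c s else 0) * ?w s) = y i * (\<Sum>s\<in>K (length l). c s * ?w s)"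
    proof -
      have "(\<Sum>s\<in>K (Suc (length l)). (if s \<in> K (length l) then y i * c s else 0) * ?w s)
        = (\<Sum>s\<in>K (length l). (if s \<in> K (length l) then y i * c s else 0) * ?w s)"
        using sub K by (intro sum.mono_neutral_right) auto
      also have "\<dots> = y i * (\<Sum>s\<in>K (length l). c s * ?w s)"
        by (simp add: sum_distrib_left mult.assoc)
      finally show ?thesis .
    qed
    have 2: "(\<Sum>s\<in>K (Suc (length l)). (if s = l then y i else 0) * ?w s) = y i * ?w l"
    proof -
      have "(\<Sum>s\<in>K (Suc (length l)). (if s = l then y i else 0) * ?w s) = (\<Sum>s\<in>K (Suc (length l)). if s = l then y i * ?w s else 0)"
        by (intro sum.cong) auto
      then show ?thesis using i K by simp
    qed
    have 3: "(\<Sum>s\<in>K (Suc (length l)). (if s \<noteq> [] \<and> hd s = i \<and> tl s \<in> K (length l) then c (tl s) else 0) * ?w s)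
      = z i * (\<Sum>s\<in>K (length l). c s * ?w s)"
    proof -
      have "(\<Sum>s\<in>K (Suc (length l)). (if s \<noteq> [] \<and> hd s = i \<and> tl s \<in> K (length l) then c (tl s) else 0) * ?w s)
        = (\<Sum>s\<in>(#) i ` K (length l). (if s \<noteq> [] \<and> hd s = i \<and> tl s \<in> K (length l) then c (tl s) else 0) * ?w s)"
      proof (intro sum.mono_neutral_right K ballI)
        show "(#) i ` K (length l) \<subseteq> K (Suc (length l))" using i by (auto simp: K_def)
        fix s assume "s \<in> K (Suc (length l)) - (#) i ` K (length l)"
        then have "\<not> (s \<noteq> [] \<and> hd s = i \<and> tl s \<in> K (length l))"
          by (metis DiffD2 image_eqI list.collapse)
        then show "(if s \<noteq> [] \<and> hd s = i \<and> tl s \<in> K (length l) then c (tl s) else 0) * ?w s = 0"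
          by (simp only: if_False mult_zero_left)
      qed
      also have "\<dots> = (\<Sum>s\<in>K (length l). c s * (z i * ?w s))"
        by (subst sum.reindex) auto
      finally show ?thesis by (simp add: sum_distrib_left mult_ac)
    qed
    have "(\<Sum>s\<in>K (length (i # l)). c' s * ?w s) = y i * (\<Sum>s\<in>K (length l). c s * ?w s) + y i * ?w l + z i * (\<Sum>s\<in>K (length l). c s * ?w s)"
      unfolding c'_def distrib_right sum.distrib using 1 2 3 by simp
    then show ?thesis by (simp add: c distrib_left distrib_right)
  qed
  then show ?case unfolding K_def by blast
qed

text \<open>Setting z = 0 identifies the coefficient of the empty word as the product of the
  \<open>y\<close>, which is the value at \<beta> alone.\<close>

lemma prod_list_add_expansion_nonempty:
  fixes y :: "nat \<Rightarrow> int"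
  assumes "set l \<subseteq> V" "finite V" "l \<noteq> []"
  shows "\<exists>c. \<forall>z. prod_list (map (\<lambda>i. y i + z i) l) = prod_list (map y l) + prod_list (map z l) +
    (\<Sum>s\<in>{s. set s \<subseteq> V \<and> s \<noteq> [] \<and> length s < length l}. c s * prod_list (map z s))"
proof -
  obtain c where c: "\<And>z. prod_list (map (\<lambda>i. y i + z i) l) =
    prod_list (map z l) + (\<Sum>s\<in>{s. set s \<subseteq> V \<and> length s < length l}. c s * prod_list (map z s))"
    using prod_list_add_expansion[OF assms(1,2)] by blast
  define K where "K = {s. set s \<subseteq> V \<and> s \<noteq> [] \<and> length s < length l}"
  have K: "finite K" "[] \<notin> K"
    by (rule finite_subset[OF _ finite_lists_length_le[OF assms(2), of "length l"]]) (auto simp: K_def)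
  have ins: "{s. set s \<subseteq> V \<and> length s < length l} = insert [] K"
    using assms(3) by (auto simp: K_def)
  have zero: "prod_list (map (\<lambda>_. 0::int) s) = 0" if "s \<noteq> []" for s :: "nat list"
    using that by (cases s) auto
  have "(\<Sum>s\<in>K. c s * prod_list (map (\<lambda>_. 0) s)) = 0"
  proof (intro sum.neutral ballI)
    fix s assume "s \<in> K"
    with K(2) have "s \<noteq> []" by auto
    from zero[OF this] show "c s * prod_list (map (\<lambda>_. 0) s) = 0" by simp
  qed
  then have "prod_list (map y l) = c []"
    using c[of "\<lambda>_. 0"] assms(3) K by (simp add: ins zero)
  with c K show ?thesis unfolding K_def[symmetric] by (auto simp: ins add_ac)
qed

section \<open>Polynomial recurrence\<close>

text \<open>The limit of the integrals of the characters at P(\<eta>(\<alpha>)) / c is a measure,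
  while a missed difference keeps each real part at most - d^2. \<open>H i\<close> lists the terms
  whose sum over \<alpha> is substituted for the i-th variable.\<close>

lemma polynomial_recurrence:
  fixes H :: "nat \<Rightarrow> nat \<Rightarrow> int" and c :: int and E :: "int set" and d :: real
  assumes c: "c \<noteq> 0" and P: "mpoly_vars P \<subseteq> V" "finite V" "Poly_Mapping.lookup P 0 = 0"
    and H: "\<And>i j. i \<in> V \<Longrightarrow> c dvd H i j" and d: "0 < d"
    and dens: "\<And>L::nat. \<exists>a b::int. a \<le> b \<and> int L \<le> b - a \<and> d * (b - a + 1) \<le> card (E \<inter> {a..b})"
  obtains \<alpha> x y where "finite \<alpha>" "\<alpha> \<noteq> {}" "x \<in> E" "y \<in> E"
    "c * (x - y) = mpoly_eval P (\<lambda>i. \<Sum>j\<in>\<alpha>. H i j)"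
proof (rule ccontr)
  assume "\<not> thesis"
  with that have none: "c * (x - y) \<noteq> mpoly_eval P (\<lambda>i. \<Sum>j\<in>\<alpha>. H i j)"
    if "finite \<alpha>" "\<alpha> \<noteq> {}" "x \<in> E" "y \<in> E" for \<alpha> x y
    using that by blast
  obtain M where M: "real_distribution M" and
    M_le: "\<And>t::int. t \<noteq> 0 \<Longrightarrow> \<forall>x\<in>E. \<forall>y\<in>E. x - y \<noteq> t \<Longrightarrow> (\<integral>x. cos (2 * pi * t * x) \<partial>M) \<le> - d\<^sup>2"
    using density_spectral_distribution[OF less_imp_le[OF d] dens] by blast
  obtain p :: "nat set filter" where p: "p \<noteq> bot"
    "\<And>P. eventually P p \<or> eventually (\<lambda>x. \<not> P x) p"
    "\<And>P. eventually P p \<Longrightarrow> \<forall>\<^sub>F \<beta> in p. \<forall>\<^sub>F \<alpha> in p. P (\<beta> \<union> \<alpha>)"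
    and fin: "\<forall>\<^sub>F \<alpha> in p. finite \<alpha> \<and> \<alpha> \<noteq> {}" and tail: "\<And>n. \<forall>\<^sub>F \<alpha> in p. \<forall>i\<in>\<alpha>. n \<le> i"
    using idempotent_ultrafilter_exists by blast
  interpret real_distribution M by (rule M)
  interpret prob_ultrafilter M p
    using p by unfold_locales auto
  obtain n a where eval: "\<And>y. mpoly_eval P y = (\<Sum>l\<in>{l. set l \<subseteq> V \<and> l \<noteq> [] \<and> length l \<le> n}. a l * prod_list (map y l))"
    using mpoly_eval_as_list_sum[OF P] by blast
  define J where "J = {l. set l \<subseteq> V \<and> l \<noteq> [] \<and> length l \<le> n}"
  have J: "finite J"
    by (rule finite_subset[OF _ finite_lists_length_le[OF P(2), of n]]) (auto simp: J_def)
  define Y where "Y \<alpha> i = (\<Sum>j\<in>\<alpha>. H i j)" for \<alpha> i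
  have Y_Un: "Y (\<beta> \<union> \<alpha>) = (\<lambda>i. Y \<beta> i + Y \<alpha> i)" if "finite \<beta>" "finite \<alpha>" "\<beta> \<inter> \<alpha> = {}" for \<alpha> \<beta>
    using that by (simp add: Y_def fun_eq_iff sum.union_disjoint)
  define w where "w l \<alpha> = prod_list (map (Y \<alpha>) l)" for l \<alpha>
  have "\<forall>\<^sub>F \<beta> in p. \<forall>l\<in>J. \<exists>b. \<forall>\<^sub>F \<alpha> in p.
      w l (\<beta> \<union> \<alpha>) = w l \<beta> + w l \<alpha> + (\<Sum>s\<in>{s\<in>J. length s < length l}. b s * w s \<alpha>)"
    using fin
  proof eventually_elim
    case (elim \<beta>)
    show ?case
    proof
      fix l assume l: "l \<in> J"
      obtain b where b: "\<And>z. prod_list (map (\<lambda>i. Y \<beta> i + z i) l) = prod_list (map (Y \<beta>) l) + prod_list (map z l) +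
        (\<Sum>s\<in>{s. set s \<subseteq> V \<and> s \<noteq> [] \<and> length s < length l}. b s * prod_list (map z s))"
        using prod_list_add_expansion_nonempty[of l V "Y \<beta>"] l P(2) by (auto simp: J_def)
      have "{s. set s \<subseteq> V \<and> s \<noteq> [] \<and> length s < length l} = {s\<in>J. length s < length l}"
        using l by (auto simp: J_def)
      note b = b[unfolded this]
      have "\<forall>\<^sub>F \<alpha> in p. w l (\<beta> \<union> \<alpha>) = w l \<beta> + w l \<alpha> + (\<Sum>s\<in>{s\<in>J. length s < length l}. b s * w s \<alpha>)"
        \<comment> \<open>Beyond the maximum of \<beta> the two sets are disjoint, so the sums over
          their union add.\<close>
        using fin tail[of "Suc (Max \<beta>)"]
      proof eventually_elim
        fix \<alpha> assume \<alpha>: "finite \<alpha> \<and> \<alpha> \<noteq> {}" "\<forall>i\<in>\<alpha>. Suc (Max \<beta>) \<le> i"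
        have "\<beta> \<inter> \<alpha> = {}"
        proof (rule ccontr)
          assume "\<beta> \<inter> \<alpha> \<noteq> {}"
          then obtain i where "i \<in> \<beta>" "i \<in> \<alpha>" by blast
          then have "Suc (Max \<beta>) \<le> i" "i \<le> Max \<beta>" using elim \<alpha>(2) by auto
          then show False by simp
        qed
        with elim \<alpha> show "w l (\<beta> \<union> \<alpha>) = w l \<beta> + w l \<alpha> + (\<Sum>s\<in>{s\<in>J. length s < length l}. b s * w s \<alpha>)"
          using b[of "Y \<alpha>"] by (simp add: w_def Y_Un)
      qed
      then show "\<exists>b. \<forall>\<^sub>F \<alpha> in p. w l (\<beta> \<union> \<alpha>) = w l \<beta> + w l \<alpha> + (\<Sum>s\<in>{s\<in>J. length s < length l}. b s * w s \<alpha>)" by blast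
    qed
  qed
  \<comment> \<open>The scaling by 1 / c makes the character at P(\<eta>) equal to the one of
    integer frequency P(\<eta>) / c.\<close>
  from weak_lim_triangular[OF _ J this, of "\<lambda>x. 2 * pi * x / c" a]
  obtain T where T: "T \<in> sets M"
    "weak_lim (\<lambda>\<alpha> x. cis (2 * pi * x / c * of_int (\<Sum>l\<in>J. a l * w l \<alpha>))) (indicator T)"
    by auto
  have eval': "(\<Sum>l\<in>J. a l * w l \<alpha>) = mpoly_eval P (Y \<alpha>)" for \<alpha>
    unfolding eval J_def w_def ..
  have lim: "((\<lambda>\<alpha>. Re (\<integral>x. cis (2 * pi * x / c * of_int (mpoly_eval P (Y \<alpha>))) \<partial>M)) \<longlongrightarrow> measure M T) p"
    using tendsto_Re[OF weak_lim_indicator_integral[OF T(2,1)]] by (simp add: eval' del: of_int_sum)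
  have "\<forall>\<^sub>F \<alpha> in p. Re (\<integral>x. cis (2 * pi * x / c * of_int (mpoly_eval P (Y \<alpha>))) \<partial>M) \<le> - d\<^sup>2"
    using fin
  proof eventually_elim
    case (elim \<alpha>)
    have "c dvd w l \<alpha>" if "l \<in> J" for l
    proof -
      obtain i s where "l = i # s" "i \<in> V" using \<open>l \<in> J\<close> by (cases l) (auto simp: J_def)
      moreover have "c dvd Y \<alpha> i" using \<open>i \<in> V\<close> H by (auto simp: Y_def intro: dvd_sum)
      ultimately show ?thesis by (simp add: w_def)
    qed
    \<comment> \<open>Every word has a first letter, whose factor is a multiple of
      \<open>c\<close>.\<close>
    then have "c dvd (\<Sum>l\<in>J. a l * w l \<alpha>)" by (intro dvd_sum dvd_mult)
    then obtain t where t: "mpoly_eval P (Y \<alpha>) = c * t" unfolding eval' by (elim dvdE)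
    have nt: "\<forall>x\<in>E. \<forall>y\<in>E. x - y \<noteq> t"
    proof (intro ballI notI)
      fix x y assume "x \<in> E" "y \<in> E" "x - y = t"
      with none[of \<alpha> x y] elim t show False unfolding Y_def by simp
    qed
    \<comment> \<open>Positive density makes \<open>E\<close> nonempty, so 0 is a difference and the
      missed value \<open>t\<close> is nonzero, as the spectral bound requires.\<close>
    obtain a b :: int where ab: "a \<le> b" "d * (b - a + 1) \<le> card (E \<inter> {a..b})" using dens[of 0] by blast
    have "0 < d * (b - a + 1)" using d ab(1) by (intro mult_pos_pos) linarith+
    with ab(2) have "0 < card (E \<inter> {a..b})" by linarith
    then obtain x where "x \<in> E" by (auto simp: card_gt_0_iff)
    then have "x - x \<noteq> t" using nt by blast
    then have "t \<noteq> 0" by simp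
    have "integrable M (\<lambda>x. cis (2 * pi * t * x))"
      by (rule integrable_bounded[where K = 1]) simp_all
    then have "Re (\<integral>x. cis (2 * pi * t * x) \<partial>M) = (\<integral>x. cos (2 * pi * t * x) \<partial>M)"
      by (simp flip: integral_Re)
    moreover have "2 * pi * x / c * of_int (c * t) = 2 * pi * t * x" for x :: real using c by simp
    ultimately show ?case using M_le[OF \<open>t \<noteq> 0\<close> nt] by (simp only: t)
  qed
  with lim have "measure M T \<le> - d\<^sup>2" by (rule tendsto_upperbound) (rule p(1))
  with d measure_nonneg[of M T] show False by (smt (verit) zero_less_power)
qed

theorem theorem2p5:
  fixes c :: int and k :: nat and P :: int_mpoly and A :: "nat set"
  assumes "c \<noteq> 0"
    and "1 \<le> k"
    and "mpoly_vars P \<subseteq> {1..k}"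
    and "Poly_Mapping.lookup P 0 = 0"
    and "A \<subseteq> {1..}"
    and "IP_large A"
    and "0 < banach_density (int ` A)"
  shows "(\<exists>\<xi>1\<in>A. \<exists>\<xi>2\<in>A. \<exists>\<eta>. \<eta> ` {1..k} \<subseteq> A \<and> inj_on \<eta> {1..k} \<and>
            c * (int \<xi>1 - int \<xi>2) = mpoly_eval P (\<lambda>i. int (\<eta> i))) \<and>
         (k = 1 \<and> P \<noteq> 0 \<longrightarrow>
            (\<exists>\<xi>1\<in>A. \<exists>\<xi>2\<in>A. \<exists>\<eta>. \<eta> ` {1..k} \<subseteq> A \<and> inj_on \<eta> {1..k} \<and>
              c * (int \<xi>1 - int \<xi>2) = mpoly_eval P (\<lambda>i. int (\<eta> i)) \<and> \<xi>1 \<noteq> \<xi>2))"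
proof -
  \<comment> \<open>For the clause on one variable: beyond \<open>R\<close> the polynomial has no
    zero.\<close>
  have "\<exists>R. k = 1 \<and> P \<noteq> 0 \<longrightarrow> (\<forall>y. int R < y 1 \<longrightarrow> mpoly_eval P y \<noteq> 0)"
  proof (cases "k = 1 \<and> P \<noteq> 0")
    case True
    then obtain R where "\<And>y. int R < y 1 \<Longrightarrow> mpoly_eval P y \<noteq> 0"
      using univariate_mpoly_roots_bounded[of P] assms(3) by auto
    then show ?thesis by blast
  qed auto
  then obtain R where R: "\<And>y. k = 1 \<Longrightarrow> P \<noteq> 0 \<Longrightarrow> int R < y 1 \<Longrightarrow> mpoly_eval P y \<noteq> 0" by blast
  obtain h :: "nat \<Rightarrow> nat" where h: "strict_mono h" "\<And>i. nat \<bar>c\<bar> dvd h i" "\<And>i. R < h i" "finite_sums h \<subseteq> A"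
    using IP_large_divisible[OF assms(6), of "nat \<bar>c\<bar>" R] assms(1) by auto
  obtain d :: real where d: "0 < d"
    "\<And>L::nat. \<exists>a b::int. a \<le> b \<and> int L \<le> b - a \<and> d * (b - a + 1) \<le> card (int ` A \<inter> {a..b})"
    using banach_density_pos_intervals[OF assms(7)] by blast
  \<comment> \<open>The i-th subsequence takes the indices congruent to \<open>i\<close> modulo k +
    1, so those for i = 1, ..., k are disjoint.\<close>
  have dvd: "c dvd int (h ((k + 1) * j + i))" for i j
    using h(2)[of "(k + 1) * j + i"] by (simp add: nat_abs_dvd_iff)
  obtain \<alpha> x y where \<alpha>: "finite \<alpha>" "\<alpha> \<noteq> {}" and xy: "x \<in> int ` A" "y \<in> int ` A"
    and eq: "c * (x - y) = mpoly_eval P (\<lambda>i. \<Sum>j\<in>\<alpha>. int (h ((k + 1) * j + i)))"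
    by (rule polynomial_recurrence[OF assms(1,3) finite_atLeastAtMost assms(4) dvd d]) (rule that)
  obtain \<xi>1 \<xi>2 where \<xi>: "\<xi>1 \<in> A" "\<xi>2 \<in> A" "x = int \<xi>1" "y = int \<xi>2" using xy by auto
  define \<eta> where "\<eta> i = (\<Sum>j\<in>\<alpha>. h ((k + 1) * j + i))" for i
  have "\<eta> i \<in> A" for i
  proof -
    have "inj_on (\<lambda>j. (k + 1) * j + i) \<alpha>"
      by (intro inj_onI) (simp only: add_right_cancel mult_cancel1, simp)
    then have "\<eta> i = (\<Sum>t\<in>(\<lambda>j. (k + 1) * j + i) ` \<alpha>. h t)"
      unfolding \<eta>_def by (simp add: sum.reindex)
    then have "\<eta> i \<in> finite_sums h" using \<alpha> unfolding finite_sums_def by blast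
    with h(4) show ?thesis by blast
  qed
  \<comment> \<open>For each \<open>j\<close> the term grows strictly with \<open>i\<close>; sums
    over the same nonempty \<alpha> therefore compare term by term, which makes the values
    distinct.\<close>
  moreover have "strict_mono \<eta>"
    unfolding \<eta>_def using \<alpha> h(1) by (intro strict_monoI sum_strict_mono) (auto simp: strict_mono_less)
  then have "inj_on \<eta> {1..k}" by (rule strict_mono_imp_inj_on)
  moreover have eq': "c * (int \<xi>1 - int \<xi>2) = mpoly_eval P (\<lambda>i. int (\<eta> i))"
    using eq \<xi> by (simp add: \<eta>_def)
  \<comment> \<open>The sum is at least one of its terms, hence beyond every root; so c (\<xi>1 -
    \<xi>2) is nonzero.\<close>
  moreover have "\<xi>1 \<noteq> \<xi>2" if "k = 1" "P \<noteq> 0"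
  proof -
    obtain j where "j \<in> \<alpha>" using \<alpha> by blast
    then have "h ((k + 1) * j + 1) \<le> \<eta> 1"
      unfolding \<eta>_def using \<alpha>(1) by (intro member_le_sum) auto
    with h(3)[of "(k + 1) * j + 1"] have "int R < int (\<eta> 1)" by linarith
    with R[OF that, of "\<lambda>i. int (\<eta> i)"] eq' show ?thesis by auto
  qed
  ultimately show ?thesis using \<xi>(1,2) by (metis image_subsetI)
qed

end
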